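(* For every $w\in S_\mathbb{Z}$, $$\Delta(\overleftarrow{\mathfrak{S}}_w)=\sum_{w\doteq xy}F_x\otimes\overleftarrow{\mathfrak{S}}_y\qquad\text{and}\qquad \overleftarrow{\mathfrak{S}}_w=\sum_{\substack{w\doteq xy\\ y\in S_{\neq0}}}F_x\,\mathfrak{S}_y,$$ where the sums run over factorizations $w=xy$ with $x,y\in S_\mathbb{Z}$.
   Context: $S_\mathbb{Z}$ is the group of permutations of $\mathbb{Z}$ fixing all but finitely many integers, generated by $s_i$ ($i\in\mathbb{Z}$) exchanging $i,i+1$; $\ell$ is length; $z\doteq xy$ means $z=xy$ and $\ell(z)=\ell(x)+\ell(y)$. $S_+$ (resp. $S_-$) is generated by $s_i$, $i\ge1$ (resp. $i\le-1$), and $S_{\ne0}=S_-\times S_+$. For $v\in S_+$, $\mathfrak{S}_v\in\mathbb{Q}[x_1,x_2,\dots]$ is the usual Schubert polynomial. Let $\omega$ be the automorphism of $S_\mathbb{Z}$ with $s_i\mapsto s_{-i}$ and the ring automorphism of $\mathbb{Q}[x]=\mathbb{Q}[x_i\mid i\in\mathbb{Z}]$ with $x_i\mapsto -x_{1-i}$; for $u\in S_-$ put $\mathfrak{S}_u=\omega(\mathfrak{S}_{\omega(u)})$, and for $y=uv$ with $u\in S_-$, $v\in S_+$ put $\mathfrak{S}_y=\mathfrak{S}_u\mathfrak{S}_v$. $\Lambda$ is the $\mathbb{Q}$-Hopf algebra of symmetric functions in $x_i$, $i\le0$, with primitive power sums $p_k=\sum_{i\le0}x_i^k$. $\overleftarrow{R}=\Lambda\otimes_\mathbb{Q}\mathbb{Q}[x]$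 (a polynomial ring in the $p_k$ and the $x_i$, identified with back symmetric formal power series), and $\Delta:\overleftarrow{R}\to\Lambda\otimes\overleftarrow{R}$ is the coaction given by the coproduct on the factor $\Lambda$. The back stable Schubert polynomial $\overleftarrow{\mathfrak{S}}_w\in\overleftarrow{R}$ is $\sum_{a_1\cdots a_\ell\in R(w)}\sum x_{b_1}\cdots x_{b_\ell}$, inner sum over integers $b_1\le\cdots\le b_\ell$ with $b_i\le a_i$ and $b_i<b_{i+1}$ whenever $a_i<a_{i+1}$ ($R(w)$ the reduced words of $w$); it equals the limit as $p\to-\infty,q\to\infty$ of Schubert polynomials of $w$ in variables $x_p,\dots,x_q$. Let $\eta_0:\overleftarrow{R}=\Lambda\otimes\mathbb{Q}[x]\to\Lambda$ be the $\Lambda$-algebra map sending every polynomial generator $x_i\in\mathbb{Q}[x]$ to $0$ (it does not touch symmetric functions). The Stanley symmetric function is $F_w:=\eta_0(\overleftarrow{\mathfrak{S}}_w)\in\Lambda$. *)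

theory Defs
  imports
    Complex_Main
    "HOL-Library.Poly_Mapping"
    "HOL-Combinatorics.Perm"
begin

unbundle permutation_syntax

section \<open>The group of finitely supported permutations of the integers\<close>

text \<open>
  The type \<open>int perm\<close> is $S_{\mathbb{Z}}$; its product is composition, so
  $(s_i s_j)(k) = s_i(s_j(k))$.
\<close>

definition simple_refl :: "int \<Rightarrow> int perm" where
  "simple_refl i = \<langle>i \<leftrightarrow> i + 1\<rangle>"

definition word_prod :: "int list \<Rightarrow> int perm" where
  "word_prod as = prod_list (map simple_refl as)"

definition len :: "int perm \<Rightarrow> nat" where
  "len w = (LEAST n. \<exists>as. length as = n \<and> word_prod as = w)"

definition reduced_words :: "int perm \<Rightarrow> int list set" where
  "reduced_words w = {as. word_prod as = w \<and> length as = len w}"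

definition reduced_product :: "int perm \<Rightarrow> int perm \<Rightarrow> int perm \<Rightarrow> bool" where
  "reduced_product z x y \<longleftrightarrow> z = x * y \<and> len z = len x + len y"

text \<open>The generators are involutions, so the submonoids below are the generated subgroups.\<close>

definition S_pos :: "int perm set" where
  "S_pos = {word_prod as | as. \<forall>i\<in>set as. i \<ge> 1}"

definition S_neg :: "int perm set" where
  "S_neg = {word_prod as | as. \<forall>i\<in>set as. i \<le> -1}"

definition S_nonzero :: "int perm set" where
  "S_nonzero = {u * v | u v. u \<in> S_neg \<and> v \<in> S_pos}"

text \<open>The automorphism $\omega$ is conjugation by the reflection $i \mapsto 1 - i$.\<close>

lift_definition omega_perm :: "int perm \<Rightarrow> int perm" is "\<lambda>w i. 1 - w (1 - i)"
proof -
  fix w :: "int \<Rightarrow> int"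
  assume "bij w \<and> finite {a. w a \<noteq> a}"
  then have w: "bij w" and fin: "finite {a. w a \<noteq> a}" by auto
  have r: "bij (\<lambda>i::int. 1 - i)"
    by (rule bij_betw_byWitness[where f' = "\<lambda>i. 1 - i"]) auto
  have "bij ((\<lambda>i. 1 - i) \<circ> w \<circ> (\<lambda>i. 1 - i))"
    using w r by (intro bij_comp)
  moreover have "{i. 1 - w (1 - i) \<noteq> i} \<subseteq> (\<lambda>i. 1 - i) ` {a. w a \<noteq> a}"
  proof
    fix i assume "i \<in> {i. 1 - w (1 - i) \<noteq> i}"
    then have "1 - i \<in> {a. w a \<noteq> a}" by auto
    then have "1 - (1 - i) \<in> (\<lambda>i. 1 - i) ` {a. w a \<noteq> a}" by (rule imageI)
    then show "i \<in> (\<lambda>i. 1 - i) ` {a. w a \<noteq> a}" by simp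
  qed
  then have "finite {i. 1 - w (1 - i) \<noteq> i}"
    using fin by (meson finite_imageI finite_subset)
  ultimately show "bij (\<lambda>i. 1 - w (1 - i)) \<and> finite {a. 1 - w (1 - a) \<noteq> a}"
    by (simp add: comp_def)
qed

lemma omega_perm_simple_refl: "omega_perm (simple_refl i) = simple_refl (- i)"
  by (rule perm_eqI)
    (simp add: omega_perm.rep_eq simple_refl_def Perm.swap.rep_eq transpose_def)

lemma omega_perm_mult: "omega_perm (v * w) = omega_perm v * omega_perm w"
  by (rule perm_eqI) (simp add: omega_perm.rep_eq apply_times)

section \<open>Polynomials\<close>

type_synonym 'v mpoly = "('v \<Rightarrow>\<^sub>0 nat) \<Rightarrow>\<^sub>0 rat"

definition Var :: "'v \<Rightarrow> 'v mpoly" where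
  "Var v = Poly_Mapping.single (Poly_Mapping.single v 1) 1"

text \<open>Evaluation at \<open>f\<close> in a ring into which the rationals are mapped by \<open>c\<close>.\<close>

definition peval :: "(rat \<Rightarrow> 'r) \<Rightarrow> ('v \<Rightarrow> 'r) \<Rightarrow> 'v mpoly \<Rightarrow> 'r::comm_ring_1" where
  "peval c f p =
    (\<Sum>m\<in>Poly_Mapping.keys p. c (Poly_Mapping.lookup p m) *
       (\<Prod>v\<in>Poly_Mapping.keys m. f v ^ Poly_Mapping.lookup m v))"

definition psubst :: "('v \<Rightarrow> 'w mpoly) \<Rightarrow> 'v mpoly \<Rightarrow> 'w mpoly" where
  "psubst = peval (Poly_Mapping.single 0)"

section \<open>Schubert polynomials\<close>

text \<open>Polynomials in the variables $x_i$, $i \in \mathbb{Z}$, have type \<open>int mpoly\<close>.\<close>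

definition swap_vars :: "int \<Rightarrow> int mpoly \<Rightarrow> int mpoly" where
  "swap_vars i = psubst (\<lambda>j. Var (simple_refl i \<langle>$\<rangle> j))"

text \<open>The divided difference $\partial_i f = (f - s_i f) / (x_i - x_{i+1})$.\<close>

definition ddiff :: "int \<Rightarrow> int mpoly \<Rightarrow> int mpoly" where
  "ddiff i f = (THE g. (Var i - Var (i + 1)) * g = f - swap_vars i f)"

lift_definition longest :: "nat \<Rightarrow> int perm" is
  "\<lambda>n i. if 1 \<le> i \<and> i \<le> int n then int n + 1 - i else i"
proof -
  fix n :: nat
  let ?f = "\<lambda>i. if 1 \<le> i \<and> i \<le> int n then int n + 1 - i else i"
  have "bij ?f"
    by (rule bij_betw_byWitness[where f' = ?f]) auto
  moreover have "{a. ?f a \<noteq> a} \<subseteq> {1..int n}" by auto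
  then have "finite {a. ?f a \<noteq> a}" by (rule finite_subset) simp
  ultimately show "bij ?f \<and> finite {a. ?f a \<noteq> a}" ..
qed

text \<open>
  The Lascoux--Schuetzenberger definition: $\mathfrak{S}_{w_0^{(n)}} = x_1^{n-1} x_2^{n-2} \cdots x_{n-1}$,
  and $\mathfrak{S}_{w s_i} = \partial_i \mathfrak{S}_w$ whenever $\ell(w s_i) < \ell(w)$.
\<close>

inductive is_schubert :: "int perm \<Rightarrow> int mpoly \<Rightarrow> bool" where
  longest: "is_schubert (longest n) (\<Prod>i = 1..n. Var (int i) ^ (n - i))"
| descent: "is_schubert w f \<Longrightarrow> i \<ge> 1 \<Longrightarrow> len (w * simple_refl i) < len w \<Longrightarrow>
    is_schubert (w * simple_refl i) (ddiff i f)"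

definition schubert_pos :: "int perm \<Rightarrow> int mpoly" where
  "schubert_pos v = (THE f. is_schubert v f)"

definition omega_poly :: "int mpoly \<Rightarrow> int mpoly" where
  "omega_poly = psubst (\<lambda>i. - Var (1 - i))"

definition schubert_neg :: "int perm \<Rightarrow> int mpoly" where
  "schubert_neg u = omega_poly (schubert_pos (omega_perm u))"

text \<open>The factorization $y = uv$ is unique, since $S_- \cap S_+ = 1$.\<close>

definition schubert_nonzero :: "int perm \<Rightarrow> int mpoly" where
  "schubert_nonzero y =
    (THE f. \<exists>u\<in>S_neg. \<exists>v\<in>S_pos. y = u * v \<and> f = schubert_neg u * schubert_pos v)"

section \<open>Formal power series in the variables $x_i$, $i \in \mathbb{Z}$\<close>

text \<open>Arbitrary families of coefficients, indexed by the monomials of finite degree.\<close>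

typedef series = "UNIV :: ((int \<Rightarrow>\<^sub>0 nat) \<Rightarrow> rat) set"
  morphisms coeff Series ..

setup_lifting type_definition_series

lemma series_eqI: "(\<And>m. coeff f m = coeff g m) \<Longrightarrow> f = g"
  by transfer auto

definition splits :: "('v \<Rightarrow>\<^sub>0 nat) \<Rightarrow> (('v \<Rightarrow>\<^sub>0 nat) \<times> ('v \<Rightarrow>\<^sub>0 nat)) set" where
  "splits m = {(a, b). a + b = m}"

lemma finite_splits [simp]: "finite (splits m)"
proof -
  let ?F = "{f. \<forall>x. (x \<in> Poly_Mapping.keys m \<longrightarrow> f x \<in> {.. \<Sum>v\<in>Poly_Mapping.keys m. Poly_Mapping.lookup m v})
    \<and> (x \<notin> Poly_Mapping.keys m \<longrightarrow> f x = (0::nat))}"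
  have F: "finite ?F"
    by (rule finite_set_of_finite_funs) auto
  have "Poly_Mapping.lookup a \<in> ?F" if "a + b = m" for a b
  proof -
    have le: "Poly_Mapping.lookup a x \<le> Poly_Mapping.lookup m x" for x
      using that by (auto simp: lookup_add)
    have "Poly_Mapping.lookup a x \<le> (\<Sum>v\<in>Poly_Mapping.keys m. Poly_Mapping.lookup m v)"
      if "x \<in> Poly_Mapping.keys m" for x
      using le[of x] member_le_sum[OF that, of "Poly_Mapping.lookup m"] by simp
    moreover have "Poly_Mapping.lookup a x = 0" if "x \<notin> Poly_Mapping.keys m" for x
      using le[of x] that by (simp add: in_keys_iff)
    ultimately show ?thesis by blast
  qed
  then have "Poly_Mapping.lookup ` fst ` splits m \<subseteq> ?F"
    unfolding splits_def by fastforce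
  then have "finite (Poly_Mapping.lookup ` fst ` splits m)"
    using F by (rule finite_subset)
  then have "finite (fst ` splits m)"
    by (rule finite_imageD) (simp add: inj_on_def)
  moreover have "inj_on fst (splits m)"
    by (auto simp: inj_on_def splits_def)
  ultimately show ?thesis by (rule finite_imageD)
qed

instantiation series :: comm_ring_1
begin

lift_definition zero_series :: series is "\<lambda>_. 0" .
lift_definition one_series :: series is "\<lambda>m. if m = 0 then 1 else 0" .
lift_definition plus_series :: "series \<Rightarrow> series \<Rightarrow> series" is "\<lambda>f g m. f m + g m" .
lift_definition minus_series :: "series \<Rightarrow> series \<Rightarrow> series" is "\<lambda>f g m. f m - g m" .
lift_definition uminus_series :: "series \<Rightarrow> series" is "\<lambda>f m. - f m" .
lift_definition times_series :: "series \<Rightarrow> series \<Rightarrow> series" is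
  "\<lambda>f g m. \<Sum>(a, b)\<in>splits m. f a * g b" .

instance
proof
  fix f g h :: series
  show "f * g = g * f"
  proof (transfer, rule ext)
    fix f g :: "(int \<Rightarrow>\<^sub>0 nat) \<Rightarrow> rat" and m
    show "(\<Sum>(a, b)\<in>splits m. f a * g b) = (\<Sum>(a, b)\<in>splits m. g a * f b)"
      by (rule sum.reindex_bij_witness[where i = prod.swap and j = prod.swap])
        (auto simp: splits_def add.commute mult.commute)
  qed
  show "f * g * h = f * (g * h)"
  proof (transfer, rule ext)
    fix f g h :: "(int \<Rightarrow>\<^sub>0 nat) \<Rightarrow> rat" and m
    have "(\<Sum>(a, b)\<in>splits m. (\<Sum>(c, d)\<in>splits a. f c * g d) * h b)
        = (\<Sum>p\<in>splits m. \<Sum>q\<in>splits (fst p). f (fst q) * g (snd q) * h (snd p))"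
      by (simp add: case_prod_beta sum_distrib_right)
    also have "\<dots> = (\<Sum>(p, q)\<in>Sigma (splits m) (\<lambda>p. splits (fst p)).
        f (fst q) * g (snd q) * h (snd p))"
      by (subst sum.Sigma) auto
    also have "\<dots> = (\<Sum>(p, q)\<in>Sigma (splits m) (\<lambda>p. splits (snd p)).
        f (fst p) * (g (fst q) * h (snd q)))"
      by (rule sum.reindex_bij_witness[where
            i = "\<lambda>((a, _), (c, d)). ((a + c, d), (a, c))" and
            j = "\<lambda>((_, b), (c, d)). ((c, d + b), (d, b))"])
        (auto simp: splits_def add.assoc mult.assoc)
    also have "\<dots> = (\<Sum>p\<in>splits m. \<Sum>q\<in>splits (snd p). f (fst p) * (g (fst q) * h (snd q)))"
      by (subst sum.Sigma) auto
    also have "\<dots> = (\<Sum>(a, b)\<in>splits m. f a * (\<Sum>(c, d)\<in>splits b. g c * h d))"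
      by (simp add: case_prod_beta sum_distrib_left)
    finally show "(\<Sum>(a, b)\<in>splits m. (\<Sum>(c, d)\<in>splits a. f c * g d) * h b)
        = (\<Sum>(a, b)\<in>splits m. f a * (\<Sum>(c, d)\<in>splits b. g c * h d))" .
  qed
  show "1 * f = f"
  proof (transfer, rule ext)
    fix f :: "(int \<Rightarrow>\<^sub>0 nat) \<Rightarrow> rat" and m
    have "(\<Sum>(a, b)\<in>splits m. (if a = 0 then 1 else 0) * f b)
        = (\<Sum>(a, b)\<in>{(0 :: int \<Rightarrow>\<^sub>0 nat, m)}. (if a = 0 then 1 else 0) * f b)"
      by (rule sum.mono_neutral_right, simp) (auto simp: splits_def split: if_splits)
    then show "(\<Sum>(a, b)\<in>splits m. (if a = 0 then 1 else 0) * f b) = f m" by simp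
  qed
  show "(f + g) * h = f * h + g * h"
    by transfer (simp add: case_prod_beta distrib_right sum.distrib)
  show "f + g + h = f + (g + h)" by transfer (simp add: add.assoc)
  show "f + g = g + f" by transfer (simp add: add.commute)
  show "0 + f = f" by transfer simp
  show "- f + f = 0" by transfer simp
  show "f - g = f + - g" by transfer simp
  show "(0::series) \<noteq> 1" by transfer (metis zero_neq_one)
qed

end

lift_definition series_const :: "rat \<Rightarrow> series" is "\<lambda>c m. if m = 0 then c else 0" .

lift_definition series_var :: "int \<Rightarrow> series" is
  "\<lambda>i m. if m = Poly_Mapping.single i 1 then 1 else 0" .

text \<open>The power sum $p_k = \sum_{i \le 0} x_i^k$; it is only used for $k \ge 1$.\<close>

lift_definition series_psum :: "nat \<Rightarrow> series" is
  "\<lambda>k m. if \<exists>i\<le>0. m = Poly_Mapping.single i k then 1 else 0" .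

section \<open>Back symmetric power series\<close>

text \<open>
  $\Lambda = \mathbb{Q}[p_1, p_2, \dots]$ is \<open>nat mpoly\<close>, where the variable with index \<open>k\<close> is
  $p_{k+1}$. Likewise, in the generators of $\overleftarrow{R} = \Lambda \otimes \mathbb{Q}[x]$,
  \<open>Psum k\<close> is $p_{k+1}$. A tensor product of polynomial rings is the polynomial ring in the disjoint
  union of the variables; so \<open>(nat + gen) mpoly\<close> is $\Lambda \otimes \overleftarrow{R}$.
\<close>

datatype gen = Psum nat | Xvar int

type_synonym Lam = "nat mpoly"
type_synonym backR = "gen mpoly"
type_synonym Lam_backR = "(nat + gen) mpoly"

definition of_Lam :: "Lam \<Rightarrow> backR" where
  "of_Lam = psubst (\<lambda>k. Var (Psum k))"

definition of_poly :: "int mpoly \<Rightarrow> backR" where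
  "of_poly = psubst (\<lambda>i. Var (Xvar i))"

definition tensor :: "Lam \<Rightarrow> backR \<Rightarrow> Lam_backR" (infixl \<open>\<otimes>\<^sub>\<rat>\<close> 70) where
  "f \<otimes>\<^sub>\<rat> g = psubst (\<lambda>k. Var (Inl k)) f * psubst (\<lambda>v. Var (Inr v)) g"

text \<open>
  The coaction $\Delta$: the algebra homomorphism with
  $p_k \mapsto p_k \otimes 1 + 1 \otimes p_k$ and $x_i \mapsto 1 \otimes x_i$.
\<close>

definition coaction :: "backR \<Rightarrow> Lam_backR" where
  "coaction = psubst (\<lambda>v. case v of
     Psum k \<Rightarrow> Var k \<otimes>\<^sub>\<rat> 1 + 1 \<otimes>\<^sub>\<rat> Var (Psum k)
   | Xvar i \<Rightarrow> 1 \<otimes>\<^sub>\<rat> Var (Xvar i))"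

definition eta0 :: "backR \<Rightarrow> Lam" where
  "eta0 = psubst (\<lambda>v. case v of Psum k \<Rightarrow> Var k | Xvar i \<Rightarrow> 0)"

text \<open>The identification of $\overleftarrow{R}$ with a ring of formal power series.\<close>

definition to_series :: "backR \<Rightarrow> series" where
  "to_series = peval series_const (\<lambda>v. case v of Psum k \<Rightarrow> series_psum (Suc k) | Xvar i \<Rightarrow> series_var i)"

section \<open>Back stable Schubert polynomials\<close>

definition compatible :: "int list \<Rightarrow> int list \<Rightarrow> bool" where
  "compatible as bs \<longleftrightarrow> length bs = length as \<and> sorted bs \<and>
     (\<forall>i < length as. bs ! i \<le> as ! i) \<and>
     (\<forall>i. Suc i < length as \<longrightarrow> as ! i < as ! Suc i \<longrightarrow> bs ! i < bs ! Suc i)"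

definition monomial_of :: "int list \<Rightarrow> (int \<Rightarrow>\<^sub>0 nat)" where
  "monomial_of bs = (\<Sum>b\<leftarrow>bs. Poly_Mapping.single b 1)"

text \<open>
  The double sum of the monomials $x_{b_1} \cdots x_{b_\ell}$ is infinite; its coefficient at a
  monomial is the number of pairs (reduced word, compatible sequence) which yield that monomial.
\<close>

definition back_schubert_series :: "int perm \<Rightarrow> series" where
  "back_schubert_series w = Series (\<lambda>m.
     of_nat (card {(as, bs). as \<in> reduced_words w \<and> compatible as bs \<and> monomial_of bs = m}))"

text \<open>
  The series above is back symmetric, hence in the image of \<open>to_series\<close>, which is injective because
  the $p_k$ and the $x_i$ are algebraically independent.
\<close>

definition back_schubert :: "int perm \<Rightarrow> backR" where
  "back_schubert w = (THE f. to_series f = back_schubert_series w)"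

definition stanley :: "int perm \<Rightarrow> Lam" where
  "stanley w = eta0 (back_schubert w)"

end

theory Submission
  imports "HOL-Computational_Algebra.Polynomial" Defs
begin

text \<open>
  In the nilCoxeter algebra put \<open>A\<^sub>b(x) = \<dots> (1 + x u\<^bsub>b+1\<^esub>)(1 + x u\<^sub>b)\<close> and
  \<open>A(x) = \<dots> (1 + x u\<^sub>1)(1 + x u\<^sub>0)(1 + x u\<^bsub>-1\<^esub>) \<dots>\<close>. Grouping compatible sequences by the value \<open>b\<close>
  identifies the back stable Schubert polynomial of \<open>w\<close> with the coefficient of \<open>u\<^sub>w\<close> in the
  product of all \<open>A\<^sub>b(x\<^sub>b)\<close>, \<open>b\<close> increasing. The \<open>A(x)\<close> commute, so the product of the \<open>A(x\<^sub>b)\<close>,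
  \<open>b \<le> 0\<close>, is \<open>F = exp (\<Sum>k. p\<^sub>k c\<^sub>k)\<close> with commuting \<open>c\<^sub>k\<close>; since the \<open>p\<^sub>k\<close> are primitive,
  \<open>\<Delta> F = F \<otimes> F\<close>. Writing \<open>A(x)\<close> as \<open>A\<^sub>b(x)\<close> times the factors with letters below \<open>b\<close>, the full product
  becomes \<open>F G\<^sub>- G\<^sub>+\<close>, where \<open>G\<^sub>+\<close> is the product of the \<open>A\<^sub>b(x\<^sub>b)\<close>, \<open>b \<ge> 1\<close>, and \<open>G\<^sub>-\<close> is its image
  under \<open>\<omega>\<close>. The coefficients of \<open>G\<^sub>+\<close> are the Schubert polynomials, because
  \<open>A\<^sub>i(x) A\<^bsub>i+1\<^esub>(y) = A\<^sub>i(x) A\<^sub>i(y) (1 - y u\<^sub>i)\<close> has divided difference \<open>A\<^sub>i(x) A\<^bsub>i+1\<^esub>(y) u\<^sub>i\<close>.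
  Everything is done with the letters restricted to \<open>-N, \<dots>, N\<close>, which suffices for a fixed \<open>w\<close>
  with support in that range.
\<close>

section \<open>Length, inversions and reduced words\<close>

text \<open>The objects are infinite in two directions: infinitely many letters, and infinitely many
  variables x_b with b \<le> 0. A finite window of letters removes the first infinity. For the
  second, F is not a limit of products; it is built with coefficients in \<open>Lam\<close> from a
  differential equation in the length grading, and replacing p_k by a sum of finitely many k-th
  powers then yields finite products. Uniqueness of the solution proves both this comparison and the
  multiplicativity under the coaction.

  \<open>back_schubert\<close> is a definite description, so the p_k and the x_i must be shown
  algebraically independent. Setting x_b = 0 for b < -M reduces this to polynomials, but the cut has
  to move: for a fixed M every p_k becomes a polynomial in the x_i.

  \<open>is_schubert\<close> is a relation as well. That different chains of divided differences
  agree is not derived from braid relations: each value is a coefficient of one fixed generating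
  function.\<close>

lemma simple_refl_apply:
  "simple_refl i \<langle>$\<rangle> j = (if j = i then i + 1 else if j = i + 1 then i else j)"
  by (simp add: simple_refl_def swap.rep_eq transpose_def)

lemma simple_refl_square [simp]: "simple_refl i * simple_refl i = 1"
  by (rule perm_eqI) (simp add: apply_times simple_refl_apply)

lemma mult_simple_refl_cancel [simp]: "w * simple_refl i * simple_refl i = w"
  by (simp add: mult.assoc)

lemma simple_refl_mult_cancel [simp]: "simple_refl i * (simple_refl i * w) = w"
  by (simp add: mult.assoc [symmetric])

lemma inverse_simple_refl [simp]: "inverse (simple_refl i) = simple_refl i"
  by (rule perm.inverse_unique) simp

lemma simple_refl_commute:
  assumes "i + 1 < j \<or> j + 1 < i"
  shows "simple_refl i * simple_refl j = simple_refl j * simple_refl i"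
  using assms by (intro perm_eqI) (auto simp: apply_times simple_refl_apply)

lemma simple_refl_braid:
  "simple_refl i * (simple_refl (i + 1) * simple_refl i) =
    simple_refl (i + 1) * (simple_refl i * simple_refl (i + 1))"
  by (intro perm_eqI) (auto simp: apply_times simple_refl_apply)

lemma word_prod_Nil [simp]: "word_prod [] = 1"
  and word_prod_Cons [simp]: "word_prod (a # as) = simple_refl a * word_prod as"
  and word_prod_append [simp]: "word_prod (as @ bs) = word_prod as * word_prod bs"
  by (simp_all add: word_prod_def)

lemma inverse_word_prod: "inverse (word_prod as) = word_prod (rev as)"
  by (induction as) (simp_all add: perm.inverse_neutral)

section \<open>Inversions compute the length\<close>

definition inversions :: "int perm \<Rightarrow> (int \<times> int) set" where
  "inversions w = {(a, b). a < b \<and> w \<langle>$\<rangle> b < w \<langle>$\<rangle> a}"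

text \<open>The parabolic subgroup generated by the \<open>s\<^sub>i\<close> with \<open>m \<le> i \<le> n\<close>.\<close>

definition parabolic :: "int \<Rightarrow> int \<Rightarrow> int perm set" where
  "parabolic m n = {w. \<forall>j. j < m \<or> n + 1 < j \<longrightarrow> w \<langle>$\<rangle> j = j}"

lemma parabolic_apply: "w \<in> parabolic m n \<Longrightarrow> j < m \<or> n + 1 < j \<Longrightarrow> w \<langle>$\<rangle> j = j"
  by (auto simp: parabolic_def)

lemma parabolic_mult: "x \<in> parabolic m n \<Longrightarrow> y \<in> parabolic m n \<Longrightarrow> x * y \<in> parabolic m n"
  by (auto simp: parabolic_def apply_times)

lemma parabolic_1 [simp]: "1 \<in> parabolic m n"
  by (simp add: parabolic_def)

lemma simple_refl_parabolic: "m \<le> i \<Longrightarrow> i \<le> n \<Longrightarrow> simple_refl i \<in> parabolic m n"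
  by (auto simp: parabolic_def simple_refl_apply)

text \<open>A value outside the interval would itself be a fixed point, and by injectivity only its
  own position can reach it.\<close>

lemma parabolic_range:
  assumes "w \<in> parabolic m n" "m \<le> j" "j \<le> n + 1"
  shows "m \<le> w \<langle>$\<rangle> j" "w \<langle>$\<rangle> j \<le> n + 1"
proof -
  have "w \<langle>$\<rangle> (w \<langle>$\<rangle> j) = w \<langle>$\<rangle> j" if "w \<langle>$\<rangle> j < m \<or> n + 1 < w \<langle>$\<rangle> j"
    using assms(1) that by (simp add: parabolic_apply)
  then show "m \<le> w \<langle>$\<rangle> j" "w \<langle>$\<rangle> j \<le> n + 1"
    using assms(2,3) by (auto simp: apply_inj not_less[symmetric])
qed

lemma ex_parabolic: "\<exists>n\<ge>n0. w \<in> parabolic (- int n) (int n)"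
proof -
  have "finite (abs ` affected w)" by simp
  then have B: "b \<le> Max (abs ` affected w)" if "b \<in> abs ` affected w" for b
    using that by (rule Max_ge)
  let ?n = "max n0 (nat (Max (abs ` affected w)))"
  have "w \<langle>$\<rangle> j = j" if "j < - int ?n \<or> int ?n + 1 < j" for j
  proof (rule ccontr)
    assume "w \<langle>$\<rangle> j \<noteq> j"
    then have "\<bar>j\<bar> \<le> Max (abs ` affected w)" using B[of "\<bar>j\<bar>"] by (simp add: in_affected)
    then show False using that by linarith
  qed
  then have "w \<in> parabolic (- int ?n) (int ?n)" by (simp add: parabolic_def)
  then show ?thesis by (meson max.cobounded1)
qed

lemma finite_inversions [simp]: "finite (inversions w)"
proof -
  obtain n where n: "w \<in> parabolic (- int n) (int n)" using ex_parabolic by blast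
  let ?I = "{- int n..int n + 1}"
  have "inversions w \<subseteq> ?I \<times> ?I"
  proof (rule subrelI)
    fix a b assume "(a, b) \<in> inversions w"
    then have ab: "a < b" "w \<langle>$\<rangle> b < w \<langle>$\<rangle> a" by (auto simp: inversions_def)
    have A: "w \<langle>$\<rangle> j = j" if "j \<notin> ?I" for j
      using parabolic_apply[OF n, of j] that by auto
    have R: "w \<langle>$\<rangle> j \<in> ?I" if "j \<in> ?I" for j
      using parabolic_range[OF n, of j] that by simp
    have "a \<in> ?I"
    proof (rule ccontr)
      assume *: "a \<notin> ?I"
      then show False using A[of a] A[of b] R[of b] ab by (cases "b \<in> ?I") auto
    qed
    moreover have "b \<in> ?I"
    proof (rule ccontr)
      assume *: "b \<notin> ?I"
      then show False using A[of a] A[of b] R[of a] ab by (cases "a \<in> ?I") auto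
    qed
    ultimately show "(a, b) \<in> ?I \<times> ?I" by simp
  qed
  then show ?thesis by (rule finite_subset) simp
qed

text \<open>Renaming positions by s_i carries inversions to inversions, since s_i changes the order
  of no pair of positions except (i, i + 1); that pair is the one new inversion.\<close>

lemma card_inversions_mult_simple_refl:
  assumes "w \<langle>$\<rangle> i < w \<langle>$\<rangle> (i + 1)"
  shows "card (inversions (w * simple_refl i)) = Suc (card (inversions w))"
proof -
  let ?s = "\<lambda>j. simple_refl i \<langle>$\<rangle> j"
  let ?f = "\<lambda>(a, b). (?s a, ?s b)"
  have ss: "?s (?s j) = j" for j by (simp add: simple_refl_apply)
  have inj: "inj_on ?f A" for A
    by (rule inj_onI) (auto simp: apply_inj)
  have "inversions (w * simple_refl i) = insert (i, i + 1) (?f ` inversions w)"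
  proof (intro equalityI subsetI)
    fix p assume p: "p \<in> inversions (w * simple_refl i)"
    obtain a b where ab: "p = (a, b)" by (cases p)
    have *: "a < b" "w \<langle>$\<rangle> (?s b) < w \<langle>$\<rangle> (?s a)" using p ab by (auto simp: inversions_def apply_times)
    show "p \<in> insert (i, i + 1) (?f ` inversions w)"
    proof (cases "p = (i, i + 1)")
      case False
      then have "?s a < ?s b" using * ab by (auto simp: simple_refl_apply)
      then have "(?s a, ?s b) \<in> inversions w" using * by (auto simp: inversions_def)
      then have "?f (?s a, ?s b) \<in> ?f ` inversions w" by (rule imageI)
      then show ?thesis using ab ss by simp
    qed simp
  next
    fix p assume p: "p \<in> insert (i, i + 1) (?f ` inversions w)"
    show "p \<in> inversions (w * simple_refl i)"
    proof (cases "p = (i, i + 1)")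
      case True
      then show ?thesis using assms by (auto simp: inversions_def apply_times simple_refl_apply)
    next
      case False
      then obtain a b where ab: "p = (?s a, ?s b)" "(a, b) \<in> inversions w" using p by auto
      then have *: "a < b" "w \<langle>$\<rangle> b < w \<langle>$\<rangle> a" by (auto simp: inversions_def)
      have "(a, b) \<noteq> (i, i + 1)" using * assms by auto
      then have "?s a < ?s b" using * by (auto simp: simple_refl_apply)
      then show ?thesis using ab * ss by (auto simp: inversions_def apply_times)
    qed
  qed
  moreover have "(i, i + 1) \<notin> ?f ` inversions w"
    by (auto simp: inversions_def simple_refl_apply split: if_splits)
  ultimately show ?thesis by (simp add: card_image[OF inj])
qed

lemma card_inversions_mult_simple_refl':
  assumes "w \<langle>$\<rangle> (i + 1) < w \<langle>$\<rangle> i"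
  shows "card (inversions w) = Suc (card (inversions (w * simple_refl i)))"
  using card_inversions_mult_simple_refl[of "w * simple_refl i" i] assms
  by (simp add: apply_times simple_refl_apply)

lemma apply_less_cases: "w \<langle>$\<rangle> i < w \<langle>$\<rangle> (i + 1) \<or> w \<langle>$\<rangle> (i + 1) < w \<langle>$\<rangle> i" for w :: "int perm"
  using apply_inj[of w i "i + 1"] by auto

lemma card_inversions_word_prod: "card (inversions (word_prod as)) \<le> length as"
proof (induction as rule: rev_induct)
  case Nil
  have "inversions 1 = {}" by (auto simp: inversions_def)
  then show ?case by simp
next
  case (snoc a as)
  then show ?case
    using apply_less_cases[of "word_prod as" a] card_inversions_mult_simple_refl[of "word_prod as" a]
      card_inversions_mult_simple_refl'[of "word_prod as" a]
    by (elim disjE) simp_all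
qed

text \<open>Far to the left and far to the right there are fixed points. Going right from the
  former, values grow at least as fast as positions; going left from the latter, they fall at least
  as fast. So every value equals its position.\<close>

lemma ascending_perm_eq_1:
  fixes w :: "int perm"
  assumes asc: "\<And>i. w \<langle>$\<rangle> i < w \<langle>$\<rangle> (i + 1)"
  shows "w = 1"
proof (rule perm_eqI)
  fix j
  obtain n where n: "w \<in> parabolic (- int n) (int n)" using ex_parabolic by blast
  have up: "i + int k \<le> w \<langle>$\<rangle> (i + int k)" if "w \<langle>$\<rangle> i = i" for i k
  proof (induction k)
    case (Suc k)
    then show ?case using asc[of "i + int k"] by (simp add: algebra_simps)
  qed (simp add: that)
  have down: "w \<langle>$\<rangle> (i - int k) \<le> i - int k" if "w \<langle>$\<rangle> i = i" for i k
  proof (induction k)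
    case (Suc k)
    then show ?case using asc[of "i - int k - 1"] by (simp add: algebra_simps)
  qed (simp add: that)
  define a b where "a = min j (- int n - 1)" and "b = max j (int n + 2)"
  have "w \<langle>$\<rangle> a = a" "w \<langle>$\<rangle> b = b" using parabolic_apply[OF n] by (auto simp: a_def b_def)
  from up[OF this(1), of "nat (j - a)"] down[OF this(2), of "nat (b - j)"]
  show "w \<langle>$\<rangle> j = 1 \<langle>$\<rangle> j" by (simp add: a_def b_def)
qed

text \<open>Cancelling a descent lowers the inversion count by one, and only the identity has no
  descent.\<close>

lemma ex_word_inversions: "\<exists>as. word_prod as = w \<and> length as = card (inversions w)"
proof (induction "card (inversions w)" arbitrary: w)
  case 0
  then have "inversions w = {}" by simp
  then have "w \<langle>$\<rangle> i < w \<langle>$\<rangle> (i + 1)" for i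
    using apply_less_cases[of w i] by (auto simp: inversions_def)
  then have "w = 1" by (rule ascending_perm_eq_1)
  then show ?case using 0 by (intro exI[of _ "[]"]) simp
next
  case (Suc k)
  have "\<exists>i. w \<langle>$\<rangle> (i + 1) < w \<langle>$\<rangle> i"
  proof (rule ccontr)
    assume "\<not> ?thesis"
    then have "w = 1" using apply_less_cases[of w] by (intro ascending_perm_eq_1) blast
    then show False using Suc(2) card_inversions_word_prod[of "[]"] by simp
  qed
  then obtain i where i: "w \<langle>$\<rangle> (i + 1) < w \<langle>$\<rangle> i" ..
  from card_inversions_mult_simple_refl'[OF this] Suc(2)
  have "k = card (inversions (w * simple_refl i))" by simp
  from Suc(1)[OF this] obtain as where "word_prod as = w * simple_refl i" "length as = k"
    using \<open>k = _\<close> by auto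
  then show ?case using Suc(2) by (intro exI[of _ "as @ [i]"]) simp
qed

lemma len_eq: "len w = card (inversions w)"
  unfolding len_def
proof (rule Least_equality)
  show "\<exists>as. length as = card (inversions w) \<and> word_prod as = w"
    using ex_word_inversions by blast
  show "card (inversions w) \<le> n" if "\<exists>as. length as = n \<and> word_prod as = w" for n
    using that card_inversions_word_prod by blast
qed

lemma len_word_prod_le: "len (word_prod as) \<le> length as"
  by (simp add: len_eq card_inversions_word_prod)

lemma ex_reduced_word: obtains as where "as \<in> reduced_words w"
  using ex_word_inversions[of w] by (auto simp: reduced_words_def len_eq)

lemma reduced_wordsD: "as \<in> reduced_words w \<Longrightarrow> word_prod as = w"
  "as \<in> reduced_words w \<Longrightarrow> length as = len w"
  by (auto simp: reduced_words_def)

lemma len_mult_le: "len (x * y) \<le> len x + len y"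
proof -
  obtain as bs where "as \<in> reduced_words x" "bs \<in> reduced_words y" by (meson ex_reduced_word)
  then show ?thesis using len_word_prod_le[of "as @ bs"] by (simp add: reduced_words_def)
qed

lemma len_1 [simp]: "len 1 = 0"
  using len_word_prod_le[of "[]"] by simp

lemma len_eq_0_iff [simp]: "len w = 0 \<longleftrightarrow> w = 1"
proof
  assume "len w = 0"
  moreover obtain as where "as \<in> reduced_words w" by (rule ex_reduced_word)
  ultimately show "w = 1" by (auto simp: reduced_words_def)
qed simp

lemma len_inverse [simp]: "len (inverse w) = len w"
proof -
  have "len (inverse w) \<le> len w" for w
  proof -
    obtain as where "as \<in> reduced_words w" by (rule ex_reduced_word)
    then show ?thesis using len_word_prod_le[of "rev as"] inverse_word_prod[of as]
      by (simp add: reduced_words_def)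
  qed
  from this[of w] this[of "inverse w"] show ?thesis by simp
qed

lemma len_mult_simple_refl_ascent: "w \<langle>$\<rangle> i < w \<langle>$\<rangle> (i + 1) \<Longrightarrow> len (w * simple_refl i) = Suc (len w)"
  by (simp add: len_eq card_inversions_mult_simple_refl)

lemma len_mult_simple_refl_descent: "w \<langle>$\<rangle> (i + 1) < w \<langle>$\<rangle> i \<Longrightarrow> len w = Suc (len (w * simple_refl i))"
  by (simp add: len_eq card_inversions_mult_simple_refl')

lemma len_mult_simple_refl_less_iff: "len (w * simple_refl i) < len w \<longleftrightarrow> w \<langle>$\<rangle> (i + 1) < w \<langle>$\<rangle> i"
  using apply_less_cases[of w i] len_mult_simple_refl_ascent[of w i] len_mult_simple_refl_descent[of w i]
  by linarith

lemma len_mult_simple_refl_cases: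
  "len (w * simple_refl i) = Suc (len w) \<or> len w = Suc (len (w * simple_refl i))"
  using apply_less_cases[of w i] len_mult_simple_refl_ascent[of w i] len_mult_simple_refl_descent[of w i]
  by blast

lemma len_simple_refl_mult_cases:
  "len (simple_refl i * w) = Suc (len w) \<or> len w = Suc (len (simple_refl i * w))"
  using len_mult_simple_refl_cases[of "inverse w" i] len_inverse[of "simple_refl i * w"] by simp

lemma len_simple_refl [simp]: "len (simple_refl i) = 1"
  using len_mult_simple_refl_cases[of 1 i] by auto

lemma word_prod_parabolic: "set as \<subseteq> {m..n} \<Longrightarrow> word_prod as \<in> parabolic m n"
  by (induction as) (auto intro!: parabolic_mult simple_refl_parabolic)

text \<open>The last letter of a reduced word is a descent of \<open>w\<close>. Since
  \<open>w\<close> is the identity below \<open>m\<close> and above \<open>n + 1\<close> and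
  preserves the interval between, its descents lie in {m..n}.\<close>

lemma reduced_word_parabolic:
  "as \<in> reduced_words w \<Longrightarrow> w \<in> parabolic m n \<Longrightarrow> set as \<subseteq> {m..n}"
proof (induction as arbitrary: w rule: rev_induct)
  case (snoc i as)
  have w: "w = word_prod as * simple_refl i" "len w = Suc (length as)"
    using snoc.prems(1) by (auto simp: reduced_words_def)
  have as: "word_prod as = w * simple_refl i" using w by simp
  have "len (w * simple_refl i) < len w" using as w(2) len_word_prod_le[of as] by simp
  then have red: "as \<in> reduced_words (w * simple_refl i)"
    using as w(2) len_mult_simple_refl_cases[of w i] by (auto simp: reduced_words_def)
  have d: "w \<langle>$\<rangle> (i + 1) < w \<langle>$\<rangle> i"
    using \<open>len (w * simple_refl i) < len w\<close> by (simp add: len_mult_simple_refl_less_iff)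
  have i: "m \<le> i \<and> i \<le> n"
  proof (rule ccontr)
    assume "\<not> ?thesis"
    then consider "i + 1 < m" | "i + 1 = m" | "i = n + 1" | "n + 1 < i" by linarith
    then show False
      using d parabolic_apply[OF snoc.prems(2), of i] parabolic_apply[OF snoc.prems(2), of "i + 1"]
        parabolic_range[OF snoc.prems(2), of i] parabolic_range[OF snoc.prems(2), of "i + 1"]
      by cases (cases "m \<le> n + 1"; simp)+
  qed
  then have "w * simple_refl i \<in> parabolic m n"
    using snoc.prems(2) by (intro parabolic_mult simple_refl_parabolic) auto
  with snoc.IH[OF red] i show ?case by simp
qed simp

lemma reduced_product_append:
  assumes "reduced_product w x y" "as \<in> reduced_words x" "bs \<in> reduced_words y"
  shows "as @ bs \<in> reduced_words w"
  using assms by (auto simp: reduced_product_def reduced_words_def)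

text \<open>Subadditivity of the length forces both halves of a reduced word to be reduced. This
  equivalence is what makes \<open>word_elt\<close> multiplicative.\<close>

lemma reduced_words_append:
  "as @ bs \<in> reduced_words w \<longleftrightarrow>
    (reduced_product w (word_prod as) (word_prod bs) \<and>
      as \<in> reduced_words (word_prod as) \<and> bs \<in> reduced_words (word_prod bs))"
  using len_word_prod_le[of as] len_word_prod_le[of bs] len_mult_le[of "word_prod as" "word_prod bs"]
  by (auto simp: reduced_words_def reduced_product_def)

lemma reduced_product_parabolic:
  assumes "reduced_product w x y" "w \<in> parabolic m n"
  shows "x \<in> parabolic m n" "y \<in> parabolic m n"
proof -
  obtain as bs where ab: "as \<in> reduced_words x" "bs \<in> reduced_words y" by (meson ex_reduced_word)
  have "set (as @ bs) \<subseteq> {m..n}"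
    using reduced_word_parabolic[OF reduced_product_append[OF assms(1) ab] assms(2)] .
  then show "x \<in> parabolic m n" "y \<in> parabolic m n"
    using ab word_prod_parabolic by (auto dest!: reduced_wordsD(1))
qed

section \<open>Reduced factorizations\<close>

definition factorizations :: "int perm \<Rightarrow> (int perm \<times> int perm) set" where
  "factorizations w = {(x, y). reduced_product w x y}"

lemma factorizations_iff: "(x, y) \<in> factorizations w \<longleftrightarrow> w = x * y \<and> len w = len x + len y"
  by (simp add: factorizations_def reduced_product_def)

text \<open>By \<open>reduced_word_parabolic\<close> both factors have reduced words in one finite
  alphabet, of length at most \<open>len w\<close>.\<close>

lemma finite_factorizations [simp]: "finite (factorizations w)"
proof -
  obtain n where n: "w \<in> parabolic (- int n) (int n)" using ex_parabolic by blast
  let ?W = "word_prod ` {as. set as \<subseteq> {- int n..int n} \<and> length as \<le> len w}"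
  have W: "x \<in> ?W" if "x \<in> parabolic (- int n) (int n)" "len x \<le> len w" for x
  proof -
    obtain as where as: "as \<in> reduced_words x" by (rule ex_reduced_word)
    then have "set as \<subseteq> {- int n..int n}" "length as \<le> len w" "x = word_prod as"
      using that reduced_word_parabolic by (auto dest: reduced_wordsD)
    then show ?thesis by blast
  qed
  have "factorizations w \<subseteq> ?W \<times> ?W"
    using W reduced_product_parabolic[OF _ n] by (auto simp: factorizations_def reduced_product_def)
  moreover have "finite (?W \<times> ?W)"
    by (intro finite_cartesian_product finite_imageI finite_lists_length_le) simp_all
  ultimately show ?thesis by (rule finite_subset)
qed

section \<open>The subgroups \<open>S_neg\<close> and \<open>S_pos\<close> as pointwise
  stabilizers\<close>

lemma S_pos_eq: "S_pos = {w. \<forall>j\<le>0. w \<langle>$\<rangle> j = j}"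
proof (intro equalityI subsetI)
  fix w :: "int perm" assume "w \<in> S_pos"
  then obtain as where as: "\<forall>i\<in>set as. i \<ge> 1" "w = word_prod as" by (auto simp: S_pos_def)
  then have "w \<in> parabolic 1 (Max (insert 0 (set as)))" by (auto intro!: word_prod_parabolic)
  then show "w \<in> {w. \<forall>j\<le>0. w \<langle>$\<rangle> j = j}" by (auto simp: parabolic_def)
next
  fix w :: "int perm" assume w: "w \<in> {w. \<forall>j\<le>0. w \<langle>$\<rangle> j = j}"
  obtain n where "w \<in> parabolic (- int n) (int n)" using ex_parabolic by blast
  with w have "w \<in> parabolic 1 (int n)" by (auto simp: parabolic_def)
  moreover obtain as where "as \<in> reduced_words w" by (rule ex_reduced_word)
  ultimately have "set as \<subseteq> {1..int n}" "word_prod as = w"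
    using reduced_word_parabolic reduced_wordsD by auto
  then show "w \<in> S_pos" by (force simp: S_pos_def)
qed

lemma S_neg_eq: "S_neg = {w. \<forall>j\<ge>1. w \<langle>$\<rangle> j = j}"
proof (intro equalityI subsetI)
  fix w :: "int perm" assume "w \<in> S_neg"
  then obtain as where as: "\<forall>i\<in>set as. i \<le> - 1" "w = word_prod as" by (auto simp: S_neg_def)
  then have "w \<in> parabolic (Min (insert 0 (set as))) (- 1)" by (auto intro!: word_prod_parabolic)
  then show "w \<in> {w. \<forall>j\<ge>1. w \<langle>$\<rangle> j = j}" by (auto simp: parabolic_def)
next
  fix w :: "int perm" assume w: "w \<in> {w. \<forall>j\<ge>1. w \<langle>$\<rangle> j = j}"
  obtain n where "w \<in> parabolic (- int n) (int n)" using ex_parabolic by blast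
  with w have "w \<in> parabolic (- int n) (- 1)" by (auto simp: parabolic_def)
  moreover obtain as where "as \<in> reduced_words w" by (rule ex_reduced_word)
  ultimately have "set as \<subseteq> {- int n..- 1}" "word_prod as = w"
    using reduced_word_parabolic reduced_wordsD by auto
  then show "w \<in> S_neg" by (force simp: S_neg_def)
qed

lemma S_neg_pos_apply:
  assumes "u \<in> S_neg" "v \<in> S_pos"
  shows "(u * v) \<langle>$\<rangle> j = (if j \<le> 0 then u \<langle>$\<rangle> j else v \<langle>$\<rangle> j)"
    "j \<le> 0 \<Longrightarrow> u \<langle>$\<rangle> j \<le> 0" "j \<ge> 1 \<Longrightarrow> v \<langle>$\<rangle> j \<ge> 1"
proof -
  have u: "u \<langle>$\<rangle> j = j" if "j \<ge> 1" for j using assms(1) that by (simp add: S_neg_eq)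
  have v: "v \<langle>$\<rangle> j = j" if "j \<le> 0" for j using assms(2) that by (simp add: S_pos_eq)
  show *: "u \<langle>$\<rangle> j \<le> 0" if "j \<le> 0" for j using u[of "u \<langle>$\<rangle> j"] that by (force simp: apply_inj)
  show **: "v \<langle>$\<rangle> j \<ge> 1" if "j \<ge> 1" for j using v[of "v \<langle>$\<rangle> j"] that by (force simp: apply_inj)
  show "(u * v) \<langle>$\<rangle> j = (if j \<le> 0 then u \<langle>$\<rangle> j else v \<langle>$\<rangle> j)"
    using u[of "v \<langle>$\<rangle> j"] v[of j] **[of j] by (auto simp: apply_times)
qed

lemma S_neg_pos_unique:
  assumes "u \<in> S_neg" "v \<in> S_pos" "u' \<in> S_neg" "v' \<in> S_pos" "u * v = u' * v'"
  shows "u = u'" "v = v'"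
proof -
  have e: "(u * v) \<langle>$\<rangle> j = (u' * v') \<langle>$\<rangle> j" for j using assms by simp
  have "u \<langle>$\<rangle> j = u' \<langle>$\<rangle> j" "v \<langle>$\<rangle> j = v' \<langle>$\<rangle> j" for j
    using e[of j] assms(1-4) S_neg_pos_apply(1)[OF assms(1,2), of j] S_neg_pos_apply(1)[OF assms(3,4), of j]
    by (cases "j \<le> 0"; simp add: S_neg_eq S_pos_eq)+
  then show "u = u'" "v = v'" by (auto intro: perm_eqI)
qed

text \<open>No inversion straddles the gap between 0 and 1, so the inversions of the product are the
  disjoint union of those of the factors.\<close>

lemma len_S_neg_pos:
  assumes "u \<in> S_neg" "v \<in> S_pos"
  shows "len (u * v) = len u + len v"
proof -
  have u: "u \<langle>$\<rangle> j = j" if "j \<ge> 1" for j using assms(1) that by (simp add: S_neg_eq)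
  have v: "v \<langle>$\<rangle> j = j" if "j \<le> 0" for j using assms(2) that by (simp add: S_pos_eq)
  note S = S_neg_pos_apply[OF assms]
  have iu: "(a, b) \<in> inversions u \<longleftrightarrow> a \<le> 0 \<and> b \<le> 0 \<and> (a, b) \<in> inversions (u * v)" for a b
    using S(2)[of a] S(2)[of b] S(1)[of a] S(1)[of b] u[of a] u[of b]
    by (cases "a \<le> 0"; cases "b \<le> 0"; auto simp: inversions_def)
  have iv: "(a, b) \<in> inversions v \<longleftrightarrow> \<not> (a \<le> 0 \<and> b \<le> 0) \<and> (a, b) \<in> inversions (u * v)" for a b
    using S(2)[of a] S(2)[of b] S(3)[of a] S(3)[of b] S(1)[of a] S(1)[of b] v[of a] v[of b]
    by (cases "a \<le> 0"; cases "b \<le> 0"; auto simp: inversions_def)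
  have "inversions (u * v) = inversions u \<union> inversions v" using iu iv by auto
  moreover have "inversions u \<inter> inversions v = {}" using iu iv by auto
  ultimately show ?thesis by (simp add: len_eq card_Un_disjoint)
qed

section \<open>The nilCoxeter algebra\<close>

text \<open>Infinite linear combinations of the basis \<open>u\<^sub>w\<close> are allowed; they can be multiplied since each
  \<open>w\<close> has finitely many reduced factorizations.\<close>

typedef 'r nilcox = "UNIV :: (int perm \<Rightarrow> 'r) set"
  morphisms nc Nilcox ..

setup_lifting type_definition_nilcox

lemma nilcox_eqI: "(\<And>w. nc f w = nc g w) \<Longrightarrow> f = g"
  by transfer auto

instantiation nilcox :: (comm_ring_1) ring_1
begin

lift_definition zero_nilcox :: "'a nilcox" is "\<lambda>_. 0" .
lift_definition one_nilcox :: "'a nilcox" is "\<lambda>w. if w = 1 then 1 else 0" .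
lift_definition plus_nilcox :: "'a nilcox \<Rightarrow> 'a nilcox \<Rightarrow> 'a nilcox" is "\<lambda>f g w. f w + g w" .
lift_definition minus_nilcox :: "'a nilcox \<Rightarrow> 'a nilcox \<Rightarrow> 'a nilcox" is "\<lambda>f g w. f w - g w" .
lift_definition uminus_nilcox :: "'a nilcox \<Rightarrow> 'a nilcox" is "\<lambda>f w. - f w" .
lift_definition times_nilcox :: "'a nilcox \<Rightarrow> 'a nilcox \<Rightarrow> 'a nilcox" is
  "\<lambda>f g w. \<Sum>(x, y)\<in>factorizations w. f x * g y" .

instance
proof
  fix f g h :: "'a nilcox"
  show "f * g * h = f * (g * h)"
  proof (transfer, rule ext)
    fix f g h :: "int perm \<Rightarrow> 'a" and w
    have "(\<Sum>(a, b)\<in>factorizations w. (\<Sum>(c, d)\<in>factorizations a. f c * g d) * h b)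
        = (\<Sum>p\<in>factorizations w. \<Sum>q\<in>factorizations (fst p). f (fst q) * g (snd q) * h (snd p))"
      by (simp add: case_prod_beta sum_distrib_right)
    also have "\<dots> = (\<Sum>(p, q)\<in>Sigma (factorizations w) (\<lambda>p. factorizations (fst p)).
        f (fst q) * g (snd q) * h (snd p))"
      by (subst sum.Sigma) auto
    also have "\<dots> = (\<Sum>(p, q)\<in>Sigma (factorizations w) (\<lambda>p. factorizations (snd p)).
        f (fst p) * (g (fst q) * h (snd q)))"
    \<comment> \<open>Once the three lengths add up to \<open>len w\<close>, subadditivity leaves no
      slack for the other bracketing.\<close>
    proof (rule sum.reindex_bij_witness[where
            i = "\<lambda>((a, _), (c, d)). ((a * c, d), (a, c))" and
            j = "\<lambda>((_, b), (c, d)). ((c, d * b), (d, b))"], goal_cases)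
      case (2 p)
      obtain a b c d where p: "p = ((a, b), (c, d))" by (metis surj_pair)
      show ?case using 2 len_mult_le[of c "d * b"] len_mult_le[of d b]
        by (auto simp: p factorizations_iff mult.assoc)
    next
      case (4 p)
      obtain a b c d where p: "p = ((a, b), (c, d))" by (metis surj_pair)
      show ?case using 4 len_mult_le[of "a * c" d] len_mult_le[of a c]
        by (auto simp: p factorizations_iff mult.assoc)
    qed (auto simp: factorizations_iff mult.assoc)
    also have "\<dots> = (\<Sum>p\<in>factorizations w. \<Sum>q\<in>factorizations (snd p). f (fst p) * (g (fst q) * h (snd q)))"
      by (subst sum.Sigma) auto
    also have "\<dots> = (\<Sum>(a, b)\<in>factorizations w. f a * (\<Sum>(c, d)\<in>factorizations b. g c * h d))"
      by (simp add: case_prod_beta sum_distrib_left)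
    finally show "(\<Sum>(a, b)\<in>factorizations w. (\<Sum>(c, d)\<in>factorizations a. f c * g d) * h b)
        = (\<Sum>(a, b)\<in>factorizations w. f a * (\<Sum>(c, d)\<in>factorizations b. g c * h d))" .
  qed
  show "1 * f = f"
  proof (transfer, rule ext)
    fix f :: "int perm \<Rightarrow> 'a" and w
    have "(\<Sum>(a, b)\<in>factorizations w. (if a = 1 then 1 else 0) * f b)
        = (\<Sum>(a, b)\<in>{(1 :: int perm, w)}. (if a = 1 then 1 else 0) * f b)"
      by (rule sum.mono_neutral_right, simp) (auto simp: factorizations_iff split: if_splits)
    then show "(\<Sum>(a, b)\<in>factorizations w. (if a = 1 then 1 else 0) * f b) = f w" by simp
  qed
  show "f * 1 = f"
  proof (transfer, rule ext)
    fix f :: "int perm \<Rightarrow> 'a" and w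
    have "(\<Sum>(a, b)\<in>factorizations w. f a * (if b = 1 then 1 else 0))
        = (\<Sum>(a, b)\<in>{(w, 1 :: int perm)}. f a * (if b = 1 then 1 else 0))"
      by (rule sum.mono_neutral_right, simp) (auto simp: factorizations_iff split: if_splits)
    then show "(\<Sum>(a, b)\<in>factorizations w. f a * (if b = 1 then 1 else 0)) = f w" by simp
  qed
  show "(f + g) * h = f * h + g * h"
    by transfer (simp add: case_prod_beta distrib_right sum.distrib)
  show "f * (g + h) = f * g + f * h"
    by transfer (simp add: case_prod_beta distrib_left sum.distrib)
  show "f + g + h = f + (g + h)" by transfer (simp add: add.assoc)
  show "f + g = g + f" by transfer (simp add: add.commute)
  show "0 + f = f" by transfer simp
  show "- f + f = 0" by transfer simp
  show "f - g = f + - g" by transfer simp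
  show "(0::'a nilcox) \<noteq> 1" by transfer (metis zero_neq_one)
qed

end

lemmas nc_simps [simp] = zero_nilcox.rep_eq one_nilcox.rep_eq plus_nilcox.rep_eq
  minus_nilcox.rep_eq uminus_nilcox.rep_eq
lemmas nc_mult = times_nilcox.rep_eq

section \<open>Ring homomorphisms and change of scalars\<close>

definition ring_hom :: "('a::ring_1 \<Rightarrow> 'b::ring_1) \<Rightarrow> bool" where
  "ring_hom \<phi> \<longleftrightarrow> \<phi> 1 = 1 \<and> (\<forall>x y. \<phi> (x + y) = \<phi> x + \<phi> y) \<and> (\<forall>x y. \<phi> (x * y) = \<phi> x * \<phi> y)"

lemma ring_homI:
  "\<phi> 1 = 1 \<Longrightarrow> (\<And>x y. \<phi> (x + y) = \<phi> x + \<phi> y) \<Longrightarrow> (\<And>x y. \<phi> (x * y) = \<phi> x * \<phi> y) \<Longrightarrow> ring_hom \<phi>"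
  by (simp add: ring_hom_def)

lemma ring_hom_simps:
  assumes "ring_hom \<phi>"
  shows "\<phi> 0 = 0" "\<phi> 1 = 1" "\<phi> (x + y) = \<phi> x + \<phi> y" "\<phi> (x * y) = \<phi> x * \<phi> y"
    "\<phi> (- x) = - \<phi> x" "\<phi> (x - y) = \<phi> x - \<phi> y" "\<phi> (x ^ n) = \<phi> x ^ n" "\<phi> (of_nat n) = of_nat n"
proof -
  have *: "\<phi> 1 = 1" "\<And>x y. \<phi> (x + y) = \<phi> x + \<phi> y" "\<And>x y. \<phi> (x * y) = \<phi> x * \<phi> y"
    using assms by (auto simp: ring_hom_def)
  show z: "\<phi> 0 = 0" using *(2)[of 0 0] by simp
  have m: "\<phi> (- x) = - \<phi> x" for x
    using *(2)[of x "- x"] z by (simp add: eq_neg_iff_add_eq_0 add.commute)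
  show "\<phi> (- x) = - \<phi> x" by (rule m)
  show "\<phi> (x - y) = \<phi> x - \<phi> y" using *(2)[of x "- y"] m[of y] by simp
  show "\<phi> (x ^ n) = \<phi> x ^ n" by (induction n) (simp_all add: *)
  show "\<phi> (of_nat n) = of_nat n" by (induction n) (simp_all add: * z)
qed (use assms in \<open>auto simp: ring_hom_def\<close>)

lemma ring_hom_sum: "ring_hom \<phi> \<Longrightarrow> \<phi> (\<Sum>a\<in>A. f a) = (\<Sum>a\<in>A. \<phi> (f a))"
  by (induction A rule: infinite_finite_induct) (auto simp: ring_hom_simps)

lemma ring_hom_prod_list: "ring_hom \<phi> \<Longrightarrow> \<phi> (prod_list xs) = prod_list (map \<phi> xs)"
  by (induction xs) (auto simp: ring_hom_simps)

lemma ring_hom_comp: "ring_hom \<phi> \<Longrightarrow> ring_hom \<psi> \<Longrightarrow> ring_hom (\<lambda>x. \<phi> (\<psi> x))"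
  by (simp add: ring_hom_def)

lift_definition nmap :: "('a \<Rightarrow> 'b) \<Rightarrow> 'a nilcox \<Rightarrow> 'b nilcox" is "\<lambda>\<phi> f w. \<phi> (f w)" .

lemmas nc_nmap [simp] = nmap.rep_eq

lemma ring_hom_nmap: "ring_hom \<phi> \<Longrightarrow> ring_hom (nmap \<phi>)"
  by (rule ring_homI; rule nilcox_eqI)
    (auto simp: nc_mult ring_hom_simps ring_hom_sum case_prod_beta)

text \<open>The element c u_{a_1} ... u_{a_l}: it is c u_w if the word is a reduced word of w, and 0
  if the word is not reduced. The nilCoxeter relations are thus built into the definition.\<close>

lift_definition word_elt :: "int list \<Rightarrow> 'r::zero \<Rightarrow> 'r nilcox" is
  "\<lambda>as c w. if as \<in> reduced_words w then c else 0" .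

lemmas nc_word_elt = word_elt.rep_eq

lemma word_elt_Nil: "word_elt [] 1 = 1"
  by (rule nilcox_eqI) (auto simp: nc_word_elt reduced_words_def)

lemma word_elt_add: "word_elt as (x + y) = word_elt as x + word_elt as y"
  by (rule nilcox_eqI) (auto simp: nc_word_elt)

lemma word_elt_0 [simp]: "word_elt as 0 = 0"
  by (rule nilcox_eqI) (auto simp: nc_word_elt)

lemma word_elt_mult: "word_elt as x * word_elt bs y = word_elt (as @ bs) (x * y)"
proof (rule nilcox_eqI)
  fix w
  let ?a = "word_prod as" and ?b = "word_prod bs"
  have "nc (word_elt as x * word_elt bs y) w = (\<Sum>p\<in>factorizations w.
      if p = (?a, ?b) then (if as \<in> reduced_words ?a \<and> bs \<in> reduced_words ?b then x * y else 0) else 0)"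
    unfolding nc_mult by (rule sum.cong) (auto simp: nc_word_elt reduced_words_def split: if_splits)
  also have "\<dots> = nc (word_elt (as @ bs) (x * y)) w"
  proof -
    have "(?a, ?b) \<in> factorizations w \<longleftrightarrow> reduced_product w ?a ?b" by (simp add: factorizations_def)
    then show ?thesis by (simp add: nc_word_elt reduced_words_append)
  qed
  finally show "nc (word_elt as x * word_elt bs y) w = nc (word_elt (as @ bs) (x * y)) w" .
qed

lemma word_elt_cong:
  assumes "word_prod as = word_prod bs" "length as = length bs"
  shows "word_elt as x = word_elt bs x"
  using assms by (intro nilcox_eqI) (simp add: nc_word_elt reduced_words_def)

lemma word_elt_square: "word_elt [i, i] x = 0"
proof (rule nilcox_eqI)
  fix w
  have "[i, i] \<notin> reduced_words w" by (auto simp: reduced_words_def)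
  then show "nc (word_elt [i, i] x) w = nc 0 w" by (simp add: nc_word_elt)
qed

section \<open>The factors 1 + x u_i and their relations\<close>

definition hfac :: "int \<Rightarrow> 'r::comm_ring_1 \<Rightarrow> 'r nilcox" where
  "hfac i x = 1 + word_elt [i] x"

text \<open>Only the factorization (s_i, s_i w) can contribute, and it is reduced exactly when s_i
  is a left descent of \<open>w\<close>.\<close>

lemma nc_word_elt_mult:
  "nc (word_elt [i] x * f) w =
    (if len (simple_refl i * w) < len w then x * nc f (simple_refl i * w) else 0)"
proof -
  have *: "[i] \<in> reduced_words v \<longleftrightarrow> v = simple_refl i" for v by (auto simp: reduced_words_def)
  have "nc (word_elt [i] x * f) w = (\<Sum>p\<in>factorizations w.
      if p = (simple_refl i, simple_refl i * w) then x * nc f (simple_refl i * w) else 0)"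
    unfolding nc_mult
    by (rule sum.cong) (auto simp: nc_word_elt * factorizations_iff split: if_splits)
  moreover have "(simple_refl i, simple_refl i * w) \<in> factorizations w \<longleftrightarrow>
      len (simple_refl i * w) < len w"
    using len_simple_refl_mult_cases[of i w] by (auto simp: factorizations_iff)
  ultimately show ?thesis by simp
qed

lemma nc_mult_word_elt:
  "nc (f * word_elt [i] x) w =
    (if len (w * simple_refl i) < len w then x * nc f (w * simple_refl i) else 0)"
proof -
  have *: "[i] \<in> reduced_words v \<longleftrightarrow> v = simple_refl i" for v by (auto simp: reduced_words_def)
  have "nc (f * word_elt [i] x) w = (\<Sum>p\<in>factorizations w.
      if p = (w * simple_refl i, simple_refl i) then x * nc f (w * simple_refl i) else 0)"
    unfolding nc_mult
    by (rule sum.cong) (auto simp: nc_word_elt * factorizations_iff mult.assoc split: if_splits)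
  moreover have "(w * simple_refl i, simple_refl i) \<in> factorizations w \<longleftrightarrow>
      len (w * simple_refl i) < len w"
    using len_mult_simple_refl_cases[of w i] by (auto simp: factorizations_iff mult.assoc)
  ultimately show ?thesis by simp
qed

lemma nc_hfac_mult:
  "nc (hfac i x * f) w = nc f w +
    (if len (simple_refl i * w) < len w then x * nc f (simple_refl i * w) else 0)"
  by (simp add: hfac_def distrib_right nc_word_elt_mult)

lemma hfac_0 [simp]: "hfac i 0 = 1"
  by (simp add: hfac_def)

lemma nmap_word_elt: "ring_hom \<phi> \<Longrightarrow> nmap \<phi> (word_elt as x) = word_elt as (\<phi> x)"
  by (rule nilcox_eqI) (simp add: nc_word_elt ring_hom_simps)

lemma nmap_hfac: "ring_hom \<phi> \<Longrightarrow> nmap \<phi> (hfac i x) = hfac i (\<phi> x)"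
  by (simp add: hfac_def ring_hom_simps ring_hom_nmap nmap_word_elt)

lemmas hfac_calc = hfac_def word_elt_Nil [symmetric] distrib_left distrib_right word_elt_mult word_elt_add

text \<open>Since u_i^2 = 0, \<open>hfac i x\<close> is exp (x u_i), a one-parameter group.\<close>

lemma hfac_add: "hfac i x * hfac i y = hfac i (x + y)"
  by (simp add: hfac_calc word_elt_square)

lemma hfac_inverse [simp]: "hfac i x * hfac i (- x) = 1" "hfac i (- x) * hfac i x = 1"
  by (simp_all add: hfac_add)

lemma hfac_commute:
  assumes "i + 1 < j \<or> j + 1 < i"
  shows "hfac i x * hfac j y = hfac j y * hfac i x"
proof -
  have "word_elt [i, j] (x * y) = word_elt [j, i] (y * x)"
    using simple_refl_commute[OF assms] by (simp add: mult.commute word_elt_cong[of "[i, j]" "[j, i]"])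
  then show ?thesis by (simp add: hfac_calc)
qed

text \<open>In degrees up to 2 the two sides agree term by term because squares of generators
  vanish; in degree 3 both have the coefficient x (x + y) y, and the braid relation identifies the
  words.\<close>

lemma hfac_yang_baxter:
  "hfac i x * hfac (i + 1) (x + y) * hfac i y = hfac (i + 1) y * hfac i (x + y) * hfac (i + 1) x"
proof -
  have "word_elt [i, i + 1, i] z = word_elt [i + 1, i, i + 1] z" for z :: 'a
    by (rule word_elt_cong) (simp_all add: simple_refl_braid)
  then show ?thesis by (simp add: hfac_calc word_elt_square algebra_simps)
qed

text \<open>In the notation of the overview A_b(x) is \<open>desc b N x\<close> and A(x) is
  \<open>desc (- N) N x\<close>, with the letters cut off at -N and N. The inverse factors are
  \<open>asc\<close> at the negated variable.\<close>

definition desc :: "int \<Rightarrow> int \<Rightarrow> 'r::comm_ring_1 \<Rightarrow> 'r nilcox" where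
  "desc m n x = prod_list (map (\<lambda>i. hfac i x) (rev [m..n]))"

definition asc :: "int \<Rightarrow> int \<Rightarrow> 'r::comm_ring_1 \<Rightarrow> 'r nilcox" where
  "asc m n x = prod_list (map (\<lambda>i. hfac i x) [m..n])"

lemma desc_empty: "n < m \<Longrightarrow> desc m n x = 1" and asc_empty: "n < m \<Longrightarrow> asc m n x = 1"
  by (simp_all add: desc_def asc_def)

lemma desc_split: "m \<le> k \<Longrightarrow> k \<le> n + 1 \<Longrightarrow> desc m n x = desc k n x * desc m (k - 1) x"
  by (cases "k = n + 1") (simp_all add: desc_def upto_split1[of m k n])

lemma desc_bottom: "m \<le> n \<Longrightarrow> desc m n x = desc (m + 1) n x * hfac m x"
  by (simp add: desc_def upto_rec1[of m n])

lemma desc_asc_inverse [simp]: "desc m n x * asc m n (- x) = 1" "asc m n (- x) * desc m n x = 1"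
proof -
  have "prod_list (map (\<lambda>i. hfac i x) (rev is)) * prod_list (map (\<lambda>i. hfac i (- x)) is) = 1" for "is"
  proof (induction "is")
    case (Cons i "is")
    have "prod_list (map (\<lambda>i. hfac i x) (rev is)) * (hfac i x * hfac i (- x)) * prod_list (map (\<lambda>i. hfac i (- x)) is) = 1"
      using Cons.IH by simp
    then show ?case by (simp only: rev.simps map_append prod_list.append list.map prod_list.Cons prod_list.Nil mult_1_right mult.assoc)
  qed simp
  then show "desc m n x * asc m n (- x) = 1" by (simp add: desc_def asc_def)
  have "prod_list (map (\<lambda>i. hfac i (- x)) is) * prod_list (map (\<lambda>i. hfac i x) (rev is)) = 1" for "is"
  proof (induction "is" rule: rev_induct)
    case (snoc i "is")
    have "prod_list (map (\<lambda>i. hfac i (- x)) is) * (hfac i (- x) * hfac i x) * prod_list (map (\<lambda>i. hfac i x) (rev is)) = 1"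
      using snoc.IH by simp
    then show ?case by (simp only: rev_append rev.simps append_Nil append_Cons map_append prod_list.append list.map prod_list.Cons prod_list.Nil mult_1_right mult.assoc)
  qed simp
  then show "asc m n (- x) * desc m n x = 1" by (simp add: desc_def asc_def)
qed

lemma prod_list_commute:
  fixes a :: "'a::monoid_mult"
  assumes "\<And>b. b \<in> set bs \<Longrightarrow> a * b = b * a"
  shows "a * prod_list bs = prod_list bs * a"
  using assms
proof (induction bs)
  case (Cons b bs)
  have "a * (b * prod_list bs) = b * (a * prod_list bs)"
    using Cons.prems[of b] by (simp flip: mult.assoc)
  also have "\<dots> = b * prod_list bs * a" using Cons by (simp add: mult.assoc)
  finally show ?case by simp
qed simp

text \<open>The commutativity argument of Fomin and Stanley: move the smallest letter through with the
  Yang--Baxter equation.\<close>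

lemma desc_commute: "desc m n x * desc m n y = desc m n y * desc m n x"
proof (induction "nat (n - m + 1)" arbitrary: m)
  case 0
  then show ?case by (simp add: desc_empty)
next
  case (Suc k)
  then have mn: "m \<le> n" by simp
  have IH: "desc (m + 1) n x * desc (m + 1) n y = desc (m + 1) n y * desc (m + 1) n x"
    using Suc by (intro Suc(1)) simp
  show ?case
  proof (cases "m = n")
    case True
    then show ?thesis by (simp add: desc_def hfac_add add.commute)
  next
    case False
    with mn have mn': "m + 1 \<le> n" by simp
    have d2: "desc (m + 1) n z = desc (m + 2) n z * hfac (m + 1) z" for z :: 'a
    proof -
      have "m + 1 + 1 = m + 2" by simp
      from desc_bottom[OF mn', unfolded this] show ?thesis .
    qed
    have d2': "desc (m + 2) n z = desc (m + 1) n z * hfac (m + 1) (- z)" for z :: 'a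
      by (simp add: d2 mult.assoc)
    have comm: "hfac m z * desc (m + 2) n z' = desc (m + 2) n z' * hfac m z" for z z' :: 'a
      unfolding desc_def by (rule prod_list_commute) (auto intro: hfac_commute)
    have A: "desc m n z * desc m n z' =
        desc (m + 1) n z * desc (m + 2) n z' * (hfac m z * hfac (m + 1) z' * hfac m z')" for z z' :: 'a
    proof -
      have "desc m n z * desc m n z' =
          desc (m + 1) n z * (hfac m z * desc (m + 2) n z') * hfac (m + 1) z' * hfac m z'"
        using desc_bottom[OF mn, of z] desc_bottom[OF mn, of z'] d2[of z'] by (simp add: mult.assoc)
      also have "hfac m z * desc (m + 2) n z' = desc (m + 2) n z' * hfac m z" by (rule comm)
      finally show ?thesis by (simp add: mult.assoc)
    qed
    \<comment> \<open>With last argument y - x the Yang-Baxter triple begins with x and y. What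
      remains of \<open>hfac m y\<close> is then \<open>hfac m x\<close>, the last factor of the
      triple with x and y exchanged.\<close>
    have yb: "hfac m x * hfac (m + 1) y * hfac m (y - x) = hfac (m + 1) (y - x) * hfac m y * hfac (m + 1) x"
      using hfac_yang_baxter[of m x "y - x"] by simp
    have "hfac m x * hfac (m + 1) y * hfac m y = hfac m x * hfac (m + 1) y * hfac m (y - x) * hfac m x"
      by (simp add: mult.assoc hfac_add)
    then have h: "hfac m x * hfac (m + 1) y * hfac m y = hfac (m + 1) (y - x) * (hfac m y * hfac (m + 1) x * hfac m x)"
      unfolding yb by (simp add: mult.assoc)
    \<comment> \<open>The factor moved to the left completes \<open>desc (m + 2) n y\<close> to
      \<open>desc (m + 1) n y\<close>, up to \<open>hfac (m + 1) (- x)\<close>, so that the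
      induction hypothesis applies.\<close>
    have "desc (m + 1) n x * desc (m + 2) n y * hfac (m + 1) (y - x) =
        desc (m + 1) n x * desc (m + 1) n y * hfac (m + 1) (- x)"
      by (simp add: d2' mult.assoc hfac_add)
    also have "\<dots> = desc (m + 1) n y * desc (m + 2) n x"
      by (simp only: IH d2' mult.assoc)
    finally have e: "desc (m + 1) n x * desc (m + 2) n y * hfac (m + 1) (y - x) =
        desc (m + 1) n y * desc (m + 2) n x" .
    have "desc m n x * desc m n y =
        (desc (m + 1) n x * desc (m + 2) n y * hfac (m + 1) (y - x)) * (hfac m y * hfac (m + 1) x * hfac m x)"
      unfolding A[of x y] h by (simp only: mult.assoc)
    also have "\<dots> = desc m n y * desc m n x"
      unfolding e A[of y x] by (rule refl)
    finally show ?thesis .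
  qed
qed

lemma nmap_prod_list: "ring_hom \<phi> \<Longrightarrow> nmap \<phi> (prod_list fs) = prod_list (map (nmap \<phi>) fs)"
  by (rule ring_hom_prod_list) (rule ring_hom_nmap)

lemma nmap_desc: "ring_hom \<phi> \<Longrightarrow> nmap \<phi> (desc m n x) = desc m n (\<phi> x)"
  by (simp add: desc_def nmap_prod_list nmap_hfac comp_def)

lemma nmap_asc: "ring_hom \<phi> \<Longrightarrow> nmap \<phi> (asc m n x) = asc m n (\<phi> x)"
  by (simp add: asc_def nmap_prod_list nmap_hfac comp_def)

subsection \<open>The grading\<close>

text \<open>Weights by length: powers of t rescale the variable, \<open>of_nat\<close> gives the
  Euler derivation, and an indicator function projects to a homogeneous component.\<close>

lift_definition wt :: "(nat \<Rightarrow> 'r::times) \<Rightarrow> 'r nilcox \<Rightarrow> 'r nilcox" is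
  "\<lambda>P f w. P (len w) * f w" .

lemmas nc_wt [simp] = wt.rep_eq

lemma wt_add: "wt P (f + g) = wt P f + wt P g" for f :: "'r::comm_ring_1 nilcox"
  by (rule nilcox_eqI) (simp add: distrib_left)

lemma wt_add_left: "wt (\<lambda>n. P n + Q n) f = wt P f + wt Q f" for f :: "'r::comm_ring_1 nilcox"
  by (rule nilcox_eqI) (simp add: distrib_right)

lemma wt_wt: "wt P (wt Q f) = wt (\<lambda>n. P n * Q n) f" for f :: "'r::comm_ring_1 nilcox"
  by (rule nilcox_eqI) (simp add: mult.assoc)

lemma nmap_wt: "ring_hom \<phi> \<Longrightarrow> nmap \<phi> (wt P f) = wt (\<lambda>n. \<phi> (P n)) (nmap \<phi> f)"
  by (rule nilcox_eqI) (simp add: ring_hom_simps)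

lemma ring_hom_wt_power: "ring_hom (wt (\<lambda>n. t ^ n))" for t :: "'r::comm_ring_1"
proof (rule ring_homI)
  fix f g :: "'r nilcox"
  show "wt (\<lambda>n. t ^ n) (f * g) = wt (\<lambda>n. t ^ n) f * wt (\<lambda>n. t ^ n) g"
    by (rule nilcox_eqI)
      (auto simp: nc_mult sum_distrib_left factorizations_iff power_add mult_ac intro!: sum.cong)
qed (auto simp: wt_add intro!: nilcox_eqI)

lemma wt_power_hfac: "wt (\<lambda>n. t ^ n) (hfac i x) = hfac i (t * x)" for t :: "'r::comm_ring_1"
proof -
  have "wt (\<lambda>n. t ^ n) (word_elt [i] x) = word_elt [i] (t * x)"
    by (rule nilcox_eqI) (auto simp: nc_word_elt reduced_words_def)
  then show ?thesis
    by (simp add: hfac_def ring_hom_simps[OF ring_hom_wt_power])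
qed

lemma wt_power_desc: "wt (\<lambda>n. t ^ n) (desc m n x) = desc m n (t * x)" for t :: "'r::comm_ring_1"
  by (simp add: desc_def ring_hom_prod_list[OF ring_hom_wt_power] comp_def wt_power_hfac)

lemma wt_power_asc: "wt (\<lambda>n. t ^ n) (asc m n x) = asc m n (t * x)" for t :: "'r::comm_ring_1"
  by (simp add: asc_def ring_hom_prod_list[OF ring_hom_wt_power] comp_def wt_power_hfac)

text \<open>On \<open>desc m n x\<close> this is x d/dx, because every letter carries one x. It acts
  through the length alone, so no derivation of the coefficient ring is required.\<close>

abbreviation deg_deriv :: "'r::comm_ring_1 nilcox \<Rightarrow> 'r nilcox" where
  "deg_deriv \<equiv> wt of_nat"

lemma deg_deriv_mult: "deg_deriv (f * g) = deg_deriv f * g + f * deg_deriv g"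
  by (rule nilcox_eqI)
    (auto simp: nc_mult sum_distrib_left factorizations_iff algebra_simps simp flip: sum.distrib
      intro!: sum.cong)

abbreviation hcomp :: "nat \<Rightarrow> 'r::comm_ring_1 nilcox \<Rightarrow> 'r nilcox" where
  "hcomp k \<equiv> wt (\<lambda>n. if n = k then 1 else 0)"

text \<open>Every homogeneous component of f commutes with every one of g. Plain commutation would
  not pass to \<open>wt P f\<close>, hence not to the logarithmic derivative.\<close>

definition graded_commute :: "'r::comm_ring_1 nilcox \<Rightarrow> 'r nilcox \<Rightarrow> bool" where
  "graded_commute f g \<longleftrightarrow> (\<forall>P Q. wt P f * wt Q g = wt Q g * wt P f)"

lemma graded_commute_sym: "graded_commute f g \<Longrightarrow> graded_commute g f"
  by (auto simp: graded_commute_def)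

lemma graded_commuteD: "graded_commute f g \<Longrightarrow> wt P f * wt Q g = wt Q g * wt P f"
  by (simp add: graded_commute_def)

lemma graded_commute_wt: "graded_commute f g \<Longrightarrow> graded_commute f (wt P g)"
  by (simp add: graded_commute_def wt_wt)

lemma wt_trivial: "wt (\<lambda>n. 1) f = f" for f :: "'r::comm_ring_1 nilcox"
  by (rule nilcox_eqI) simp

text \<open>In the coefficient at \<open>w\<close> the two lengths add up to \<open>len w\<close>,
  so the length of one factor determines the weight of the other. It therefore suffices to grade one
  side.\<close>

lemma graded_commute_iff: "graded_commute f g \<longleftrightarrow> (\<forall>k. hcomp k f * g = g * hcomp k f)"
proof
  assume "graded_commute f g"
  then show "\<forall>k. hcomp k f * g = g * hcomp k f"
    using graded_commuteD[of f g _ "\<lambda>n. 1"] by (simp add: wt_trivial)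
next
  assume *: "\<forall>k. hcomp k f * g = g * hcomp k f"
  show "graded_commute f g"
    unfolding graded_commute_def
  proof (intro allI, rule nilcox_eqI)
    fix P Q :: "nat \<Rightarrow> 'a" and w
    have "nc (wt P f * wt Q g) w =
        (\<Sum>(x, y)\<in>factorizations w. \<Sum>k\<le>len w. if len x = k then P k * Q (len w - k) * (nc f x * nc g y) else 0)"
      by (auto simp: nc_mult factorizations_iff mult_ac intro!: sum.cong)
    also have "\<dots> = (\<Sum>k\<le>len w. P k * Q (len w - k) * nc (hcomp k f * g) w)"
      unfolding case_prod_beta
      by (subst sum.swap) (auto simp: nc_mult case_prod_beta sum_distrib_left intro!: sum.cong)
    also have "\<dots> = (\<Sum>k\<le>len w. P k * Q (len w - k) * nc (g * hcomp k f) w)"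
      using * by simp
    also have "\<dots> = (\<Sum>(y, x)\<in>factorizations w. \<Sum>k\<le>len w. if len x = k then P k * Q (len w - k) * (nc f x * nc g y) else 0)"
      unfolding case_prod_beta
      by (subst sum.swap) (auto simp: nc_mult case_prod_beta sum_distrib_left mult_ac intro!: sum.cong)
    also have "\<dots> = nc (wt Q g * wt P f) w"
      by (auto simp: nc_mult factorizations_iff mult_ac intro!: sum.cong)
    finally show "nc (wt P f * wt Q g) w = nc (wt Q g * wt P f) w" .
  qed
qed

lemma graded_commute_mult:
  assumes "graded_commute f g" "graded_commute f h"
  shows "graded_commute f (g * h)"
  unfolding graded_commute_iff
proof
  fix k
  have "hcomp k f * (g * h) = g * (hcomp k f * h)"
    using assms(1) by (simp add: graded_commute_iff flip: mult.assoc)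
  then show "hcomp k f * (g * h) = g * h * hcomp k f"
    using assms(2) by (simp add: graded_commute_iff mult.assoc)
qed

lemma graded_commute_add: "graded_commute f g \<Longrightarrow> graded_commute f h \<Longrightarrow> graded_commute f (g + h)"
  by (simp add: graded_commute_iff distrib_left distrib_right)

lemma graded_commute_1: "graded_commute f 1"
  by (simp add: graded_commute_iff)

lemma graded_commute_inverse:
  assumes "graded_commute f g" "g * g' = 1" "g' * g = 1"
  shows "graded_commute f g'"
  unfolding graded_commute_iff
proof
  fix k
  have "g' * (hcomp k f * g) * g' = g' * (g * hcomp k f) * g'"
    using assms(1) by (simp add: graded_commute_iff)
  then have "g' * hcomp k f * (g * g') = (g' * g) * hcomp k f * g'" by (simp add: mult.assoc)
  then show "hcomp k f * g' = g' * hcomp k f" using assms(2,3) by simp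
qed

text \<open>Commutation at independent variables contains commutation of all components:
  \<open>desc_commute\<close> is applied over \<open>'r poly\<close> with an indeterminate X and 1,
  and coefficients of X^k are compared.\<close>

lemma graded_commute_desc: "graded_commute (desc m n 1) (desc m n 1 :: 'r::comm_ring_1 nilcox)"
  unfolding graded_commute_iff
proof (intro allI nilcox_eqI)
  fix k w
  let ?a = "desc m n 1 :: 'r nilcox" and ?b = "desc m n 1 :: 'r poly nilcox"
  let ?X = "[:0, 1:] :: 'r poly"
  have hom: "ring_hom (\<lambda>c::'r. [:c:])" by (rule ring_homI) auto
  have b: "nc ?b v = [:nc ?a v:]" for v
    using nmap_desc[OF hom, of m n 1] by (metis nc_nmap pCons_one)
  have bX: "nc (desc m n ?X) v = monom (nc ?a v) (len v)" for v
    using arg_cong[OF wt_power_desc[of ?X m n 1], of "\<lambda>f. nc f v"]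
    by (simp add: b monom_altdef)
  have "nc (hcomp k ?a * ?a) w = poly.coeff (nc (desc m n ?X * ?b) w) k"
    by (auto simp: nc_mult coeff_sum b bX smult_monom mult_ac intro!: sum.cong)
  also have "desc m n ?X * ?b = ?b * desc m n ?X" by (rule desc_commute)
  also have "poly.coeff (nc (?b * desc m n ?X) w) k = nc (?a * hcomp k ?a) w"
    by (auto simp: nc_mult coeff_sum b bX smult_monom mult_ac intro!: sum.cong)
  finally show "nc (hcomp k ?a * ?a) w = nc (?a * hcomp k ?a) w" .
qed

section \<open>Evaluation of polynomials\<close>

definition mval :: "('v \<Rightarrow> 'r::comm_ring_1) \<Rightarrow> ('v \<Rightarrow>\<^sub>0 nat) \<Rightarrow> 'r" where
  "mval f m = (\<Prod>v\<in>Poly_Mapping.keys m. f v ^ Poly_Mapping.lookup m v)"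

lemma mval_superset:
  assumes "finite S" "Poly_Mapping.keys m \<subseteq> S"
  shows "mval f m = (\<Prod>v\<in>S. f v ^ Poly_Mapping.lookup m v)"
  unfolding mval_def by (rule prod.mono_neutral_left) (use assms in \<open>auto simp: in_keys_iff\<close>)

lemma mval_0 [simp]: "mval f 0 = 1"
  by (simp add: mval_def)

lemma mval_add: "mval f (m + n) = mval f m * mval f n"
proof -
  let ?S = "Poly_Mapping.keys m \<union> Poly_Mapping.keys n"
  have "mval f k = (\<Prod>v\<in>?S. f v ^ Poly_Mapping.lookup k v)" if "k \<in> {m, n, m + n}" for k
    using that keys_add[of m n] by (intro mval_superset) auto
  then show ?thesis by (simp add: lookup_add power_add prod.distrib)
qed

lemma mval_single: "mval f (Poly_Mapping.single v n) = f v ^ n"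
  by (simp add: mval_def)

lemma mpoly_expand: "p = (\<Sum>m\<in>Poly_Mapping.keys p. Poly_Mapping.single m (Poly_Mapping.lookup p m))"
  for p :: "'a \<Rightarrow>\<^sub>0 'b::comm_monoid_add"
proof (rule poly_mapping_eqI)
  fix k
  show "Poly_Mapping.lookup p k =
      Poly_Mapping.lookup (\<Sum>m\<in>Poly_Mapping.keys p. Poly_Mapping.single m (Poly_Mapping.lookup p m)) k"
    by (simp add: lookup_sum lookup_single when_def in_keys_iff)
qed

lemma peval_superset:
  assumes "ring_hom c" "finite S" "Poly_Mapping.keys p \<subseteq> S"
  shows "peval c f p = (\<Sum>m\<in>S. c (Poly_Mapping.lookup p m) * mval f m)"
  unfolding peval_def mval_def[symmetric]
  by (rule sum.mono_neutral_left) (use assms in \<open>auto simp: in_keys_iff ring_hom_simps\<close>)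

lemma peval_single:
  assumes "ring_hom c"
  shows "peval c f (Poly_Mapping.single m a) = c a * mval f m"
  using peval_superset[OF assms, of "{m}" "Poly_Mapping.single m a"] by simp

lemma peval_add:
  assumes "ring_hom c"
  shows "peval c f (p + q) = peval c f p + peval c f q"
proof -
  let ?S = "Poly_Mapping.keys p \<union> Poly_Mapping.keys q"
  have "peval c f r = (\<Sum>m\<in>?S. c (Poly_Mapping.lookup r m) * mval f m)" if "r \<in> {p, q, p + q}" for r
    using that keys_add[of p q] by (intro peval_superset[OF assms]) auto
  then show ?thesis by (simp add: lookup_add ring_hom_simps[OF assms] distrib_right sum.distrib)
qed

lemma peval_sum: "ring_hom c \<Longrightarrow> peval c f (\<Sum>a\<in>A. p a) = (\<Sum>a\<in>A. peval c f (p a))"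
proof (induction A rule: infinite_finite_induct)
  case (insert x F)
  then show ?case by (simp add: peval_add)
qed (simp_all add: peval_def)

lemma ring_hom_peval:
  fixes f :: "'v \<Rightarrow> 'r::comm_ring_1"
  assumes c: "ring_hom c"
  shows "ring_hom (peval c f)"
proof (rule ring_homI)
  show "peval c f 1 = 1"
    using peval_single[OF c, of f 0 1] by (simp add: ring_hom_simps[OF c])
next
  fix p q :: "'v mpoly"
  show "peval c f (p + q) = peval c f p + peval c f q" by (rule peval_add[OF c])
  let ?s = "\<lambda>r m. Poly_Mapping.single m (Poly_Mapping.lookup r m) :: 'v mpoly"
  have "p * q = (\<Sum>m\<in>Poly_Mapping.keys p. \<Sum>n\<in>Poly_Mapping.keys q. ?s p m * ?s q n)"
    by (subst mpoly_expand[of p], subst mpoly_expand[of q]) (simp add: sum_product)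
  also have "peval c f \<dots> = (\<Sum>m\<in>Poly_Mapping.keys p. \<Sum>n\<in>Poly_Mapping.keys q.
      (c (Poly_Mapping.lookup p m) * mval f m) * (c (Poly_Mapping.lookup q n) * mval f n))"
    by (simp add: peval_sum[OF c] mult_single peval_single[OF c] mval_add ring_hom_simps[OF c] mult_ac)
  also have "\<dots> = peval c f p * peval c f q"
    by (simp add: peval_def mval_def sum_product)
  finally show "peval c f (p * q) = peval c f p * peval c f q" .
qed

lemma peval_const: "ring_hom c \<Longrightarrow> peval c f (Poly_Mapping.single 0 a) = c a"
  by (simp add: peval_single)

lemma peval_Var: "ring_hom c \<Longrightarrow> peval c f (Var v) = f v"
  by (simp add: Var_def peval_single mval_single ring_hom_simps)

lemma ring_hom_const: "ring_hom (Poly_Mapping.single 0 :: 'a \<Rightarrow> ('b::comm_monoid_add \<Rightarrow>\<^sub>0 'a::comm_ring_1))"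
  by (rule ring_homI) (simp_all add: single_add mult_single)

lemma ring_hom_psubst: "ring_hom (psubst f)"
  unfolding psubst_def by (rule ring_hom_peval[OF ring_hom_const])

lemma psubst_const [simp]: "psubst f (Poly_Mapping.single 0 a) = Poly_Mapping.single 0 a"
  unfolding psubst_def by (rule peval_const[OF ring_hom_const])

lemma psubst_Var [simp]: "psubst f (Var v) = f v"
  unfolding psubst_def by (rule peval_Var[OF ring_hom_const])

lemma mpoly_induct [case_names const Var add mult]:
  fixes p :: "'v mpoly"
  assumes const: "\<And>a. P (Poly_Mapping.single 0 a)" and Var: "\<And>v. P (Var v)"
    and add: "\<And>p q. P p \<Longrightarrow> P q \<Longrightarrow> P (p + q)" and mult: "\<And>p q. P p \<Longrightarrow> P q \<Longrightarrow> P (p * q)"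
  shows "P p"
proof -
  have P0: "P 0" and P1: "P 1" using const[of 0] const[of 1] by simp_all
  have pow: "P (Poly_Mapping.single (Poly_Mapping.single v n) 1)" for v :: 'v and n :: nat
  proof (induction n)
    case (Suc n)
    have "Poly_Mapping.single (Poly_Mapping.single v (Suc n)) (1 :: rat)
        = Var v * Poly_Mapping.single (Poly_Mapping.single v n) 1"
      by (simp add: Var_def mult_single flip: single_add)
    then show ?case using Suc mult[OF Var] by simp
  qed (simp add: P1)
  have mon: "P (Poly_Mapping.single m 1)" for m :: "'v \<Rightarrow>\<^sub>0 nat"
  proof -
    have "P (Poly_Mapping.single (\<Sum>v\<in>A. Poly_Mapping.single v (Poly_Mapping.lookup m v)) 1)" if "finite A" for A
      using that
    proof (induction A)
      case (insert x F)
      have "Poly_Mapping.single (\<Sum>v\<in>insert x F. Poly_Mapping.single v (Poly_Mapping.lookup m v)) (1 :: rat)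
        = Poly_Mapping.single (Poly_Mapping.single x (Poly_Mapping.lookup m x)) 1 *
          Poly_Mapping.single (\<Sum>v\<in>F. Poly_Mapping.single v (Poly_Mapping.lookup m v)) 1"
        using insert by (simp add: mult_single)
      then show ?case using insert mult[OF pow] by simp
    qed (simp add: P1)
    from this[OF finite_keys[of m]] show ?thesis by (simp flip: mpoly_expand)
  qed
  have single: "P (Poly_Mapping.single m a)" for m a
  proof -
    have "Poly_Mapping.single m a = Poly_Mapping.single 0 a * Poly_Mapping.single m 1"
      by (simp add: mult_single)
    then show ?thesis using mult[OF const mon] by simp
  qed
  have "P (\<Sum>m\<in>A. Poly_Mapping.single m (Poly_Mapping.lookup p m))" if "finite A" for A
    using that by (induction A) (auto simp: P0 add single)
  from this[OF finite_keys[of p]] show ?thesis by (simp flip: mpoly_expand)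
qed

lemma mpoly_hom_eqI:
  assumes "ring_hom \<phi>" "ring_hom \<psi>"
    and "\<And>a. \<phi> (Poly_Mapping.single 0 a) = \<psi> (Poly_Mapping.single 0 a)" "\<And>v. \<phi> (Var v) = \<psi> (Var v)"
  shows "\<phi> p = \<psi> p"
  by (induction p rule: mpoly_induct) (simp_all add: assms ring_hom_simps[OF assms(1)] ring_hom_simps[OF assms(2)])

lemma psubst_psubst: "psubst f (psubst g p) = psubst (\<lambda>v. psubst f (g v)) p"
  by (rule mpoly_hom_eqI[OF ring_hom_comp[OF ring_hom_psubst ring_hom_psubst] ring_hom_psubst]) simp_all

lemma psubst_Var_id: "psubst Var p = p"
  by (rule mpoly_hom_eqI[OF ring_hom_psubst, where \<psi> = "\<lambda>x. x"]) (simp_all add: ring_homI)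

text \<open>The part of characteristic 0 that uniqueness for the differential equation needs: the
  factor \<open>len w\<close> produced by \<open>deg_deriv\<close> can be cancelled.\<close>

definition torsion_free :: "'r::comm_ring_1 itself \<Rightarrow> bool" where
  "torsion_free _ \<longleftrightarrow> (\<forall>n (a::'r). 0 < n \<longrightarrow> of_nat n * a = 0 \<longrightarrow> a = 0)"

lemma torsion_freeD:
  "torsion_free TYPE('r::comm_ring_1) \<Longrightarrow> of_nat n * (a::'r) = of_nat n * b \<Longrightarrow> 0 < n \<Longrightarrow> a = b"
  unfolding torsion_free_def by (metis eq_iff_diff_eq_0 right_diff_distrib)

lemma inverse_nat_mpoly:
  "0 < n \<Longrightarrow> of_nat n * (Poly_Mapping.single 0 (1 / of_nat n) :: 'v mpoly) = 1"
  by (simp add: mult_single flip: single_of_nat)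

lemma torsion_free_mpoly: "torsion_free TYPE('v mpoly)"
  unfolding torsion_free_def
proof (intro allI impI)
  fix n and a :: "'v mpoly"
  assume "0 < n" "of_nat n * a = 0"
  then have "(of_nat n * Poly_Mapping.single 0 (1 / of_nat n)) * a = 0"
    by (metis mult.assoc mult.commute mult_zero_right)
  then show "a = 0" using \<open>0 < n\<close> by (simp add: inverse_nat_mpoly)
qed

section \<open>The generating function of the Stanley symmetric functions\<close>

lemma nc_mult_1: "nc (f * g) 1 = nc f 1 * nc g 1"
proof -
  have "factorizations 1 = {(1, 1)}"
  proof -
    have "x = 1 \<and> y = 1" if "(x, y) \<in> factorizations 1" for x y
      using that by (auto simp: factorizations_iff)
    then show ?thesis by (auto simp: factorizations_iff)
  qed
  then show ?thesis by (simp add: nc_mult)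
qed

text \<open>Without a constant term, \<open>e\<close> uses up at least one letter, so only
  coefficients at strictly shorter elements of the right factor matter.\<close>

lemma nc_mult_cong:
  assumes "\<And>y. len y < len w \<Longrightarrow> nc f y = nc g y" "nc e 1 = 0"
  shows "nc (e * f) w = nc (e * g) w"
  unfolding nc_mult
proof (rule sum.cong[OF refl], clarify)
  fix x y assume "(x, y) \<in> factorizations w"
  then have "x = 1 \<or> len y < len w" by (auto simp: factorizations_iff)
  then show "nc e x * nc f y = nc e x * nc g y" using assms by auto
qed

text \<open>Induction on the length: the left side of the equation is \<open>len w\<close> times the
  coefficient at \<open>w\<close>, while the right side sees only shorter elements.\<close>

lemma ode_unique:
  fixes f g :: "'r::comm_ring_1 nilcox"
  assumes "torsion_free TYPE('r)" "nc e 1 = 0"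
    "deg_deriv f = e * f" "deg_deriv g = e * g" "nc f 1 = nc g 1"
  shows "f = g"
proof (rule nilcox_eqI)
  fix w show "nc f w = nc g w"
  proof (induction "len w" arbitrary: w rule: less_induct)
    case less
    show ?case
    proof (cases "w = 1")
      case False
      have "nc (e * f) w = nc (e * g) w" using less assms(2) by (intro nc_mult_cong) auto
      then have "of_nat (len w) * nc f w = of_nat (len w) * nc g w"
        using arg_cong[OF assms(3), of "\<lambda>f. nc f w"] arg_cong[OF assms(4), of "\<lambda>f. nc f w"] by simp
      then show ?thesis by (rule torsion_freeD[OF assms(1)]) (simp add: neq0_conv[symmetric] False)
    qed (simp add: assms(5))
  qed
qed

lemma ode_mult:
  assumes "deg_deriv f = e * f" "deg_deriv f' = e' * f'" "e' * f = f * e'"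
  shows "deg_deriv (f * f') = (e + e') * (f * f')"
  using assms by (simp add: deg_deriv_mult distrib_right flip: mult.assoc)

text \<open>A' A^(-1) at x = 1, the inverse being \<open>asc m n (- 1)\<close>. Evaluation at 1
  loses nothing: the grading recovers the value at x through the weights x^k.\<close>

definition log_deriv :: "int \<Rightarrow> int \<Rightarrow> 'r::comm_ring_1 nilcox" where
  "log_deriv m n = deg_deriv (desc m n 1) * asc m n (- 1)"

lemma nc_log_deriv_1 [simp]: "nc (log_deriv m n) 1 = 0"
  by (simp add: log_deriv_def nc_mult_1)

lemma nmap_log_deriv: "ring_hom \<phi> \<Longrightarrow> nmap \<phi> (log_deriv m n) = log_deriv m n"
  by (simp add: log_deriv_def ring_hom_simps[OF ring_hom_nmap] nmap_wt nmap_desc nmap_asc ring_hom_simps)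

lemma graded_commute_desc_log_deriv: "graded_commute (desc m n 1) (log_deriv m n)"
  unfolding log_deriv_def
  by (intro graded_commute_mult graded_commute_wt graded_commute_inverse[OF _ desc_asc_inverse] graded_commute_desc)

lemma graded_commute_log_deriv: "graded_commute (log_deriv m n) (log_deriv m n)"
  by (subst (2) log_deriv_def)
    (intro graded_commute_mult graded_commute_wt graded_commute_inverse[OF _ desc_asc_inverse]
      graded_commute_sym[OF graded_commute_desc_log_deriv])

lemma deg_deriv_desc: "deg_deriv (desc m n x) = wt (\<lambda>k. x ^ k) (log_deriv m n) * desc m n x"
proof -
  have "wt (\<lambda>k. x ^ k) (log_deriv m n) = deg_deriv (desc m n x) * asc m n (- x)"
    using wt_power_desc[of x m n 1, symmetric] wt_power_asc[of x m n "- 1", symmetric]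
    by (simp add: log_deriv_def ring_hom_simps[OF ring_hom_wt_power] wt_wt mult.commute)
  then show ?thesis by (simp add: mult.assoc)
qed

text \<open>Logarithmic derivatives of commuting factors add up; summing the weights x^k over the
  list produces its power sums.\<close>

lemma deg_deriv_prod_desc:
  "deg_deriv (prod_list (map (desc m n) xs)) =
    wt (\<lambda>k. \<Sum>x\<leftarrow>xs. x ^ k) (log_deriv m n) * prod_list (map (desc m n) xs)"
proof (induction xs)
  case Nil
  show ?case by (rule nilcox_eqI) (auto simp: nc_mult)
next
  case (Cons x xs)
  have "wt P (log_deriv m n) * desc m n x = desc m n x * wt P (log_deriv m n)" for P
    using graded_commuteD[OF graded_commute_desc_log_deriv, of "\<lambda>k. x ^ k" m n P] wt_power_desc[of x m n 1]
    by simp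
  from ode_mult[OF deg_deriv_desc Cons.IH this] show ?case by (simp add: wt_add_left)
qed

text \<open>\<open>Var (k - 1)\<close> is p_k; the spurious value at k = 0 is harmless, since
  \<open>log_deriv\<close> has no constant term.\<close>

definition lam_log_deriv :: "int \<Rightarrow> int \<Rightarrow> Lam nilcox" where
  "lam_log_deriv m n = wt (\<lambda>k. Var (k - 1)) (log_deriv m n)"

text \<open>Picard iteration. Integration in the length grading is division by the length, the
  constant term 1 being supplied separately. Iterate k is correct up to length k.\<close>

primrec stanley_approx :: "int \<Rightarrow> int \<Rightarrow> nat \<Rightarrow> Lam nilcox" where
  "stanley_approx m n 0 = 1"
| "stanley_approx m n (Suc k) =
    1 + wt (\<lambda>l. if l = 0 then 0 else Poly_Mapping.single 0 (1 / of_nat l)) (lam_log_deriv m n * stanley_approx m n k)"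

text \<open>The exponential \<open>exp (\<Sum>k\<ge>1. p\<^sub>k c\<^sub>k)\<close>, where \<open>k c\<^sub>k\<close> is the degree \<open>k\<close> part of the logarithmic
  derivative; it is constructed as the solution of the differential equation \<open>F' = (\<Sum>k. p\<^sub>k k c\<^sub>k) F\<close>.\<close>

definition stanley_elt :: "int \<Rightarrow> int \<Rightarrow> Lam nilcox" where
  "stanley_elt m n = Nilcox (\<lambda>w. nc (stanley_approx m n (len w)) w)"

lemma nc_stanley_approx_1 [simp]: "nc (stanley_approx m n k) 1 = 1"
  by (cases k) (simp_all add: nc_mult_1)

lemma nc_lam_log_deriv_1 [simp]: "nc (lam_log_deriv m n) 1 = 0"
  by (simp add: lam_log_deriv_def)

lemma stanley_approx_stable:
  "len w \<le> k \<Longrightarrow> len w \<le> l \<Longrightarrow> nc (stanley_approx m n k) w = nc (stanley_approx m n l) w"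
proof (induction k arbitrary: w l)
  case (Suc k)
  show ?case
  proof (cases "w = 1")
    case False
    then have "0 < len w" by (simp add: neq0_conv[symmetric])
    then obtain l' where l: "l = Suc l'" using Suc.prems by (cases l) auto
    have "nc (lam_log_deriv m n * stanley_approx m n k) w = nc (lam_log_deriv m n * stanley_approx m n l') w"
      using Suc l by (intro nc_mult_cong) auto
    then show ?thesis by (simp add: l)
  qed simp
qed auto

lemma nc_stanley_elt: "len w \<le> k \<Longrightarrow> nc (stanley_elt m n) w = nc (stanley_approx m n k) w"
  using stanley_approx_stable[of w "len w" k m n] by (simp add: stanley_elt_def Nilcox_inverse)

lemma nc_stanley_elt_1 [simp]: "nc (stanley_elt m n) 1 = 1"
  by (simp add: nc_stanley_elt[of 1 0])

lemma deg_deriv_stanley_elt: "deg_deriv (stanley_elt m n) = lam_log_deriv m n * stanley_elt m n"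
proof (rule nilcox_eqI)
  fix w
  show "nc (deg_deriv (stanley_elt m n)) w = nc (lam_log_deriv m n * stanley_elt m n) w"
  proof (cases "w = 1")
    case False
    then obtain k where k: "len w = Suc k" by (cases "len w") auto
    have "nc (deg_deriv (stanley_elt m n)) w =
        (of_nat (len w) * Poly_Mapping.single 0 (1 / of_nat (len w))) * nc (lam_log_deriv m n * stanley_approx m n k) w"
      using False k by (simp add: nc_stanley_elt[of w "Suc k"] mult.assoc del: of_nat_Suc)
    also have "\<dots> = nc (lam_log_deriv m n * stanley_approx m n k) w"
      using k by (subst inverse_nat_mpoly) simp_all
    also have "\<dots> = nc (lam_log_deriv m n * stanley_elt m n) w"
      using k by (intro nc_mult_cong) (simp_all add: nc_stanley_elt[of _ k])
    finally show ?thesis .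
  qed (simp add: nc_mult_1)
qed

text \<open>Each iterate arises from \<open>log_deriv\<close> by sums, products and weights, and
  graded commutation survives all three; the coefficient at \<open>w\<close> only needs the iterate
  \<open>len w\<close>.\<close>

lemma graded_commute_stanley_elt: "graded_commute (log_deriv m n) (stanley_elt m n)"
  unfolding graded_commute_iff
proof (intro allI nilcox_eqI)
  fix k w
  have "graded_commute (log_deriv m n) (stanley_approx m n l)" for l
    by (induction l) (auto simp: lam_log_deriv_def
        intro!: graded_commute_1 graded_commute_add graded_commute_wt graded_commute_mult graded_commute_log_deriv)
  then have "hcomp k (log_deriv m n) * stanley_approx m n (len w) = stanley_approx m n (len w) * hcomp k (log_deriv m n)"
    by (simp add: graded_commute_iff)
  then have "nc (hcomp k (log_deriv m n) * stanley_approx m n (len w)) w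
      = nc (stanley_approx m n (len w) * hcomp k (log_deriv m n)) w" by simp
  moreover have "nc (hcomp k (log_deriv m n) * stanley_approx m n (len w)) w = nc (hcomp k (log_deriv m n) * stanley_elt m n) w"
    and "nc (stanley_approx m n (len w) * hcomp k (log_deriv m n)) w = nc (stanley_elt m n * hcomp k (log_deriv m n)) w"
    by (auto simp: nc_mult factorizations_iff nc_stanley_elt[of _ "len w"] simp del: nc_wt intro!: sum.cong)
  ultimately show "nc (hcomp k (log_deriv m n) * stanley_elt m n) w = nc (stanley_elt m n * hcomp k (log_deriv m n)) w"
    by simp
qed

lemma deg_deriv_nmap_stanley_elt:
  assumes "ring_hom \<phi>"
  shows "deg_deriv (nmap \<phi> (stanley_elt m n)) =
    wt (\<lambda>k. \<phi> (Var (k - 1))) (log_deriv m n) * nmap \<phi> (stanley_elt m n)"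
  using arg_cong[OF deg_deriv_stanley_elt, of "nmap \<phi>" m n]
  by (simp add: nmap_wt ring_hom_simps[OF ring_hom_nmap] assms ring_hom_simps[OF assms] lam_log_deriv_def nmap_log_deriv)

lemma wt_log_deriv_cong:
  assumes "\<And>k. 0 < k \<Longrightarrow> P k = Q k"
  shows "wt P (log_deriv m n) = wt Q (log_deriv m n)"
proof (rule nilcox_eqI)
  fix w
  show "nc (wt P (log_deriv m n)) w = nc (wt Q (log_deriv m n)) w"
    using assms[of "len w"] by (cases "w = 1") (auto simp: neq0_conv[symmetric] simp del: neq0_conv)
qed

text \<open>Both sides have constant term 1 and satisfy the same differential equation, by
  \<open>deg_deriv_prod_desc\<close>. This is the bridge from power sums to products of
  factors.\<close>

lemma nmap_stanley_elt_eq_prod_desc: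
  fixes \<phi> :: "Lam \<Rightarrow> 'r::comm_ring_1"
  assumes "torsion_free TYPE('r)" "ring_hom \<phi>" "\<And>k. \<phi> (Var k) = (\<Sum>x\<leftarrow>xs. x ^ Suc k)"
  shows "nmap \<phi> (stanley_elt m n) = prod_list (map (desc m n) xs)"
proof (rule ode_unique[OF assms(1) _ deg_deriv_nmap_stanley_elt[OF assms(2)]])
  have "wt (\<lambda>k. \<phi> (Var (k - 1))) (log_deriv m n) = wt (\<lambda>k. \<Sum>x\<leftarrow>xs. x ^ k) (log_deriv m n)"
    by (rule wt_log_deriv_cong) (simp add: assms(3))
  then show "deg_deriv (prod_list (map (desc m n) xs)) =
      wt (\<lambda>k. \<phi> (Var (k - 1))) (log_deriv m n) * prod_list (map (desc m n) xs)"
    using deg_deriv_prod_desc[of m n xs] by simp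
  have "nc (prod_list fs) 1 = prod_list (map (\<lambda>f. nc f 1) fs)" for fs :: "'r nilcox list"
    by (induction fs) (simp_all add: nc_mult_1)
  moreover have "nc (desc m n x) 1 = 1" for x :: 'r
  proof -
    have "desc m n (0 :: 'r) = 1" by (simp add: desc_def map_replicate_const)
    with arg_cong[OF wt_power_desc[of 0 m n x], of "\<lambda>f. nc f 1"] show ?thesis by simp
  qed
  ultimately show "nc (nmap \<phi> (stanley_elt m n)) 1 = nc (prod_list (map (desc m n) xs)) 1"
    by (simp add: ring_hom_simps[OF assms(2)] comp_def map_replicate_const)
qed simp

text \<open>The exponential law. The components of the logarithmic derivative commute with the first
  factor, so the product solves the equation whose weights are the sums. Its use is with the two
  summands of a primitive p_k.\<close>

lemma nmap_stanley_elt_add: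
  fixes \<phi> :: "Lam \<Rightarrow> 'r::comm_ring_1"
  assumes "torsion_free TYPE('r)" "ring_hom \<phi>" "ring_hom \<phi>1" "ring_hom \<phi>2"
    "\<And>k. \<phi> (Var k) = \<phi>1 (Var k) + \<phi>2 (Var k)"
  shows "nmap \<phi> (stanley_elt m n) = nmap \<phi>1 (stanley_elt m n) * nmap \<phi>2 (stanley_elt m n)"
proof (rule ode_unique[OF assms(1) _ deg_deriv_nmap_stanley_elt[OF assms(2)]])
  have "graded_commute (log_deriv m n) (nmap \<phi>1 (stanley_elt m n))"
    unfolding graded_commute_iff
  proof
    fix k
    have "nmap \<phi>1 (hcomp k (log_deriv m n) * stanley_elt m n) = nmap \<phi>1 (stanley_elt m n * hcomp k (log_deriv m n))"
      using graded_commute_stanley_elt by (simp add: graded_commute_iff)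
    moreover have "nmap \<phi>1 (hcomp k (log_deriv m n)) = hcomp k (log_deriv m n)"
      by (simp add: nmap_wt assms(3) nmap_log_deriv if_distrib ring_hom_simps[OF assms(3)] cong: if_cong)
    ultimately show "hcomp k (log_deriv m n) * nmap \<phi>1 (stanley_elt m n) = nmap \<phi>1 (stanley_elt m n) * hcomp k (log_deriv m n)"
      by (simp add: ring_hom_simps[OF ring_hom_nmap[OF assms(3)]])
  qed
  then have "wt P (log_deriv m n) * nmap \<phi>1 (stanley_elt m n) = nmap \<phi>1 (stanley_elt m n) * wt P (log_deriv m n)" for P
    using graded_commuteD[of _ _ P "\<lambda>n. 1"] by (metis wt_trivial)
  from ode_mult[OF deg_deriv_nmap_stanley_elt[OF assms(3)] deg_deriv_nmap_stanley_elt[OF assms(4)] this]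
  show "deg_deriv (nmap \<phi>1 (stanley_elt m n) * nmap \<phi>2 (stanley_elt m n)) =
      wt (\<lambda>k. \<phi> (Var (k - 1))) (log_deriv m n) * (nmap \<phi>1 (stanley_elt m n) * nmap \<phi>2 (stanley_elt m n))"
    by (simp add: assms(5) wt_add_left)
qed (simp_all add: nc_mult_1 assms ring_hom_simps)

section \<open>Expansion of products into compatible sequences\<close>

lemma reduced_words_Cons:
  "i # as \<in> reduced_words w \<longleftrightarrow> len (simple_refl i * w) < len w \<and> as \<in> reduced_words (simple_refl i * w)"
proof -
  have "word_prod (i # as) = w \<longleftrightarrow> word_prod as = simple_refl i * w"
    by (metis simple_refl_mult_cancel word_prod_Cons)
  moreover have "len (simple_refl i * w) < len w"
    if "word_prod as = simple_refl i * w" "Suc (length as) = len w"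
    using that len_word_prod_le[of as] by simp
  ultimately show ?thesis
    using len_simple_refl_mult_cases[of i w] by (auto simp: reduced_words_def)
qed

text \<open>Equal neighbours would cancel and leave a shorter word. Since neighbouring letters thus
  rise or fall strictly, the strictness condition of \<open>compatible\<close> can be read as
  \<open>factor_less\<close>.\<close>

lemma reduced_word_nth_neq:
  assumes "as \<in> reduced_words w" "Suc i < length as"
  shows "as ! i \<noteq> as ! Suc i"
proof
  assume eq: "as ! i = as ! Suc i"
  have "as = take i as @ [as ! i, as ! Suc i] @ drop (Suc (Suc i)) as"
    using assms(2) by (simp add: Cons_nth_drop_Suc)
  then have "word_prod as = word_prod (take i as @ drop (Suc (Suc i)) as)"
    by (metis append_Cons append_Nil eq simple_refl_mult_cancel word_prod_Cons word_prod_append)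
  moreover have "length (take i as @ drop (Suc (Suc i)) as) < length as" using assms(2) by simp
  ultimately show False
    using assms(1) len_word_prod_le[of "take i as @ drop (Suc (Suc i)) as"] by (simp add: reduced_words_def)
qed

text \<open>A factor \<open>1 + x\<^sub>b u\<^sub>i\<close> is indexed by \<open>(b, i)\<close>; this is the order of the factors.\<close>

definition factor_less :: "int \<times> int \<Rightarrow> int \<times> int \<Rightarrow> bool" where
  "factor_less p q \<longleftrightarrow> fst p < fst q \<or> fst p = fst q \<and> snd q < snd p"

lemma transp_factor_less: "transp factor_less"
  by (rule transpI) (auto simp: factor_less_def)

text \<open>A chain records from which factors of the ordered product the term with u_i is taken
  rather than 1, the letters taken forming a reduced word of \<open>w\<close>.\<close>

definition factor_chains :: "(int \<times> int) list \<Rightarrow> int perm \<Rightarrow> (int \<times> int) list set" where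
  "factor_chains L w = {zs. sorted_wrt factor_less zs \<and> set zs \<subseteq> set L \<and> map snd zs \<in> reduced_words w}"

lemma finite_factor_chains [simp]: "finite (factor_chains L w)"
proof (rule finite_subset)
  show "factor_chains L w \<subseteq> {zs. set zs \<subseteq> set L \<and> length zs = len w}"
    by (auto simp: factor_chains_def reduced_words_def)
  show "finite {zs. set zs \<subseteq> set L \<and> length zs = len w}" by (rule finite_lists_length_eq) simp
qed

text \<open>The head precedes all other factors, so a chain that uses it must begin with it.\<close>

lemma factor_chains_Cons:
  assumes "sorted_wrt factor_less ((b, i) # L)"
  shows "factor_chains ((b, i) # L) w = factor_chains L w \<union>
    (if len (simple_refl i * w) < len w then (#) (b, i) ` factor_chains L (simple_refl i * w) else {})"
proof (intro equalityI subsetI)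
  fix zs assume zs: "zs \<in> factor_chains ((b, i) # L) w"
  have min: "factor_less (b, i) q" if "q \<in> set L" for q using assms that by auto
  show "zs \<in> factor_chains L w \<union>
    (if len (simple_refl i * w) < len w then (#) (b, i) ` factor_chains L (simple_refl i * w) else {})"
  proof (cases "(b, i) \<in> set zs")
    case False
    then show ?thesis using zs by (auto simp: factor_chains_def)
  next
    case True
    then obtain z zs' where z: "zs = z # zs'" by (cases zs) auto
    have "z = (b, i)"
    proof (rule ccontr)
      assume "z \<noteq> (b, i)"
      then have "factor_less z (b, i)" "z \<in> set L" using True zs z by (auto simp: factor_chains_def)
      then show False using min[of z] by (auto simp: factor_less_def)
    qed
    moreover have "(b, i) \<notin> set zs'" using zs z \<open>z = (b, i)\<close> by (auto simp: factor_chains_def factor_less_def)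
    ultimately show ?thesis using zs z by (auto simp: factor_chains_def reduced_words_Cons)
  qed
next
  fix zs assume "zs \<in> factor_chains L w \<union>
    (if len (simple_refl i * w) < len w then (#) (b, i) ` factor_chains L (simple_refl i * w) else {})"
  then show "zs \<in> factor_chains ((b, i) # L) w"
    using assms by (auto simp: factor_chains_def reduced_words_Cons split: if_splits; blast)
qed

lemma monomial_of_Cons [simp]: "monomial_of (b # bs) = Poly_Mapping.single b 1 + monomial_of bs"
  by (simp add: monomial_of_def)

lemma monomial_of_Nil [simp]: "monomial_of [] = 0"
  by (simp add: monomial_of_def)

lemma keys_monomial_of: "Poly_Mapping.keys (monomial_of bs) = set bs"
proof -
  have "Poly_Mapping.lookup (monomial_of bs) b \<noteq> 0 \<longleftrightarrow> b \<in> set bs" for b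
    by (induction bs) (auto simp: lookup_add lookup_single when_def)
  then show ?thesis by (auto simp: in_keys_iff)
qed

lemma nc_prod_hfac:
  assumes "sorted_wrt factor_less L"
  shows "nc (prod_list (map (\<lambda>(b, i). hfac i (Var b)) L)) w =
    (\<Sum>zs\<in>factor_chains L w. Poly_Mapping.single (monomial_of (map fst zs)) 1)"
  using assms
proof (induction L arbitrary: w)
  case Nil
  have "factor_chains [] w = (if w = 1 then {[]} else {})"
    by (auto simp: factor_chains_def reduced_words_def)
  then show ?case by simp
next
  case (Cons p L)
  obtain b i where p: "p = (b, i)" by (cases p)
  have "(b, i) \<notin> set L" using Cons.prems by (auto simp: p factor_less_def)
  then have disj: "factor_chains L w \<inter> (#) (b, i) ` factor_chains L (simple_refl i * w) = {}"
    by (auto simp: factor_chains_def)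
  have "Var b * (\<Sum>zs\<in>factor_chains L (simple_refl i * w). Poly_Mapping.single (monomial_of (map fst zs)) 1)
    = (\<Sum>zs\<in>(#) (b, i) ` factor_chains L (simple_refl i * w). Poly_Mapping.single (monomial_of (map fst zs)) 1)"
    by (subst sum.reindex) (auto simp: inj_on_def sum_distrib_left Var_def mult_single)
  then show ?case
    using Cons disj
    by (simp add: p nc_hfac_mult factor_chains_Cons[OF Cons.prems[unfolded p]] sum.union_disjoint)
qed

text \<open>A pair (b, i) in a chain is the value b under the letter i. Neighbouring pairs may share
  b only when the letters fall, which is the strictness condition of \<open>compatible\<close>. The
  bound on the keys of \<open>m\<close> excludes values below -M, for which \<open>L\<close> has no
  factors.\<close>

lemma card_factor_chains:
  assumes set: "\<And>b i. (b, i) \<in> set L \<longleftrightarrow> - M \<le> b \<and> b \<le> i \<and> - N \<le> i \<and> i \<le> N"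
    and w: "w \<in> parabolic (- N) N" and m: "Poly_Mapping.keys m \<subseteq> {- M..}"
  shows "card {zs \<in> factor_chains L w. monomial_of (map fst zs) = m} =
    card {(as, bs). as \<in> reduced_words w \<and> compatible as bs \<and> monomial_of bs = m}"
proof (rule bij_betw_same_card[where f = "\<lambda>zs. (map snd zs, map fst zs)"],
    rule bij_betw_byWitness[where f' = "\<lambda>(as, bs). zip bs as"])
  let ?Z = "{zs \<in> factor_chains L w. monomial_of (map fst zs) = m}"
  let ?C = "{(as, bs). as \<in> reduced_words w \<and> compatible as bs \<and> monomial_of bs = m}"
  show "\<forall>zs\<in>?Z. (case (map snd zs, map fst zs) of (as, bs) \<Rightarrow> zip bs as) = zs"
    by (auto simp: zip_map_fst_snd)
  show "\<forall>p\<in>?C. (map snd (case p of (as, bs) \<Rightarrow> zip bs as), map fst (case p of (as, bs) \<Rightarrow> zip bs as)) = p"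
    by (auto simp: compatible_def)
  have key: "compatible as bs \<longleftrightarrow> sorted_wrt factor_less (zip bs as) \<and> (\<forall>i<length as. bs ! i \<le> as ! i)"
    if "length as = length bs" "as \<in> reduced_words w" for as bs
  proof -
    have "sorted bs \<longleftrightarrow> (\<forall>i. Suc i < length bs \<longrightarrow> bs ! i \<le> bs ! Suc i)"
      by (rule sorted_iff_nth_Suc)
    moreover have "sorted_wrt factor_less (zip bs as) \<longleftrightarrow>
        (\<forall>i. Suc i < length bs \<longrightarrow> factor_less (bs ! i, as ! i) (bs ! Suc i, as ! Suc i))"
      using that by (simp add: sorted_wrt_iff_nth_Suc_transp[OF transp_factor_less])
    ultimately show ?thesis
      using that(1) reduced_word_nth_neq[OF that(2)]
      unfolding compatible_def factor_less_def by (auto simp: not_less)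
  qed
  show "(\<lambda>zs. (map snd zs, map fst zs)) ` ?Z \<subseteq> ?C"
  proof clarify
    fix zs assume zs: "zs \<in> factor_chains L w"
    have "\<forall>i<length zs. fst (zs ! i) \<le> snd (zs ! i)"
      using zs set by (metis (no_types, lifting) factor_chains_def mem_Collect_eq nth_mem prod.collapse subsetD)
    then show "map snd zs \<in> reduced_words w \<and> compatible (map snd zs) (map fst zs)
        \<and> monomial_of (map fst zs) = monomial_of (map fst zs)"
      using zs key[of "map snd zs" "map fst zs"] by (auto simp: factor_chains_def zip_map_fst_snd)
  qed
  show "(\<lambda>(as, bs). zip bs as) ` ?C \<subseteq> ?Z"
  proof clarify
    fix as bs assume *: "as \<in> reduced_words w" "compatible as bs" "m = monomial_of bs"
    then have l: "length as = length bs" by (simp add: compatible_def)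
    have a: "set as \<subseteq> {- N..N}" by (rule reduced_word_parabolic[OF *(1) w])
    have b: "set bs \<subseteq> {- M..}" using m *(3) by (simp add: keys_monomial_of)
    have "set (zip bs as) \<subseteq> set L"
    proof
      fix p assume "p \<in> set (zip bs as)"
      then obtain i where i: "i < length bs" "p = (bs ! i, as ! i)" using l by (auto simp: set_zip)
      moreover have "bs ! i \<le> as ! i" using *(2) i l by (simp add: compatible_def)
      moreover have "as ! i \<in> {- N..N}" "bs ! i \<in> {- M..}" using a b i l nth_mem by (metis subsetD)+
      ultimately show "p \<in> set L" using set by auto
    qed
    then show "zip bs as \<in> factor_chains L w \<and> monomial_of (map fst (zip bs as)) = monomial_of bs"
      using * l key[OF l *(1)] by (simp add: factor_chains_def)
  qed
qed

definition factor_list :: "int \<Rightarrow> int \<Rightarrow> (int \<times> int) list" where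
  "factor_list M N = concat (map (\<lambda>b. map (Pair b) (rev [max b (- N)..N])) [- M..N])"

lemma set_factor_list: "(b, i) \<in> set (factor_list M N) \<longleftrightarrow> - M \<le> b \<and> b \<le> i \<and> - N \<le> i \<and> i \<le> N"
  by (force simp: factor_list_def)

lemma sorted_wrt_factor_concat:
  assumes "sorted_wrt (<) bs"
  shows "sorted_wrt factor_less (concat (map (\<lambda>b. map (Pair b) (rev [f b..g b])) bs))"
  using assms
proof (induction bs)
  case (Cons b bs)
  have "sorted_wrt (<) [f b..g b]" by simp
  then have "sorted_wrt (>) (rev [f b..g b])" by (simp add: sorted_wrt_rev)
  then have "sorted_wrt factor_less (map (Pair b) (rev [f b..g b]))"
    by (simp add: sorted_wrt_map factor_less_def)
  moreover have "\<forall>p\<in>set (map (Pair b) (rev [f b..g b])).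
      \<forall>q\<in>set (concat (map (\<lambda>b. map (Pair b) (rev [f b..g b])) bs)). factor_less p q"
    using Cons.prems by (auto simp: factor_less_def)
  ultimately show ?case using Cons by (simp add: sorted_wrt_append)
qed simp

lemma prod_list_map_concat: "prod_list (map f (concat xss)) = prod_list (map (\<lambda>xs. prod_list (map f xs)) xss)"
  for f :: "'a \<Rightarrow> 'b::monoid_mult"
  by (induction xss) simp_all

text \<open>Values b > N need no factor, since a value is at most its letter and letters are at most
  N. For b < -N the window, not b, bounds the letters from below, whence the maximum.\<close>

definition back_elt :: "int \<Rightarrow> int \<Rightarrow> int mpoly nilcox" where
  "back_elt M N = prod_list (map (\<lambda>b. desc (max b (- N)) N (Var b)) [- M..N])"

lemma lookup_back_elt:
  assumes "w \<in> parabolic (- N) N" "Poly_Mapping.keys m \<subseteq> {- M..}"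
  shows "Poly_Mapping.lookup (nc (back_elt M N) w) m = coeff (back_schubert_series w) m"
proof -
  let ?L = "factor_list M N"
  have sorted: "sorted_wrt factor_less ?L"
    unfolding factor_list_def by (rule sorted_wrt_factor_concat) simp
  have "back_elt M N = prod_list (map (\<lambda>(b, i). hfac i (Var b)) ?L)"
    by (simp add: factor_list_def prod_list_map_concat back_elt_def desc_def comp_def)
  then have "nc (back_elt M N) w = (\<Sum>zs\<in>factor_chains ?L w. Poly_Mapping.single (monomial_of (map fst zs)) 1)"
    by (simp add: nc_prod_hfac[OF sorted])
  then have "Poly_Mapping.lookup (nc (back_elt M N) w) m =
      of_nat (card {zs \<in> factor_chains ?L w. monomial_of (map fst zs) = m})"
    by (simp add: lookup_sum lookup_single when_def sum.If_cases Int_def conj_commute)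
  also have "\<dots> = coeff (back_schubert_series w) m"
    by (simp add: card_factor_chains[OF set_factor_list assms] back_schubert_series_def Series_inverse)
  finally show ?thesis .
qed

section \<open>The factorization of the back stable Schubert polynomials\<close>

definition schubert_pos_elt :: "int \<Rightarrow> int mpoly nilcox" where
  "schubert_pos_elt N = prod_list (map (\<lambda>b. desc b N (Var b)) [1..N])"

text \<open>The factors A(x_b)^(-1) A_b(x_b) for b \<le> 0, in reversed order; they are 1 for b
  \<le> -N, so only b \<ge> 1 - N occur. That they form the image of the positive half under
  \<omega> is \<open>omega_schubert_pos_elt\<close>.\<close>

definition schubert_neg_elt :: "int \<Rightarrow> int mpoly nilcox" where
  "schubert_neg_elt N = prod_list (map (\<lambda>b. asc (- N) (b - 1) (- Var b)) (rev [1 - N..0]))"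

lemma desc_asc_split:
  assumes "- N \<le> N + 1" "b \<le> N + 1"
  shows "desc (- N) N x * asc (- N) (b - 1) (- x) = desc (max b (- N)) N x"
proof (cases "b \<le> - N")
  case True
  then show ?thesis by (simp add: asc_empty max_absorb2)
next
  case False
  then have "desc (- N) N x = desc b N x * desc (- N) (b - 1) x"
    using assms by (intro desc_split) auto
  then show ?thesis using False by (simp add: mult.assoc max_absorb1)
qed

lemma desc_asc_commute:
  assumes "b < c"
  shows "desc c N y * asc M (b - 1) x = asc M (b - 1) x * desc c N y"
  unfolding asc_def
proof (rule prod_list_commute)
  fix f assume "f \<in> set (map (\<lambda>i. hfac i x) [M..b - 1])"
  then obtain i where i: "f = hfac i x" "i \<le> b - 1" by auto
  have "f * desc c N y = desc c N y * f"
    unfolding desc_def i(1) by (rule prod_list_commute) (use i(2) assms in \<open>auto intro!: hfac_commute\<close>)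
  then show "desc c N y * f = f * desc c N y" by simp
qed

text \<open>The factors cancel from the inside out: by the time \<open>A(x\<^sub>b)\<close> meets its inverse factor, what
  remains of \<open>A(x\<^sub>c)\<close> for \<open>b < c\<close> has letters \<open>\<ge> c\<close> and commutes with the letters \<open>< b\<close>.\<close>

lemma prod_desc_asc_telescope:
  assumes "c \<le> N + 1" "0 \<le> N"
  shows "prod_list (map (\<lambda>b. desc (- N) N (x b)) [a..c]) *
      prod_list (map (\<lambda>b. asc (- N) (b - 1) (- x b)) (rev [a..c])) =
    prod_list (map (\<lambda>b. desc (max b (- N)) N (x b)) [a..c])"
  using assms(1)
proof (induction "nat (c - a + 1)" arbitrary: c)
  case 0
  then show ?case by simp
next
  case (Suc k)
  then have ac: "a \<le> c" by simp
  let ?D = "\<lambda>b. desc (- N) N (x b)" and ?A = "\<lambda>b. asc (- N) (b - 1) (- x b)"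
  let ?T = "\<lambda>b. desc (max b (- N)) N (x b)"
  let ?P = "prod_list (map ?D [a..c - 1])" and ?Q = "prod_list (map ?A (rev [a..c - 1]))"
  have IH: "?P * ?Q = prod_list (map ?T [a..c - 1])" using Suc by (intro Suc(1)) auto
  have "?T c * ?Q = ?Q * ?T c"
    by (rule prod_list_commute) (auto intro!: desc_asc_commute)
  then have "?P * (?D c * ?A c) * ?Q = ?P * ?Q * ?T c"
    using Suc.prems assms(2) by (simp add: desc_asc_split mult.assoc)
  then show ?case by (simp add: upto_rec2[OF ac] IH mult.assoc)
qed

lemma schubert_neg_elt_eq:
  assumes "0 \<le> N" "N \<le> M"
  shows "prod_list (map (\<lambda>b. asc (- N) (b - 1) (- Var b)) (rev [- M..0])) = schubert_neg_elt N"
proof -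
  have "[- M..0] = [- M..- N] @ [1 - N..0]"
    using assms upto_split2[of "- M" "- N" 0] by simp
  moreover have "prod_list (map (\<lambda>b. asc (- N) (b - 1) (- Var b)) (rev [- M..- N])) = (1 :: int mpoly nilcox)"
  proof -
    have "map (\<lambda>b. asc (- N) (b - 1) (- Var b)) (rev [- M..- N]) = map (\<lambda>_. 1 :: int mpoly nilcox) (rev [- M..- N])"
      by (rule map_cong) (auto simp: asc_empty)
    then show ?thesis by (simp add: map_replicate_const)
  qed
  ultimately show ?thesis by (simp add: schubert_neg_elt_def)
qed

lemma back_elt_factorization:
  assumes "0 \<le> N" "N \<le> M"
  shows "prod_list (map (desc (- N) N) (map Var [- M..0])) * (schubert_neg_elt N * schubert_pos_elt N) = back_elt M N"
proof -
  have "[- M..N] = [- M..0] @ [1..N]" using assms upto_split2[of "- M" 0 N] by simp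
  moreover have "map (\<lambda>b. desc (max b (- N)) N (Var b)) [1..N] = map (\<lambda>b. desc b N (Var b) :: int mpoly nilcox) [1..N]"
    using assms(1) by (intro map_cong) (auto simp: max_def)
  ultimately have "back_elt M N = prod_list (map (\<lambda>b. desc (max b (- N)) N (Var b)) [- M..0]) * schubert_pos_elt N"
    unfolding back_elt_def schubert_pos_elt_def by (simp only: map_append prod_list.append)
  then show ?thesis
    using prod_desc_asc_telescope[of 0 N Var "- M"] assms
    by (simp add: schubert_neg_elt_eq comp_def flip: mult.assoc)
qed

section \<open>Injectivity of the series expansion\<close>

lemma sum_Pair_delta:
  assumes "finite A" "\<And>a b. (a, b) \<in> A \<Longrightarrow> (a, b) \<noteq> p \<Longrightarrow> f a b = 0"
  shows "(\<Sum>(a, b)\<in>A. f a b) = (if p \<in> A then f (fst p) (snd p) else (0 :: 'a::comm_monoid_add))"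
proof -
  have "(\<Sum>(a, b)\<in>A. f a b) = (\<Sum>q\<in>A. if q = p then f (fst p) (snd p) else 0)"
    by (rule sum.cong) (use assms(2) in auto)
  then show ?thesis using assms(1) by simp
qed

lemma ring_hom_series_const: "ring_hom series_const"
proof (rule ring_homI)
  show "series_const 1 = 1" by transfer auto
  fix x y
  show "series_const (x + y) = series_const x + series_const y" by transfer auto
  show "series_const (x * y) = series_const x * series_const y"
  proof (transfer, rule ext)
    fix x y :: rat and m :: "int \<Rightarrow>\<^sub>0 nat"
    have "(0, 0) \<in> splits m \<longleftrightarrow> m = 0" by (auto simp: splits_def)
    then show "(if m = 0 then x * y else 0) =
        (\<Sum>(a, b)\<in>splits m. (if a = 0 then x else 0) * (if b = 0 then y else 0))"
      by (subst sum_Pair_delta[where p = "(0, 0)"]) auto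
  qed
qed

lemma lookup_mult_splits:
  fixes p q :: "'v mpoly"
  shows "Poly_Mapping.lookup (p * q) m =
    (\<Sum>(a, b)\<in>splits m. Poly_Mapping.lookup p a * Poly_Mapping.lookup q b)"
proof -
  let ?P = "Poly_Mapping.keys p \<times> Poly_Mapping.keys q"
  let ?s = "\<lambda>r m. Poly_Mapping.single m (Poly_Mapping.lookup r m) :: 'v mpoly"
  have "p * q = (\<Sum>a\<in>Poly_Mapping.keys p. \<Sum>b\<in>Poly_Mapping.keys q. ?s p a * ?s q b)"
    by (subst mpoly_expand[of p], subst mpoly_expand[of q]) (simp add: sum_product)
  then have "Poly_Mapping.lookup (p * q) m = (\<Sum>(a, b)\<in>?P.
      if a + b = m then Poly_Mapping.lookup p a * Poly_Mapping.lookup q b else 0)"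
    by (simp add: lookup_sum mult_single lookup_single when_def sum.cartesian_product case_prod_beta)
  also have "\<dots> = (\<Sum>(a, b)\<in>{(a, b) \<in> ?P. a + b = m}. Poly_Mapping.lookup p a * Poly_Mapping.lookup q b)"
    by (rule sum.mono_neutral_cong_right) (auto split: if_splits)
  also have "\<dots> = (\<Sum>(a, b)\<in>splits m. Poly_Mapping.lookup p a * Poly_Mapping.lookup q b)"
    by (rule sum.mono_neutral_left[OF finite_splits]) (auto simp: splits_def in_keys_iff)
  finally show ?thesis .
qed

lemma ring_hom_to_series: "ring_hom to_series"
  unfolding to_series_def by (rule ring_hom_peval[OF ring_hom_series_const])

text \<open>Setting \<open>x\<^sub>b = 0\<close> for \<open>b < -M\<close> makes the power sums finite.\<close>

definition truncate :: "int \<Rightarrow> backR \<Rightarrow> int mpoly" where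
  "truncate M = psubst (\<lambda>v. case v of
     Psum k \<Rightarrow> \<Sum>b\<in>{- M..0}. Var b ^ Suc k | Xvar i \<Rightarrow> if - M \<le> i then Var i else 0)"

lemma ring_hom_truncate: "ring_hom (truncate M)"
  unfolding truncate_def by (rule ring_hom_psubst)

lemma truncate_const [simp]: "truncate M (Poly_Mapping.single 0 a) = Poly_Mapping.single 0 a"
  and truncate_Psum: "truncate M (Var (Psum k)) = (\<Sum>b\<in>{- M..0}. Var b ^ Suc k)"
  and truncate_Xvar: "truncate M (Var (Xvar i)) = (if - M \<le> i then Var i else 0)"
  by (simp_all add: truncate_def)

lemma Var_power: "Var v ^ n = Poly_Mapping.single (Poly_Mapping.single v n) 1"
proof (induction n)
  case (Suc n)
  then show ?case by (simp add: Var_def mult_single flip: single_add)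
qed simp

lemma single_eq_single_iff: "n \<noteq> 0 \<Longrightarrow> Poly_Mapping.single a n = Poly_Mapping.single b n \<longleftrightarrow> a = b"
  by (metis lookup_single_eq lookup_single_not_eq)

text \<open>A monomial in the x_b with b \<ge> -M receives nothing from terms containing another
  variable. Its divisors are of the same kind, which handles products.\<close>

lemma coeff_to_series:
  "Poly_Mapping.keys m \<subseteq> {- M..} \<Longrightarrow> coeff (to_series f) m = Poly_Mapping.lookup (truncate M f) m"
proof (induction f arbitrary: m rule: mpoly_induct)
  case (const a)
  show ?case
    by (cases "m = 0")
      (auto simp: to_series_def peval_const[OF ring_hom_series_const] series_const.rep_eq lookup_single when_def)
next
  case (Var v)
  show ?case
  proof (cases v)
    case (Xvar i)
    have "m \<noteq> Poly_Mapping.single i 1" if "i < - M" using that Var by auto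
    then have "Poly_Mapping.lookup (truncate M (Var (Xvar i))) m = (if m = Poly_Mapping.single i 1 then 1 else 0)"
      by (auto simp: truncate_Xvar Var_def[of i] lookup_single when_def)
    then show ?thesis
      by (simp add: Xvar to_series_def peval_Var[OF ring_hom_series_const] series_var.rep_eq)
  next
    case (Psum k)
    have "Poly_Mapping.lookup (truncate M (Var (Psum k))) m =
        (\<Sum>b\<in>{- M..0}. if m = Poly_Mapping.single b (Suc k) then 1 else 0)"
      by (auto simp: truncate_Psum Var_power lookup_sum lookup_single when_def simp del: power_Suc intro!: sum.cong)
    also have "\<dots> = (if \<exists>i\<le>0. m = Poly_Mapping.single i (Suc k) then 1 else 0)"
    proof (cases "\<exists>i\<le>0. m = Poly_Mapping.single i (Suc k)")
      case True
      then obtain i where i: "i \<le> 0" "m = Poly_Mapping.single i (Suc k)" by blast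
      then have "i \<in> {- M..0}" using Var by simp
      then show ?thesis using i by (auto simp: single_eq_single_iff)
    qed auto
    finally show ?thesis
      by (simp add: Psum to_series_def peval_Var[OF ring_hom_series_const] series_psum.rep_eq)
  qed
next
  case (add p q)
  then show ?case
    by (simp add: ring_hom_simps[OF ring_hom_to_series] ring_hom_simps[OF ring_hom_truncate]
        plus_series.rep_eq lookup_add)
next
  case (mult p q)
  have "Poly_Mapping.keys a \<subseteq> {- M..} \<and> Poly_Mapping.keys b \<subseteq> {- M..}" if "(a, b) \<in> splits m" for a b
  proof -
    have "Poly_Mapping.keys a \<subseteq> Poly_Mapping.keys m" "Poly_Mapping.keys b \<subseteq> Poly_Mapping.keys m"
      using that by (auto simp: splits_def in_keys_iff lookup_add)
    then show ?thesis using mult.prems by blast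
  qed
  then show ?case
    using mult.IH
    by (simp add: ring_hom_simps[OF ring_hom_to_series] ring_hom_simps[OF ring_hom_truncate]
        times_series.rep_eq lookup_mult_splits case_prod_beta cong: sum.cong)
      (auto intro!: sum.cong)
qed

section \<open>Variables occurring in a polynomial\<close>

definition vars :: "'v mpoly \<Rightarrow> 'v set" where
  "vars p = (\<Union>m\<in>Poly_Mapping.keys p. Poly_Mapping.keys m)"

lemma finite_vars [simp]: "finite (vars p)"
  by (simp add: vars_def)

lemma vars_add: "vars (p + q) \<subseteq> vars p \<union> vars q"
  using keys_add[of p q] by (auto simp: vars_def)

lemma vars_mult: "vars (p * q) \<subseteq> vars p \<union> vars q"
proof
  fix v assume "v \<in> vars (p * q)"
  then obtain m where m: "m \<in> Poly_Mapping.keys (p * q)" "v \<in> Poly_Mapping.keys m" by (auto simp: vars_def)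
  then obtain a b where "m = a + b" "a \<in> Poly_Mapping.keys p" "b \<in> Poly_Mapping.keys q"
    using keys_mult[of p q] by blast
  then show "v \<in> vars p \<union> vars q" using m keys_add[of a b] by (auto simp: vars_def)
qed

lemma vars_const [simp]: "vars (Poly_Mapping.single 0 a) = {}"
  and vars_0 [simp]: "vars 0 = {}"
  by (auto simp: vars_def split: if_splits)

lemma vars_Var_power: "vars (Var v ^ n) \<subseteq> {v}"
  by (auto simp: vars_def Var_power split: if_splits)

lemma vars_Var: "vars (Var v) = {v}"
  by (auto simp: vars_def Var_def)

lemma vars_sum: "(\<And>a. a \<in> A \<Longrightarrow> vars (f a) \<subseteq> S) \<Longrightarrow> vars (\<Sum>a\<in>A. f a) \<subseteq> S"
proof (induction A rule: infinite_finite_induct)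
  case (insert a A)
  then show ?case using vars_add[of "f a" "\<Sum>a\<in>A. f a"] by auto
qed auto

lemma vars_truncate: "vars (truncate M f) \<subseteq> {- M..}"
proof (induction f rule: mpoly_induct)
  case (Var v)
  show ?case
  proof (cases v)
    case (Psum k)
    then show ?thesis
      unfolding Psum truncate_Psum using vars_Var_power by (intro vars_sum) fastforce
  qed (simp add: truncate_Xvar vars_Var)
next
  case (add p q)
  then show ?case using vars_add[of "truncate M p" "truncate M q"]
    by (simp add: ring_hom_simps[OF ring_hom_truncate]) blast
next
  case (mult p q)
  then show ?case using vars_mult[of "truncate M p" "truncate M q"]
    by (simp add: ring_hom_simps[OF ring_hom_truncate]) blast
qed simp

lemma psubst_cong:
  assumes "\<And>v. v \<in> vars p \<Longrightarrow> f v = g v"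
  shows "psubst f p = psubst g p"
proof -
  have "f v = g v" if "m \<in> Poly_Mapping.keys p" "v \<in> Poly_Mapping.keys m" for m v
    using assms that by (auto simp: vars_def)
  then show ?thesis
    unfolding psubst_def peval_def by (intro sum.cong prod.cong refl arg_cong2[where f = "(*)"]) simp
qed

section \<open>Formal partial derivatives\<close>

lift_definition pdiff :: "'v \<Rightarrow> 'v mpoly \<Rightarrow> 'v mpoly" is
  "\<lambda>v f m. of_nat (Suc (Poly_Mapping.lookup m v)) * f (m + Poly_Mapping.single v 1)"
proof -
  fix v :: 'v and f :: "('v \<Rightarrow>\<^sub>0 nat) \<Rightarrow> rat"
  assume "finite {m. f m \<noteq> 0}"
  then have "finite ((\<lambda>m. m + Poly_Mapping.single v 1) -` {m. f m \<noteq> 0})"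
    by (rule finite_vimageI) (simp add: inj_on_def)
  then show "finite {m. of_nat (Suc (Poly_Mapping.lookup m v)) * f (m + Poly_Mapping.single v 1) \<noteq> 0}"
    by (rule finite_subset[rotated]) auto
qed

lemma lookup_pdiff: "Poly_Mapping.lookup (pdiff v f) m =
    of_nat (Suc (Poly_Mapping.lookup m v)) * Poly_Mapping.lookup f (m + Poly_Mapping.single v 1)"
  by (simp add: pdiff.rep_eq)

lemma pdiff_add: "pdiff v (p + q) = pdiff v p + pdiff v q"
  by (rule poly_mapping_eqI) (simp add: lookup_pdiff lookup_add distrib_left)

lemma pdiff_0 [simp]: "pdiff v 0 = 0"
  by (rule poly_mapping_eqI) (simp add: lookup_pdiff)

lemma pdiff_sum: "pdiff v (\<Sum>a\<in>A. f a) = (\<Sum>a\<in>A. pdiff v (f a))"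
  by (induction A rule: infinite_finite_induct) (simp_all add: pdiff_add)

lemma pdiff_single:
  "pdiff v (Poly_Mapping.single m a) =
    Poly_Mapping.single (m - Poly_Mapping.single v 1) (of_nat (Poly_Mapping.lookup m v) * a)"
proof (rule poly_mapping_eqI)
  fix n
  show "Poly_Mapping.lookup (pdiff v (Poly_Mapping.single m a)) n =
      Poly_Mapping.lookup (Poly_Mapping.single (m - Poly_Mapping.single v 1) (of_nat (Poly_Mapping.lookup m v) * a)) n"
  proof (cases "m = n + Poly_Mapping.single v 1")
    case True
    then show ?thesis by (simp add: lookup_pdiff lookup_add)
  next
    case False
    have "m = n + Poly_Mapping.single v 1" if "m - Poly_Mapping.single v 1 = n" "Poly_Mapping.lookup m v \<noteq> 0"
      by (rule poly_mapping_eqI) (use that in \<open>auto simp: lookup_add lookup_minus lookup_single when_def\<close>)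
    with False have "m - Poly_Mapping.single v 1 \<noteq> n \<or> Poly_Mapping.lookup m v = 0" by blast
    then show ?thesis using False by (auto simp: lookup_pdiff lookup_single when_def)
  qed
qed

lemma pdiff_mult: "pdiff v (p * q) = pdiff v p * q + p * pdiff v q"
proof -
  have s: "pdiff v (Poly_Mapping.single m a * Poly_Mapping.single n b) =
      pdiff v (Poly_Mapping.single m a) * Poly_Mapping.single n b +
      Poly_Mapping.single m a * pdiff v (Poly_Mapping.single n b)" for m n a b
  proof -
    have *: "k + l - Poly_Mapping.single v 1 = (k - Poly_Mapping.single v 1) + l"
      if "Poly_Mapping.lookup k v \<noteq> 0" for k l :: "'a \<Rightarrow>\<^sub>0 nat"
      by (rule poly_mapping_eqI) (use that in \<open>auto simp: lookup_add lookup_minus lookup_single when_def\<close>)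
    have "m + n - Poly_Mapping.single v 1 = (m - Poly_Mapping.single v 1) + n \<or> Poly_Mapping.lookup m v = 0"
      and "m + n - Poly_Mapping.single v 1 = m + (n - Poly_Mapping.single v 1) \<or> Poly_Mapping.lookup n v = 0"
      using *[of m n] *[of n m] by (auto simp: add.commute)
    then show ?thesis
      by (auto simp: mult_single pdiff_single lookup_add algebra_simps simp flip: single_add)
  qed
  have *: "pdiff v (p * Poly_Mapping.single n b) = pdiff v p * Poly_Mapping.single n b + p * pdiff v (Poly_Mapping.single n b)"
    for p n b
    by (subst (1 2 3) mpoly_expand[of p])
      (simp add: sum_distrib_right pdiff_sum s sum.distrib)
  show ?thesis
    by (subst (1 2 3) mpoly_expand[of q])
      (simp add: sum_distrib_left pdiff_sum * sum.distrib)
qed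

lemma pdiff_const [simp]: "pdiff v (Poly_Mapping.single 0 a) = 0"
  by (simp add: pdiff_single)

lemma pdiff_Var: "pdiff v (Var u) = (if u = v then 1 else 0)"
  by (auto simp: Var_def pdiff_single lookup_single when_def)

lemma pdiff_Var_power: "pdiff v (Var u ^ Suc n) = (if u = v then of_nat (Suc n) * Var u ^ n else 0)"
  by (induction n) (auto simp: pdiff_mult pdiff_Var algebra_simps)

text \<open>There are infinitely many generators, so the sum of the chain rule is restricted to a
  set V, to be chosen finite and large enough for \<open>f\<close>.\<close>

definition chain_rule :: "gen set \<Rightarrow> backR \<Rightarrow> bool" where
  "chain_rule V f \<longleftrightarrow> (\<forall>M b. pdiff b (truncate M f) =
    (\<Sum>v\<in>V. truncate M (pdiff v f) * pdiff b (truncate M (Var v))))"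

text \<open>Asking for every finite superset of \<open>V0\<close>, and not for a single set, lets
  the two operands of a sum or product share a common V.\<close>

lemma ex_chain_rule: "\<exists>V0. finite V0 \<and> (\<forall>V. finite V \<longrightarrow> V0 \<subseteq> V \<longrightarrow> chain_rule V f)"
proof (induction f rule: mpoly_induct)
  case (const a)
  show ?case by (rule exI[of _ "{}"]) (simp add: chain_rule_def ring_hom_simps[OF ring_hom_truncate])
next
  case (Var u)
  have "pdiff b (truncate M (Var u)) = (\<Sum>v\<in>V. truncate M (pdiff v (Var u)) * pdiff b (truncate M (Var v)))"
    if "finite V" "{u} \<subseteq> V" for V M b
  proof -
    have "(\<Sum>v\<in>V. truncate M (pdiff v (Var u)) * pdiff b (truncate M (Var v))) =
        (\<Sum>v\<in>V. if v = u then pdiff b (truncate M (Var u)) else 0)"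
      by (rule sum.cong) (auto simp: pdiff_Var ring_hom_simps[OF ring_hom_truncate])
    then show ?thesis using that by simp
  qed
  then show ?case by (intro exI[of _ "{u}"]) (auto simp: chain_rule_def)
next
  case (add p q)
  then obtain V1 V2 where V: "finite V1" "finite V2"
    "\<And>V. finite V \<Longrightarrow> V1 \<subseteq> V \<Longrightarrow> chain_rule V p" "\<And>V. finite V \<Longrightarrow> V2 \<subseteq> V \<Longrightarrow> chain_rule V q"
    by metis
  have "chain_rule V (p + q)" if "chain_rule V p" "chain_rule V q" for V
    using that by (simp add: chain_rule_def ring_hom_simps[OF ring_hom_truncate] pdiff_add distrib_right sum.distrib)
  then show ?case using V by (intro exI[of _ "V1 \<union> V2"]) auto
next
  case (mult p q)
  then obtain V1 V2 where V: "finite V1" "finite V2"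
    "\<And>V. finite V \<Longrightarrow> V1 \<subseteq> V \<Longrightarrow> chain_rule V p" "\<And>V. finite V \<Longrightarrow> V2 \<subseteq> V \<Longrightarrow> chain_rule V q"
    by metis
  have "chain_rule V (p * q)" if "chain_rule V p" "chain_rule V q" for V
    unfolding chain_rule_def
  proof (intro allI)
    fix M b
    have "pdiff b (truncate M (p * q)) = pdiff b (truncate M p) * truncate M q + truncate M p * pdiff b (truncate M q)"
      by (simp add: ring_hom_simps[OF ring_hom_truncate] pdiff_mult)
    also have "\<dots> = (\<Sum>v\<in>V. truncate M (pdiff v p) * pdiff b (truncate M (Var v))) * truncate M q +
        truncate M p * (\<Sum>v\<in>V. truncate M (pdiff v q) * pdiff b (truncate M (Var v)))"
      using that unfolding chain_rule_def by metis
    also have "\<dots> = (\<Sum>v\<in>V. truncate M (pdiff v (p * q)) * pdiff b (truncate M (Var v)))"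
      by (simp add: ring_hom_simps[OF ring_hom_truncate] pdiff_mult sum_distrib_left sum_distrib_right
          algebra_simps flip: sum.distrib)
    finally show "pdiff b (truncate M (p * q)) =
        (\<Sum>v\<in>V. truncate M (pdiff v (p * q)) * pdiff b (truncate M (Var v)))" .
  qed
  then show ?case using V by (intro exI[of _ "V1 \<union> V2"]) auto
qed

text \<open>If a polynomial in power sums vanishes, differentiate by \<open>x\<^sub>b\<close> for many fresh \<open>b\<close>: the partial
  derivatives are the coefficients of a polynomial with too many roots \<open>x\<^sub>b\<close>, hence vanish too.\<close>

lemma truncate_pdiff_Psum_eq_0:
  assumes "\<And>M. M \<ge> M0 \<Longrightarrow> truncate M f = 0"
  shows "\<exists>M1. \<forall>M\<ge>M1. truncate M (pdiff (Psum k) f) = 0"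
proof -
  obtain V0 where V0: "finite V0" "\<And>V. finite V \<Longrightarrow> V0 \<subseteq> V \<Longrightarrow> chain_rule V f"
    using ex_chain_rule[of f] by metis
  \<comment> \<open>\<open>Psum k\<close> is added so that the derivative in question is a
    coefficient of \<open>g\<close> below even if \<open>V0\<close> lacks it.\<close>
  define V where "V = insert (Psum k) V0"
  define J where "J = {j. Psum j \<in> V}"
  define X where "X = {i. Xvar i \<in> V}"
  have V: "finite V" using V0 by (simp add: V_def)
  have "chain_rule V f" using V0(2)[OF V] by (auto simp: V_def)
  have VJX: "V = Psum ` J \<union> Xvar ` X"
    unfolding J_def X_def by (auto simp: image_iff) (metis gen.exhaust)
  have "finite J" "finite X"
    using V finite_vimageI[of V Psum] finite_vimageI[of V Xvar] by (auto simp: J_def X_def vimage_def inj_on_def)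
  define K where "K = Max (insert 0 J)"
  define L where "L = Max (insert 0 (uminus ` X))"
  have K: "j \<le> K" if "j \<in> J" for j using that \<open>finite J\<close> by (auto simp: K_def)
  have L: "0 \<le> L" "\<And>i. i \<in> X \<Longrightarrow> - L \<le> i"
  proof -
    show "0 \<le> L" using \<open>finite X\<close> by (auto simp: L_def)
    fix i assume "i \<in> X"
    then have "- i \<le> L" using \<open>finite X\<close> by (auto simp: L_def)
    then show "- L \<le> i" by simp
  qed
  \<comment> \<open>For -M \<le> b < -L no \<open>Xvar\<close> in V becomes x_b, and b < 0 lies in
    the range of the power sums. There are M - L > K such b, more than the degree of a nonzero
    \<open>g\<close> allows as roots.\<close>
  have "truncate M (pdiff (Psum k) f) = 0" if M: "M \<ge> max M0 (L + int K + 1)" for M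
  proof -
    define c where "c j = truncate M (pdiff (Psum j) f) * of_nat (Suc j)" for j
    define g where "g = (\<Sum>j\<in>J. monom (c j) j)"
    have root: "poly g (Var b) = 0" if b: "b \<in> {- M..< - L}" for b
    proof -
      have ps: "pdiff b (truncate M (Var (Psum j))) = of_nat (Suc j) * Var b ^ j" for j
        using b L(1) by (simp add: truncate_Psum pdiff_sum pdiff_Var_power del: power_Suc of_nat_Suc)
      have xs: "pdiff b (truncate M (Var (Xvar i))) = 0" if "i \<in> X" for i
        using b L(2)[OF that] by (auto simp: truncate_Xvar pdiff_Var)
      have "0 = pdiff b (truncate M f)" using assms M by simp
      also have "\<dots> = (\<Sum>v\<in>V. truncate M (pdiff v f) * pdiff b (truncate M (Var v)))"
        using \<open>chain_rule V f\<close> unfolding chain_rule_def by blast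
      also have "\<dots> = (\<Sum>v\<in>Psum ` J. truncate M (pdiff v f) * pdiff b (truncate M (Var v)))"
        by (rule sum.mono_neutral_right[OF V]) (auto simp: VJX xs)
      also have "\<dots> = (\<Sum>j\<in>J. truncate M (pdiff (Psum j) f) * (of_nat (Suc j) * Var b ^ j))"
        by (subst sum.reindex) (auto simp: inj_on_def ps)
      also have "\<dots> = poly g (Var b)"
        by (simp add: g_def c_def poly_sum poly_monom mult.assoc)
      finally show ?thesis by simp
    qed
    have "g = 0"
    proof (rule ccontr)
      assume g: "g \<noteq> 0"
      have inj: "inj_on Var {- M..< - L}"
        by (rule inj_onI) (metis Var_def lookup_single_eq lookup_single_not_eq single_eq_single_iff zero_neq_one one_neq_zero)
      have "M - L \<le> int (card (Var ` {- M..< - L} :: int mpoly set))"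
        using M by (simp add: card_image[OF inj])
      also have "card (Var ` {- M..< - L} :: int mpoly set) \<le> card {x. poly g x = 0}"
        by (rule card_mono[OF poly_roots_finite[OF g]]) (auto simp: root)
      also have "\<dots> \<le> degree g" by (rule card_poly_roots_bound[OF g])
      also have "\<dots> \<le> K"
        unfolding g_def using K by (intro degree_sum_le[OF \<open>finite J\<close>]) (meson degree_monom_le order_trans)
      finally show False using M by simp
    qed
    then have "poly.coeff g k = 0" by simp
    moreover have "poly.coeff g k = c k"
      using \<open>finite J\<close> by (simp add: g_def coeff_sum J_def V_def)
    ultimately have "of_nat (Suc k) * truncate M (pdiff (Psum k) f) = of_nat (Suc k) * 0"
      by (simp add: c_def mult.commute)
    then show ?thesis by (rule torsion_freeD[OF torsion_free_mpoly]) simp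
  qed
  then show ?thesis by blast
qed

text \<open>The derivatives by the power sums also truncate to 0 for large M and have smaller
  degree, so they vanish by induction and \<open>f\<close> involves no power sum. A polynomial in
  the x_i alone is recovered from its truncation once M is large.\<close>

lemma truncate_eq_0_imp_eq_0:
  assumes "\<And>M. M \<ge> M0 \<Longrightarrow> truncate M f = 0"
  shows "f = 0"
proof -
  \<comment> \<open>Induction on a bound for the degree; \<open>mval (\<lambda>_. 2) m\<close> is \<open>2\<close> to the degree of \<open>m\<close>.\<close>
  have "f = 0" if "\<And>M. M \<ge> M0 \<Longrightarrow> truncate M f = 0"
    "\<And>m. m \<in> Poly_Mapping.keys f \<Longrightarrow> mval (\<lambda>_. 2 :: int) m < 2 ^ d" for M0 f d
    using that
  proof (induction d arbitrary: f M0)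
    case 0
    have "(1::int) \<le> mval (\<lambda>_. 2) m" for m :: "gen \<Rightarrow>\<^sub>0 nat"
      by (simp add: mval_def prod_ge_1)
    then have "m \<notin> Poly_Mapping.keys f" for m using 0(2)[of m] by (metis power_0 not_less)
    then have "Poly_Mapping.keys f = {}" by blast
    then show ?case by simp
  next
    case (Suc d)
    have pd: "pdiff (Psum k) f = 0" for k
    proof -
      obtain M1 where "\<And>M. M \<ge> M1 \<Longrightarrow> truncate M (pdiff (Psum k) f) = 0"
        using truncate_pdiff_Psum_eq_0[OF Suc.prems(1)] by blast
      moreover have "mval (\<lambda>_. 2 :: int) m < 2 ^ d" if "m \<in> Poly_Mapping.keys (pdiff (Psum k) f)" for m
      proof -
        have "m + Poly_Mapping.single (Psum k) 1 \<in> Poly_Mapping.keys f"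
          using that by (auto simp: in_keys_iff lookup_pdiff)
        from Suc.prems(2)[OF this] show ?thesis by (simp add: mval_add mval_single)
      qed
      ultimately show ?thesis by (rule Suc.IH)
    qed
    \<comment> \<open>A monomial containing \<open>Psum k\<close> would leave a nonzero coefficient
      in the derivative, as its exponent is nonzero in characteristic 0.\<close>
    have Xonly: "\<exists>i. v = Xvar i" if v: "v \<in> vars f" for v
    proof (cases v)
      case (Psum k)
      then obtain m where m: "m \<in> Poly_Mapping.keys f" "Poly_Mapping.lookup m (Psum k) \<noteq> 0"
        using v by (auto simp: vars_def in_keys_iff)
      have "m - Poly_Mapping.single (Psum k) 1 + Poly_Mapping.single (Psum k) 1 = m"
        by (rule poly_mapping_eqI) (use m(2) in \<open>auto simp: lookup_add lookup_minus lookup_single when_def\<close>)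
      then have "Poly_Mapping.lookup (pdiff (Psum k) f) (m - Poly_Mapping.single (Psum k) 1) \<noteq> 0"
        using m(1) by (simp add: lookup_pdiff in_keys_iff del: of_nat_Suc)
      then show ?thesis by (simp add: pd)
    qed simp
    define L where "L = Max (insert M0 (uminus ` {i. Xvar i \<in> vars f}))"
    have fin: "finite {i. Xvar i \<in> vars f}"
      using finite_vimageI[of "vars f" Xvar] by (auto simp: vimage_def inj_on_def)
    have L: "- L \<le> i" if "Xvar i \<in> vars f" for i
    proof -
      have "- i \<le> L" unfolding L_def using fin that by (intro Max_ge) auto
      then show ?thesis by simp
    qed
    have "M0 \<le> L" unfolding L_def using fin by (intro Max_ge) auto
    then have "0 = of_poly (truncate L f)"
      using Suc.prems(1) by (simp add: of_poly_def ring_hom_simps[OF ring_hom_psubst])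
    also have "\<dots> = psubst Var f"
      unfolding of_poly_def truncate_def psubst_psubst
      by (rule psubst_cong) (use Xonly L in fastforce)
    finally show ?case by (simp add: psubst_Var_id)
  qed
  moreover have "\<exists>d. \<forall>m\<in>Poly_Mapping.keys f. mval (\<lambda>_. 2 :: int) m < 2 ^ d"
  proof -
    define B where "B = Max (insert 0 (mval (\<lambda>_. 2 :: int) ` Poly_Mapping.keys f))"
    have "mval (\<lambda>_. 2 :: int) m < 2 ^ nat B" if "m \<in> Poly_Mapping.keys f" for m
    proof -
      have "mval (\<lambda>_. 2 :: int) m \<le> B" "0 \<le> B" unfolding B_def using that by (auto intro: Max_ge)
      moreover have "int (nat B) < int (2 ^ nat B)" by (subst of_nat_less_iff) (rule less_exp)
      ultimately show ?thesis by simp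
    qed
    then show ?thesis by blast
  qed
  ultimately show ?thesis using assms by blast
qed

lemma to_series_inject: "to_series f = to_series g \<longleftrightarrow> f = g"
proof
  assume eq: "to_series f = to_series g"
  have "truncate M (f - g) = 0" for M
  proof (rule poly_mapping_eqI)
    fix m
    show "Poly_Mapping.lookup (truncate M (f - g)) m = Poly_Mapping.lookup 0 m"
    proof (cases "Poly_Mapping.keys m \<subseteq> {- M..}")
      case True
      then show ?thesis
        using eq by (simp add: coeff_to_series[symmetric] ring_hom_simps[OF ring_hom_to_series] zero_series.rep_eq)
    next
      case False
      then have "m \<notin> Poly_Mapping.keys (truncate M (f - g))"
        using vars_truncate[of M "f - g"] unfolding vars_def by blast
      then show ?thesis by (simp add: in_keys_iff)
    qed
  qed
  then have "f - g = 0" by (rule truncate_eq_0_imp_eq_0)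
  then show "f = g" by simp
qed simp

section \<open>The back stable Schubert polynomials as coefficients\<close>

lemma nmap_nmap: "nmap \<phi> (nmap \<psi> f) = nmap (\<lambda>x. \<phi> (\<psi> x)) f"
  by (rule nilcox_eqI) simp

lemma nmap_cong: "(\<And>x. \<phi> x = \<psi> x) \<Longrightarrow> nmap \<phi> f = nmap \<psi> f"
  by (rule nilcox_eqI) simp

lemma nmap_schubert_pos_elt:
  assumes "ring_hom \<phi>"
  shows "nmap \<phi> (schubert_pos_elt N) = prod_list (map (\<lambda>b. desc b N (\<phi> (Var b))) [1..N])"
  by (simp add: schubert_pos_elt_def nmap_prod_list[OF assms] nmap_desc[OF assms] comp_def)

lemma nmap_schubert_neg_elt:
  assumes "ring_hom \<phi>"
  shows "nmap \<phi> (schubert_neg_elt N) = prod_list (map (\<lambda>b. asc (- N) (b - 1) (- \<phi> (Var b))) (rev [1 - N..0]))"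
  by (simp add: schubert_neg_elt_def nmap_prod_list[OF assms] nmap_asc[OF assms] comp_def ring_hom_simps[OF assms])

text \<open>This is G_- G_+. It involves only the x_b with 1 - N \<le> b \<le> N, so truncation at M
  \<ge> N does not affect it.\<close>

definition poly_elt :: "int \<Rightarrow> int mpoly nilcox" where
  "poly_elt N = schubert_neg_elt N * schubert_pos_elt N"

lemma nmap_poly_elt_id:
  assumes "ring_hom \<phi>" "\<And>b. 1 - N \<le> b \<Longrightarrow> b \<le> N \<Longrightarrow> \<phi> (Var b) = Var b"
  shows "nmap \<phi> (poly_elt N) = poly_elt N"
proof -
  have "nmap \<phi> (schubert_pos_elt N) = schubert_pos_elt N"
    unfolding nmap_schubert_pos_elt[OF assms(1)] unfolding schubert_pos_elt_def
    by (intro arg_cong[of _ _ prod_list] map_cong refl) (simp add: assms(2))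
  moreover have "nmap \<phi> (schubert_neg_elt N) = schubert_neg_elt N"
  proof (cases "0 \<le> N")
    case True
    then show ?thesis
      unfolding nmap_schubert_neg_elt[OF assms(1)] unfolding schubert_neg_elt_def
      by (intro arg_cong[of _ _ prod_list] map_cong refl) (simp add: assms(2))
  qed (simp add: schubert_neg_elt_def ring_hom_simps[OF ring_hom_nmap[OF assms(1)]])
  ultimately show ?thesis by (simp add: poly_elt_def ring_hom_simps[OF ring_hom_nmap[OF assms(1)]])
qed

lemma ring_hom_of_Lam: "ring_hom of_Lam" and ring_hom_of_poly: "ring_hom of_poly"
  and ring_hom_coaction: "ring_hom coaction" and ring_hom_eta0: "ring_hom eta0"
  by (simp_all add: of_Lam_def of_poly_def coaction_def eta0_def ring_hom_psubst)

definition back_schubert_elt :: "int \<Rightarrow> backR nilcox" where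
  "back_schubert_elt N = nmap of_Lam (stanley_elt (- N) N) * nmap of_poly (poly_elt N)"

text \<open>Truncation turns p_k into a finite power sum, so F becomes the product of the A(x_b)
  with -M \<le> b \<le> 0, and the telescoping applies.\<close>

lemma nmap_truncate_back_schubert_elt:
  assumes "0 \<le> N" "N \<le> M"
  shows "nmap (truncate M) (back_schubert_elt N) = back_elt M N"
proof -
  have "nmap (\<lambda>x. truncate M (of_Lam x)) (stanley_elt (- N) N) =
      prod_list (map (desc (- N) N) (map Var [- M..0]))"
  proof (rule nmap_stanley_elt_eq_prod_desc[OF torsion_free_mpoly])
    show "ring_hom (\<lambda>x. truncate M (of_Lam x))"
      by (rule ring_hom_comp[OF ring_hom_truncate ring_hom_of_Lam])
    show "truncate M (of_Lam (Var k)) = (\<Sum>x\<leftarrow>map Var [- M..0]. x ^ Suc k)" for k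
      by (simp add: of_Lam_def truncate_Psum comp_def sum_list_distinct_conv_sum_set del: power_Suc)
  qed
  moreover have "nmap (\<lambda>x. truncate M (of_poly x)) (poly_elt N) = poly_elt N"
    by (rule nmap_poly_elt_id[OF ring_hom_comp[OF ring_hom_truncate ring_hom_of_poly]])
      (use assms in \<open>simp add: of_poly_def truncate_Xvar\<close>)
  ultimately show ?thesis
    using back_elt_factorization[OF assms]
    by (simp add: back_schubert_elt_def ring_hom_simps[OF ring_hom_nmap[OF ring_hom_truncate]] nmap_nmap poly_elt_def)
qed

lemma back_schubert_eq:
  assumes "w \<in> parabolic (- N) N" "0 \<le> N"
  shows "back_schubert w = nc (back_schubert_elt N) w"
  unfolding back_schubert_def
proof (rule the_equality)
  show "to_series (nc (back_schubert_elt N) w) = back_schubert_series w"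
  proof (rule series_eqI)
    fix m :: "int \<Rightarrow>\<^sub>0 nat"
    \<comment> \<open>Coefficients are compared one at a time; M depends on the monomial, so that
      truncation does not affect it.\<close>
    define M where "M = Max (insert N (uminus ` Poly_Mapping.keys m))"
    have M: "N \<le> M" unfolding M_def by (intro Max_ge) auto
    have m: "Poly_Mapping.keys m \<subseteq> {- M..}"
    proof
      fix b assume "b \<in> Poly_Mapping.keys m"
      then have "- b \<le> M" unfolding M_def by (intro Max_ge) auto
      then show "b \<in> {- M..}" by simp
    qed
    show "coeff (to_series (nc (back_schubert_elt N) w)) m = coeff (back_schubert_series w) m"
      unfolding coeff_to_series[OF m] lookup_back_elt[OF assms(1) m, symmetric]
        nmap_truncate_back_schubert_elt[OF assms(2) M, symmetric] by simp
  qed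
  then show "f = nc (back_schubert_elt N) w" if "to_series f = back_schubert_series w" for f
    using that by (simp flip: to_series_inject)
qed

text \<open>Setting all x_i to 0 turns every factor of \<open>poly_elt\<close> into 1 and leaves F
  alone.\<close>

lemma stanley_eq:
  assumes "w \<in> parabolic (- N) N" "0 \<le> N"
  shows "stanley w = nc (stanley_elt (- N) N) w"
proof -
  have 1: "nmap (\<lambda>x. eta0 (of_Lam x)) (stanley_elt (- N) N) = stanley_elt (- N) N"
  proof -
    have "eta0 (of_Lam p) = p" for p
      by (simp add: eta0_def of_Lam_def psubst_psubst psubst_Var_id)
    then show ?thesis by (simp add: nilcox_eqI)
  qed
  have hom: "ring_hom (\<lambda>x. eta0 (of_poly x))"
    by (rule ring_hom_comp[OF ring_hom_eta0 ring_hom_of_poly])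
  have "eta0 (of_poly (Var b)) = 0" for b by (simp add: eta0_def of_poly_def)
  then have 2: "nmap (\<lambda>x. eta0 (of_poly x)) (poly_elt N) = 1"
    by (simp add: poly_elt_def ring_hom_simps[OF ring_hom_nmap[OF hom]] nmap_schubert_pos_elt[OF hom]
        nmap_schubert_neg_elt[OF hom] desc_def asc_def map_replicate_const)
  have "nmap eta0 (back_schubert_elt N) = stanley_elt (- N) N"
    by (simp add: back_schubert_elt_def ring_hom_simps[OF ring_hom_nmap[OF ring_hom_eta0]] nmap_nmap 1 2)
  then show ?thesis
    unfolding stanley_def back_schubert_eq[OF assms] by (metis nc_nmap)
qed

text \<open>The coaction obeys the exponential law on F and embeds polynomials into the right tensor
  factor, so it maps F G to (F \<otimes> 1) (1 \<otimes> F G), where G is G_- G_+. The claim is the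
  coefficient of this product at \<open>w\<close>.\<close>

lemma coaction_back_schubert:
  "coaction (back_schubert w) = (\<Sum>(x, y)\<in>factorizations w. stanley x \<otimes>\<^sub>\<rat> back_schubert y)"
proof -
  obtain n where w: "w \<in> parabolic (- int n) (int n)" using ex_parabolic by blast
  define N where "N = int n"
  note w = w[folded N_def]
  have N: "0 \<le> N" by (simp add: N_def)
  define inl :: "Lam \<Rightarrow> Lam_backR" where "inl = psubst (\<lambda>k. Var (Inl k))"
  define inr :: "backR \<Rightarrow> Lam_backR" where "inr = psubst (\<lambda>v. Var (Inr v))"
  have tensor: "f \<otimes>\<^sub>\<rat> g = inl f * inr g" for f g by (simp add: tensor_def inl_def inr_def)
  have hom: "ring_hom inl" "ring_hom inr" by (simp_all add: inl_def inr_def ring_hom_psubst)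
  have 1: "nmap (\<lambda>x. coaction (of_Lam x)) (stanley_elt (- N) N) =
      nmap inl (stanley_elt (- N) N) * nmap (\<lambda>x. inr (of_Lam x)) (stanley_elt (- N) N)"
  proof (rule nmap_stanley_elt_add[OF torsion_free_mpoly])
    show "coaction (of_Lam (Var k)) = inl (Var k) + inr (of_Lam (Var k))" for k
      by (simp add: coaction_def of_Lam_def tensor ring_hom_simps[OF hom(1)] ring_hom_simps[OF hom(2)])
  qed (intro ring_hom_comp[OF ring_hom_coaction] ring_hom_comp[OF hom(2)] hom ring_hom_of_Lam)+
  have 2: "nmap (\<lambda>x. coaction (of_poly x)) (poly_elt N) = nmap (\<lambda>x. inr (of_poly x)) (poly_elt N)"
  proof (rule nmap_cong)
    show "coaction (of_poly p) = inr (of_poly p)" for p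
      by (rule mpoly_hom_eqI[OF ring_hom_comp[OF ring_hom_coaction ring_hom_of_poly] ring_hom_comp[OF hom(2) ring_hom_of_poly]])
        (simp_all add: coaction_def of_poly_def tensor ring_hom_simps[OF hom(1)] inr_def)
  qed
  have "nmap coaction (back_schubert_elt N) = nmap inl (stanley_elt (- N) N) * nmap inr (back_schubert_elt N)"
    by (simp add: back_schubert_elt_def ring_hom_simps[OF ring_hom_nmap[OF ring_hom_coaction]]
        ring_hom_simps[OF ring_hom_nmap[OF hom(2)]] nmap_nmap 1 2 mult.assoc)
  from arg_cong[OF this, of "\<lambda>f. nc f w"]
  have "coaction (back_schubert w) =
      (\<Sum>(x, y)\<in>factorizations w. inl (nc (stanley_elt (- N) N) x) * inr (nc (back_schubert_elt N) y))"
    by (simp add: back_schubert_eq[OF w N] nc_mult)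
  also have "\<dots> = (\<Sum>(x, y)\<in>factorizations w. stanley x \<otimes>\<^sub>\<rat> back_schubert y)"
  proof (rule sum.cong[OF refl], clarify)
    fix x y assume "(x, y) \<in> factorizations w"
    then have "x \<in> parabolic (- N) N" "y \<in> parabolic (- N) N"
      using reduced_product_parabolic[OF _ w] by (auto simp: factorizations_def)
    then show "inl (nc (stanley_elt (- N) N) x) * inr (nc (back_schubert_elt N) y) = stanley x \<otimes>\<^sub>\<rat> back_schubert y"
      by (simp add: tensor stanley_eq[OF _ N] back_schubert_eq[OF _ N])
  qed
  finally show ?thesis .
qed

section \<open>Schubert polynomials as coefficients\<close>

text \<open>The index set of the factors of \<open>schubert_pos_elt\<close>. For N = n - 1 its
  letters form a reduced word of \<open>longest n\<close>, and its first components give the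
  staircase monomial.\<close>

definition triangle_list :: "int \<Rightarrow> (int \<times> int) list" where
  "triangle_list N = concat (map (\<lambda>b. map (Pair b) (rev [b..N])) [1..N])"

lemma set_triangle_list: "(b, i) \<in> set (triangle_list N) \<longleftrightarrow> 1 \<le> b \<and> b \<le> i \<and> i \<le> N"
  by (force simp: triangle_list_def)

lemma sorted_triangle_list: "sorted_wrt factor_less (triangle_list N)"
  unfolding triangle_list_def by (rule sorted_wrt_factor_concat) simp

lemma nc_schubert_pos_elt: "nc (schubert_pos_elt N) v =
    (\<Sum>zs\<in>factor_chains (triangle_list N) v. Poly_Mapping.single (monomial_of (map fst zs)) 1)"
proof -
  have "schubert_pos_elt N = prod_list (map (\<lambda>(b, i). hfac i (Var b)) (triangle_list N))"
    by (simp add: triangle_list_def prod_list_map_concat schubert_pos_elt_def desc_def comp_def)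
  then show ?thesis by (simp add: nc_prod_hfac[OF sorted_triangle_list])
qed

text \<open>Letters above N occur in no reduced word of \<open>v\<close>, so the additional factors
  are never chosen.\<close>

lemma nc_schubert_pos_elt_stable:
  assumes "v \<in> parabolic 1 N" "N \<le> N'"
  shows "nc (schubert_pos_elt N') v = nc (schubert_pos_elt N) v"
proof -
  have "set zs \<subseteq> set (triangle_list N') \<longleftrightarrow> set zs \<subseteq> set (triangle_list N)" if "map snd zs \<in> reduced_words v" for zs
  proof -
    have "i \<le> N" if "(b, i) \<in> set zs" for b i
      using reduced_word_parabolic[OF \<open>map snd zs \<in> _\<close> assms(1)] that by force
    then show ?thesis using assms(2) by (fastforce simp: subset_iff set_triangle_list)
  qed
  then have "factor_chains (triangle_list N') v = factor_chains (triangle_list N) v"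
    unfolding factor_chains_def by blast
  then show ?thesis by (simp add: nc_schubert_pos_elt)
qed

section \<open>Divided differences of the generating function\<close>

lemma ring_hom_swap_vars: "ring_hom (swap_vars i)"
  by (simp add: swap_vars_def ring_hom_psubst)

lemma swap_vars_Var: "swap_vars i (Var j) = Var (if j = i then i + 1 else if j = i + 1 then i else j)"
  by (simp add: swap_vars_def simple_refl_apply)

text \<open>The divided difference formula multiplied by x_i - x_{i+1}, which avoids division.
  Exchanging the two variables affects only the factors b = i and b = i + 1.\<close>

lemma schubert_pos_elt_mult_word_elt:
  assumes "1 \<le> i" "i < N"
  shows "schubert_pos_elt N * word_elt [i] (Var i - Var (i + 1)) =
    schubert_pos_elt N - nmap (swap_vars i) (schubert_pos_elt N)"
proof -
  let ?x = "Var i :: int mpoly" and ?y = "Var (i + 1) :: int mpoly"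
  define B :: "int mpoly nilcox" where "B = prod_list (map (\<lambda>b. desc b N (Var b)) [1..i - 1])"
  define C :: "int mpoly nilcox" where "C = prod_list (map (\<lambda>b. desc b N (Var b)) [i + 2..N])"
  have "i + 1 + 1 = i + 2" by simp
  then have split: "[1..N] = [1..i - 1] @ i # (i + 1) # [i + 2..N]"
    using assms upto_split3[of 1 i N] upto_rec1[of "i + 1" N] by (metis less_imp_le zless_imp_add1_zle)
  have pos: "schubert_pos_elt N = B * (desc i N ?x * desc (i + 1) N ?y) * C"
    by (simp add: schubert_pos_elt_def split B_def C_def mult.assoc)
  have 1: "map (\<lambda>b. desc b N (swap_vars i (Var b))) [1..i - 1] = map (\<lambda>b. desc b N (Var b)) [1..i - 1]"
    by (rule map_cong) (auto simp: swap_vars_Var)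
  have 2: "map (\<lambda>b. desc b N (swap_vars i (Var b))) [i + 2..N] = map (\<lambda>b. desc b N (Var b)) [i + 2..N]"
    by (rule map_cong) (auto simp: swap_vars_Var)
  have swap: "nmap (swap_vars i) (schubert_pos_elt N) = B * (desc i N ?y * desc (i + 1) N ?x) * C"
    unfolding nmap_schubert_pos_elt[OF ring_hom_swap_vars] split
    by (simp only: map_append list.map prod_list.append prod_list.Cons 1 2 B_def C_def mult.assoc) (simp add: swap_vars_Var)
  define T where "T = desc i N ?x * desc i N ?y"
  have d: "desc (i + 1) N z = desc i N z * hfac i (- z)" for z :: "int mpoly"
    using assms desc_bottom[of i N z] by (simp add: mult.assoc)
  have T1: "desc i N ?x * desc (i + 1) N ?y = T * hfac i (- ?y)"
    by (simp add: d T_def mult.assoc)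
  have T2: "desc i N ?y * desc (i + 1) N ?x = T * hfac i (- ?x)"
    by (simp add: d T_def desc_commute[of i N ?x ?y] mult.assoc)
  \<comment> \<open>u_i can be moved past C, whose letters are all at least i + 2.\<close>
  have "word_elt [i] z * hfac j z' = hfac j z' * word_elt [i] z" if "i + 2 \<le> j" for j and z z' :: "int mpoly"
    using hfac_commute[of i j z z'] that unfolding hfac_def[of i z] by (simp add: distrib_left distrib_right)
  then have "word_elt [i] z * desc b N z' = desc b N z' * word_elt [i] z" if "i + 2 \<le> b" for b and z z' :: "int mpoly"
    unfolding desc_def using that by (intro prod_list_commute) auto
  then have C: "word_elt [i] z * C = C * word_elt [i] z" for z :: "int mpoly"
    unfolding C_def by (intro prod_list_commute) auto
  have h: "hfac i (- ?y) - hfac i (- ?x) = word_elt [i] (?x - ?y)"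
    by (simp add: hfac_def flip: word_elt_add) (rule nilcox_eqI, simp add: nc_word_elt)
  have h': "hfac i (- ?y) * word_elt [i] (?x - ?y) = word_elt [i] (?x - ?y)"
    by (simp add: hfac_def distrib_right word_elt_mult word_elt_square)
  have "schubert_pos_elt N * word_elt [i] (?x - ?y) = B * (T * (hfac i (- ?y) * word_elt [i] (?x - ?y))) * C"
    unfolding pos T1 by (simp add: mult.assoc C)
  also have "\<dots> = B * (T * (hfac i (- ?y) - hfac i (- ?x))) * C" by (simp only: h h')
  also have "\<dots> = schubert_pos_elt N - nmap (swap_vars i) (schubert_pos_elt N)"
    unfolding swap unfolding pos T1 T2 by (simp add: left_diff_distrib right_diff_distrib)
  finally show ?thesis .
qed

lemma Var_inject [simp]: "Var a = Var b \<longleftrightarrow> a = b"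
proof
  assume "Var a = Var b"
  then have "vars (Var a) = vars (Var b)" by simp
  then show "a = b" by (simp add: vars_Var)
qed simp

text \<open>The polynomial ring has no zero divisors, so the quotient described by
  \<open>ddiff\<close> is unique.\<close>

lemma ddiff_schubert_pos_elt:
  assumes "1 \<le> i" "i < N" "len (w * simple_refl i) < len w"
  shows "ddiff i (nc (schubert_pos_elt N) w) = nc (schubert_pos_elt N) (w * simple_refl i)"
  unfolding ddiff_def
proof (rule the_equality)
  show *: "(Var i - Var (i + 1)) * nc (schubert_pos_elt N) (w * simple_refl i) =
      nc (schubert_pos_elt N) w - swap_vars i (nc (schubert_pos_elt N) w)"
    using arg_cong[OF schubert_pos_elt_mult_word_elt[OF assms(1,2)], of "\<lambda>f. nc f w"] assms(3)
    by (simp add: nc_mult_word_elt)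
  fix g assume "(Var i - Var (i + 1)) * g = nc (schubert_pos_elt N) w - swap_vars i (nc (schubert_pos_elt N) w)"
  with * have "(Var i - Var (i + 1)) * g = (Var i - Var (i + 1)) * nc (schubert_pos_elt N) (w * simple_refl i)"
    by simp
  then show "g = nc (schubert_pos_elt N) (w * simple_refl i)" by simp
qed

section \<open>The longest element and its staircase word\<close>

lemma word_prod_rev_upto:
  "m \<le> n + 1 \<Longrightarrow> word_prod (rev [m..n]) \<langle>$\<rangle> j = (if j = m then n + 1 else if m < j \<and> j \<le> n + 1 then j - 1 else j)"
proof (induction "nat (n + 1 - m)" arbitrary: m j)
  case 0
  then show ?case by simp
next
  case (Suc k)
  then have "m \<le> n" by simp
  then show ?case using Suc(1)[of "m + 1"] Suc(2)
    by (simp add: upto_rec1[of m n] apply_times simple_refl_apply)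
qed

lemma word_prod_triangle:
  "1 \<le> m \<Longrightarrow> m \<le> N + 1 \<Longrightarrow> word_prod (concat (map (\<lambda>b. rev [b..N]) [m..N])) \<langle>$\<rangle> j =
    (if m \<le> j \<and> j \<le> N + 1 then m + N + 1 - j else j)"
proof (induction "nat (N + 1 - m)" arbitrary: m j)
  case 0
  then show ?case by simp
next
  case (Suc k)
  then have "m \<le> N" by simp
  from arg_cong[OF upto_rec1[OF this], of "\<lambda>xs. word_prod (concat (map (\<lambda>b. rev [b..N]) xs)) \<langle>$\<rangle> j"]
  have eq: "word_prod (concat (map (\<lambda>b. rev [b..N]) [m..N])) \<langle>$\<rangle> j =
      word_prod (rev [m..N]) \<langle>$\<rangle> (word_prod (concat (map (\<lambda>b. rev [b..N]) [m + 1..N])) \<langle>$\<rangle> j)"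
    by (simp add: apply_times)
  have IH: "word_prod (concat (map (\<lambda>b. rev [b..N]) [m + 1..N])) \<langle>$\<rangle> j =
      (if m + 1 \<le> j \<and> j \<le> N + 1 then m + 1 + N + 1 - j else j)"
    using Suc(2,3) \<open>m \<le> N\<close> by (intro Suc(1)) auto
  show ?case unfolding eq IH word_prod_rev_upto[OF Suc.prems(2)] using \<open>m \<le> N\<close> by auto
qed

lemma word_prod_triangle_list: "word_prod (map snd (triangle_list (int n - 1))) = longest n"
proof (rule perm_eqI)
  fix j
  have "map snd (triangle_list (int n - 1)) = concat (map (\<lambda>b. rev [b..int n - 1]) [1..int n - 1])"
    by (simp add: triangle_list_def map_concat comp_def)
  then show "word_prod (map snd (triangle_list (int n - 1))) \<langle>$\<rangle> j = longest n \<langle>$\<rangle> j"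
    using word_prod_triangle[of 1 "int n - 1" j]
    by (cases "n = 0") (simp_all add: longest.rep_eq)
qed

lemma sorted_factor_less_distinct: "sorted_wrt factor_less zs \<Longrightarrow> distinct zs"
  by (induction zs) (auto simp: factor_less_def)

lemmas distinct_triangle_list = sorted_factor_less_distinct[OF sorted_triangle_list]

text \<open>The factor (b, i) corresponds to the inversion (b, i + 1), so the word has as many
  letters as there are inversions.\<close>

lemma triangle_list_reduced: "map snd (triangle_list (int n - 1)) \<in> reduced_words (longest n)"
proof -
  let ?S = "set (triangle_list (int n - 1))"
  have "inversions (longest n) = (\<lambda>(b, i). (b, i + 1)) ` ?S"
  proof (intro equalityI subrelI)
    fix a b assume "(a, b) \<in> inversions (longest n)"
    then have "1 \<le> a" "a < b" "b \<le> int n" by (auto simp: inversions_def longest.rep_eq split: if_splits)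
    then have "(a, b - 1) \<in> ?S" by (simp add: set_triangle_list)
    then show "(a, b) \<in> (\<lambda>(b, i). (b, i + 1)) ` ?S" by force
  next
    fix a b assume "(a, b) \<in> (\<lambda>(b, i). (b, i + 1)) ` ?S"
    then show "(a, b) \<in> inversions (longest n)"
      by (auto simp: set_triangle_list inversions_def longest.rep_eq)
  qed
  then have "len (longest n) = card ?S" by (simp add: len_eq card_image inj_on_def case_prod_beta prod_eq_iff)
  then show ?thesis
    by (simp add: reduced_words_def word_prod_triangle_list distinct_card distinct_triangle_list)
qed

lemma sorted_factor_less_unique:
  assumes "sorted_wrt factor_less xs" "sorted_wrt factor_less ys" "set xs = set ys"
  shows "xs = ys"
  using assms
proof (induction xs arbitrary: ys)
  case (Cons x xs)
  then obtain y ys' where ys: "ys = y # ys'" by (cases ys) auto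
  have irr: "\<not> (factor_less p q \<and> factor_less q p)" "\<not> factor_less p p" for p q by (auto simp: factor_less_def)
  have "x = y" using Cons.prems irr unfolding ys by (metis list.set_intros(1) set_ConsD sorted_wrt.simps(2))
  moreover have "x \<notin> set xs" "y \<notin> set ys'"
    using Cons.prems irr(2)[of x] irr(2)[of y] unfolding ys by (simp_all del: split_paired_All) blast+
  ultimately have "set xs = set ys'" using Cons.prems(3) unfolding ys by auto
  then show ?case using Cons.IH[of ys'] Cons.prems \<open>x = y\<close> unfolding ys by simp
qed simp

text \<open>A chain for \<open>longest n\<close> uses distinct factors with letters below n, and it
  needs as many as the triangle contains; hence it uses all of them.\<close>

lemma factor_chains_longest: "int n - 1 \<le> N \<Longrightarrow>
    factor_chains (triangle_list N) (longest n) = {triangle_list (int n - 1)}"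
proof (intro equalityI subsetI)
  let ?L = "triangle_list (int n - 1)"
  fix zs assume zs: "zs \<in> factor_chains (triangle_list N) (longest n)"
  have par: "longest n \<in> parabolic 1 (int n - 1)" by (simp add: parabolic_def longest.rep_eq)
  have red: "map snd zs \<in> reduced_words (longest n)" using zs by (simp add: factor_chains_def)
  have "set zs \<subseteq> set ?L"
  proof (rule subrelI)
    fix b i assume "(b, i) \<in> set zs"
    moreover from this have "i \<le> int n - 1" using reduced_word_parabolic[OF red par] by force
    ultimately show "(b, i) \<in> set ?L" using zs by (auto simp: factor_chains_def set_triangle_list)
  qed
  moreover have "card (set zs) = card (set ?L)"
  proof -
    have "distinct zs"
      using zs by (intro sorted_factor_less_distinct) (simp add: factor_chains_def)
    then have "card (set zs) = length (map snd zs)" by (simp add: distinct_card)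
    also have "\<dots> = length (map snd ?L)"
      using red triangle_list_reduced[of n] by (simp only: reduced_words_def mem_Collect_eq)
    finally show ?thesis by (simp add: distinct_card distinct_triangle_list)
  qed
  ultimately have "set zs = set ?L" by (simp add: card_subset_eq)
  then have "zs = ?L"
    using zs sorted_triangle_list by (intro sorted_factor_less_unique) (auto simp: factor_chains_def)
  then show "zs \<in> {?L}" by simp
next
  fix zs assume "int n - 1 \<le> N" "zs \<in> {triangle_list (int n - 1)}"
  then show "zs \<in> factor_chains (triangle_list N) (longest n)"
    using triangle_list_reduced[of n] sorted_triangle_list
    by (auto simp: factor_chains_def set_triangle_list)
qed

lemma single_monomial_of: "Poly_Mapping.single (monomial_of bs) 1 = prod_list (map Var bs)"
proof (induction bs)
  case (Cons b bs)
  have "Poly_Mapping.single (monomial_of (b # bs)) 1 = Var b * Poly_Mapping.single (monomial_of bs) (1 :: rat)"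
    by (simp add: Var_def mult_single)
  then show ?case by (simp only: Cons.IH list.map prod_list.Cons)
qed simp

lemma schubert_pos_elt_longest:
  assumes "int n - 1 \<le> N"
  shows "nc (schubert_pos_elt N) (longest n) = (\<Prod>i = 1..n. Var (int i) ^ (n - i))"
proof -
  have "nc (schubert_pos_elt N) (longest n) = prod_list (map Var (map fst (triangle_list (int n - 1))))"
    by (simp add: nc_schubert_pos_elt factor_chains_longest[OF assms] single_monomial_of)
  also have "\<dots> = prod_list (map (\<lambda>b. Var b ^ nat (int n - b)) [1..int n - 1])"
  proof -
    have *: "prod_list (map (\<lambda>_. x) xs) = x ^ length xs" for x :: "int mpoly" and xs :: "int list"
      by (induction xs) simp_all
    show ?thesis
      unfolding triangle_list_def map_map prod_list_map_concat comp_def by (simp add: *)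
  qed
  also have "\<dots> = (\<Prod>b\<in>{1..int n - 1}. Var b ^ nat (int n - b))"
    by (simp add: prod.distinct_set_conv_list[symmetric])
  \<comment> \<open>The added index b = n carries the exponent 0.\<close>
  also have "\<dots> = (\<Prod>b\<in>int ` {1..n}. Var b ^ nat (int n - b))"
  proof (rule prod.mono_neutral_left)
    have "{1..int n} = int ` {1..n}" by (simp add: image_int_atLeastAtMost)
    then show "{1..int n - 1} \<subseteq> int ` {1..n}" and
      "\<forall>b\<in>int ` {1..n} - {1..int n - 1}. Var b ^ nat (int n - b) = 1" by auto
  qed simp
  also have "\<dots> = (\<Prod>i = 1..n. Var (int i) ^ (n - i))"
    by (subst prod.reindex) (auto simp: nat_diff_distrib intro!: prod.cong)
  finally show ?thesis .
qed

text \<open>The claim is about all large N because each divided difference requires i < N, and the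
  starting point n - 1 \<le> N. Every chain of divided differences ends in the same coefficient,
  whatever descents it takes.\<close>

lemma is_schubert_eventually:
  "is_schubert v f \<Longrightarrow> \<exists>N0. \<forall>N\<ge>N0. nc (schubert_pos_elt N) v = f"
proof (induction rule: is_schubert.induct)
  case (longest n)
  then show ?case using schubert_pos_elt_longest by blast
next
  case (descent w f i)
  then obtain N0 where "\<forall>N\<ge>N0. nc (schubert_pos_elt N) w = f" by blast
  then have "\<forall>N\<ge>max N0 (i + 1). nc (schubert_pos_elt N) (w * simple_refl i) = ddiff i f"
    using ddiff_schubert_pos_elt[OF descent(2) _ descent(3)] by force
  then show ?case by blast
qed

text \<open>Strictly falling values in {1..n} are squeezed: starting from position 1 bounds them
  above, starting from position n bounds them below.\<close>

lemma eq_longest: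
  assumes "v \<in> parabolic 1 (int n - 1)" "\<And>i. 1 \<le> i \<Longrightarrow> i < int n \<Longrightarrow> v \<langle>$\<rangle> (i + 1) < v \<langle>$\<rangle> i"
  shows "v = longest n"
proof (rule perm_eqI)
  fix j
  show "v \<langle>$\<rangle> j = longest n \<langle>$\<rangle> j"
  proof (cases "1 \<le> j \<and> j \<le> int n")
    case True
    have up: "int k < int n \<Longrightarrow> v \<langle>$\<rangle> (1 + int k) \<le> int n - int k" for k
    proof (induction k)
      case 0
      then show ?case using parabolic_range(2)[OF assms(1), of 1] by simp
    next
      case (Suc k)
      then show ?case using assms(2)[of "1 + int k"] by (simp add: algebra_simps)
    qed
    have down: "int k < int n \<Longrightarrow> 1 + int k \<le> v \<langle>$\<rangle> (int n - int k)" for k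
    proof (induction k)
      case 0
      then show ?case using parabolic_range(1)[OF assms(1), of "int n"] by simp
    next
      case (Suc k)
      then show ?case using assms(2)[of "int n - int k - 1"] by (simp add: algebra_simps)
    qed
    show ?thesis
      using up[of "nat (j - 1)"] down[of "nat (int n - j)"] True by (simp add: longest.rep_eq)
  next
    case False
    then show ?thesis using parabolic_apply[OF assms(1), of j] by (auto simp: longest.rep_eq)
  qed
qed

text \<open>An ascent of \<open>v\<close> leads to a longer element of which \<open>v\<close> is a
  descent step, so existence is inherited from above, and the climb can only stop at
  \<open>longest n\<close>. The measure uses the crude bound n * n for the number of
  inversions.\<close>

lemma ex_is_schubert:
  assumes "v \<in> parabolic 1 (int n - 1)"
  shows "\<exists>f. is_schubert v f"
  using assms
proof (induction "n * n - len v" arbitrary: v rule: less_induct)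
  case less
  show ?case
  proof (cases "\<exists>i. 1 \<le> i \<and> i < int n \<and> v \<langle>$\<rangle> i < v \<langle>$\<rangle> (i + 1)")
    case True
    then obtain i where i: "1 \<le> i" "i < int n" "v \<langle>$\<rangle> i < v \<langle>$\<rangle> (i + 1)" by blast
    let ?v = "v * simple_refl i"
    have par: "?v \<in> parabolic 1 (int n - 1)"
      using i less.prems by (intro parabolic_mult simple_refl_parabolic) auto
    have len: "len ?v = Suc (len v)" by (rule len_mult_simple_refl_ascent[OF i(3)])
    have "len ?v \<le> n * n"
    proof -

      have "inversions ?v \<subseteq> {1..int n} \<times> {1..int n}"
      proof (rule subrelI)
        fix a b assume "(a, b) \<in> inversions ?v"
        then have ab: "a < b" "?v \<langle>$\<rangle> b < ?v \<langle>$\<rangle> a" by (auto simp: inversions_def)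
        have A: "?v \<langle>$\<rangle> j = j" if "\<not> (1 \<le> j \<and> j \<le> int n)" for j
          using parabolic_apply[OF par, of j] that by auto
        have R: "1 \<le> ?v \<langle>$\<rangle> j \<and> ?v \<langle>$\<rangle> j \<le> int n" if "1 \<le> j \<and> j \<le> int n" for j
          using parabolic_range[OF par, of j] that by simp
        show "(a, b) \<in> {1..int n} \<times> {1..int n}"
          using A[of a] A[of b] R[of a] R[of b] ab
          by (cases "1 \<le> a \<and> a \<le> int n"; cases "1 \<le> b \<and> b \<le> int n"; auto)
      qed
      then have "card (inversions ?v) \<le> card ({1..int n} \<times> {1..int n})" by (intro card_mono) auto
      then show ?thesis by (simp add: len_eq)
    qed
    then have "\<exists>f. is_schubert ?v f" using len by (intro less.hyps[OF _ par]) simp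
    then obtain f where "is_schubert ?v f" ..
    from is_schubert.descent[OF this i(1)] len show ?thesis by auto
  next
    case False
    then have "v \<langle>$\<rangle> (i + 1) < v \<langle>$\<rangle> i" if "1 \<le> i" "i < int n" for i
      using apply_less_cases[of v i] that by blast
    then have "v = longest n" by (rule eq_longest[OF less.prems])
    then show ?thesis using is_schubert.longest by blast
  qed
qed

lemma schubert_pos_eq:
  assumes "v \<in> parabolic 1 N" "0 \<le> N"
  shows "schubert_pos v = nc (schubert_pos_elt N) v"
proof -
  have unique: "f = nc (schubert_pos_elt N) v" if f: "is_schubert v f" for f
  proof -
    obtain N0 where "\<forall>N\<ge>N0. nc (schubert_pos_elt N) v = f" using is_schubert_eventually[OF f] by blast
    then have "nc (schubert_pos_elt (max N N0)) v = f" by simp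
    then show ?thesis using nc_schubert_pos_elt_stable[OF assms(1), of "max N N0"] by simp
  qed
  have "v \<in> parabolic 1 (int (nat (N + 1)) - 1)" using assms by simp
  then obtain f where "is_schubert v f" using ex_is_schubert by blast
  then show ?thesis unfolding schubert_pos_def using unique by (metis the_equality)
qed

section \<open>The automorphism \<open>\<omega>\<close> and the factor in \<open>S\<^sub>-\<close>\<close>

lemma omega_perm_omega_perm [simp]: "omega_perm (omega_perm w) = w"
  by (rule perm_eqI) (simp add: omega_perm.rep_eq)

lemma omega_perm_1 [simp]: "omega_perm 1 = 1"
  by (rule perm_eqI) (simp add: omega_perm.rep_eq)

lemma omega_perm_eq_iff: "omega_perm v = w \<longleftrightarrow> v = omega_perm w"
  by auto

lemma word_prod_map_uminus: "word_prod (map uminus as) = omega_perm (word_prod as)"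
  by (induction as) (simp_all add: omega_perm_simple_refl omega_perm_mult)

lemma len_omega_perm [simp]: "len (omega_perm w) = len w"
proof -
  have "len (omega_perm w) \<le> len w" for w
  proof -
    obtain as where "as \<in> reduced_words w" by (rule ex_reduced_word)
    then show ?thesis using len_word_prod_le[of "map uminus as"]
      by (simp add: reduced_words_def word_prod_map_uminus)
  qed
  from this[of w] this[of "omega_perm w"] show ?thesis by simp
qed

text \<open>The semilinear extension of \<omega>: it sends c u_w to \<omega>(c) u_{\<omega>(w)},
  acting on scalars and basis together.\<close>

definition omega_nilcox :: "int mpoly nilcox \<Rightarrow> int mpoly nilcox" where
  "omega_nilcox f = Nilcox (\<lambda>w. omega_poly (nc f (omega_perm w)))"

lemma nc_omega_nilcox: "nc (omega_nilcox f) w = omega_poly (nc f (omega_perm w))"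
  by (simp add: omega_nilcox_def Nilcox_inverse)

lemma ring_hom_omega_poly: "ring_hom omega_poly"
  by (simp add: omega_poly_def ring_hom_psubst)

lemmas omega_poly_simps = ring_hom_simps[OF ring_hom_omega_poly]

lemma ring_hom_omega_nilcox: "ring_hom omega_nilcox"
proof (rule ring_homI; rule nilcox_eqI)
  fix f g :: "int mpoly nilcox" and w
  have "nc (omega_nilcox (f * g)) w =
      (\<Sum>(x, y)\<in>factorizations (omega_perm w). omega_poly (nc f x) * omega_poly (nc g y))"
    by (simp add: nc_omega_nilcox nc_mult ring_hom_sum[OF ring_hom_omega_poly] omega_poly_simps case_prod_beta)
  moreover have len: "len (omega_perm x * omega_perm y) = len (x * y)" for x y
    by (simp flip: omega_perm_mult)
  have "(\<Sum>(x, y)\<in>factorizations (omega_perm w). omega_poly (nc f x) * omega_poly (nc g y)) =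
      (\<Sum>(x, y)\<in>factorizations w. omega_poly (nc f (omega_perm x)) * omega_poly (nc g (omega_perm y)))"
    by (rule sum.reindex_bij_witness[where i = "\<lambda>(x, y). (omega_perm x, omega_perm y)" and
          j = "\<lambda>(x, y). (omega_perm x, omega_perm y)"])
      (auto simp: factorizations_iff omega_perm_mult omega_perm_eq_iff len)
  ultimately show "nc (omega_nilcox (f * g)) w = nc (omega_nilcox f * omega_nilcox g) w"
    by (simp add: nc_mult nc_omega_nilcox)
qed (auto simp: nc_omega_nilcox omega_poly_simps omega_perm_eq_iff)

lemma omega_nilcox_hfac: "omega_nilcox (hfac i x) = hfac (- i) (omega_poly x)"
proof -
  have "[i] \<in> reduced_words (omega_perm w) \<longleftrightarrow> [- i] \<in> reduced_words w" for w
    by (auto simp: reduced_words_def omega_perm_simple_refl)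
      (metis omega_perm_omega_perm omega_perm_simple_refl)+
  then have "omega_nilcox (word_elt [i] x) = word_elt [- i] (omega_poly x)"
    by (intro nilcox_eqI) (simp add: nc_omega_nilcox nc_word_elt omega_poly_simps)
  then show ?thesis by (simp add: hfac_def ring_hom_simps[OF ring_hom_omega_nilcox])
qed

lemma rev_map_minus_upto: "rev (map (\<lambda>i. c - i) [a..b]) = [c - b..c - a]" for a b c :: int
proof (induction "nat (b - a + 1)" arbitrary: b)
  case (Suc k)
  then have "a \<le> b" by simp
  moreover have "rev (map (\<lambda>i. c - i) [a..b - 1]) = [c - (b - 1)..c - a]"
    using Suc by (intro Suc(1)) simp
  ultimately show ?case by (simp add: upto_rec2[of a b] upto_rec1[of "c - b" "c - a"] algebra_simps)
qed simp

text \<open>Negating letters turns a falling product into a rising one, and x_b becomes -x_{1-b}, so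
  each \<open>desc\<close> goes to an inverse factor. This is why the remainder of the telescoping
  is the generating function for \<open>S_neg\<close>.\<close>

lemma omega_schubert_pos_elt: "omega_nilcox (schubert_pos_elt N) = schubert_neg_elt N"
proof -
  have d: "omega_nilcox (desc b N (Var b)) = asc (- N) ((1 - b) - 1) (- Var (1 - b))" for b
  proof -
    have "omega_nilcox (desc b N (Var b)) = prod_list (map (\<lambda>i. hfac i (- Var (1 - b))) (rev (map uminus [b..N])))"
      by (simp add: desc_def ring_hom_prod_list[OF ring_hom_omega_nilcox] comp_def omega_nilcox_hfac
          omega_poly_def rev_map)
    also have "rev (map uminus [b..N]) = [- N..- b]"
      using rev_map_minus_upto[of 0 b N] by simp
    finally show ?thesis by (simp add: asc_def)
  qed
  have "omega_nilcox (schubert_pos_elt N) =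
      prod_list (map (\<lambda>b. asc (- N) (b - 1) (- Var b)) (map (\<lambda>b. 1 - b) [1..N]))"
    by (simp add: schubert_pos_elt_def ring_hom_prod_list[OF ring_hom_omega_nilcox] comp_def d)
  also have "map (\<lambda>b. 1 - b) [1..N] = rev [1 - N..0]"
    using arg_cong[OF rev_map_minus_upto[of 1 1 N], of rev] by simp
  finally show ?thesis by (simp add: schubert_neg_elt_def)
qed

lemma nc_schubert_neg_elt: "nc (schubert_neg_elt N) u = omega_poly (nc (schubert_pos_elt N) (omega_perm u))"
  by (simp add: nc_omega_nilcox flip: omega_schubert_pos_elt)

lemma omega_perm_S_neg: "omega_perm u \<in> S_pos \<longleftrightarrow> u \<in> S_neg"
proof -
  have "(\<forall>j\<le>0. 1 - u \<langle>$\<rangle> (1 - j) = j) \<longleftrightarrow> (\<forall>j\<ge>1. u \<langle>$\<rangle> j = j)"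
  proof
    assume *: "\<forall>j\<le>0. 1 - u \<langle>$\<rangle> (1 - j) = j"
    show "\<forall>j\<ge>1. u \<langle>$\<rangle> j = j"
    proof (intro allI impI)
      fix j :: int assume "1 \<le> j"
      then show "u \<langle>$\<rangle> j = j" using spec[OF *, of "1 - j"] by simp
    qed
  qed auto
  then show ?thesis by (simp add: S_pos_eq S_neg_eq omega_perm.rep_eq)
qed

lemma S_pos_parabolic: "v \<in> S_pos \<Longrightarrow> v \<in> parabolic (- N) N \<Longrightarrow> v \<in> parabolic 1 N"
  by (auto simp: S_pos_eq parabolic_def)

lemma omega_perm_parabolic: "u \<in> parabolic (- N) N \<Longrightarrow> omega_perm u \<in> parabolic (- N) N"
  by (auto simp: parabolic_def omega_perm.rep_eq)

lemma nc_schubert_pos_elt_eq_0: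
  assumes "v \<notin> S_pos"
  shows "nc (schubert_pos_elt N) v = 0"
proof -
  have "factor_chains (triangle_list N) v = {}"
  proof (rule equals0I)
    fix zs assume zs: "zs \<in> factor_chains (triangle_list N) v"
    then have "\<forall>i\<in>set (map snd zs). 1 \<le> i"
      by (fastforce simp: factor_chains_def set_triangle_list)
    moreover have "word_prod (map snd zs) = v" using zs by (simp add: factor_chains_def reduced_words_def)
    ultimately show False using assms unfolding S_pos_def by blast
  qed
  then show ?thesis by (simp add: nc_schubert_pos_elt)
qed

lemma schubert_nonzero_eq:
  assumes "u \<in> S_neg" "v \<in> S_pos"
  shows "schubert_nonzero (u * v) = schubert_neg u * schubert_pos v"
  unfolding schubert_nonzero_def
proof (rule the_equality)
  show "\<exists>u'\<in>S_neg. \<exists>v'\<in>S_pos. u * v = u' * v' \<and> schubert_neg u * schubert_pos v = schubert_neg u' * schubert_pos v'"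
    using assms by blast
  fix f assume "\<exists>u'\<in>S_neg. \<exists>v'\<in>S_pos. u * v = u' * v' \<and> f = schubert_neg u' * schubert_pos v'"
  then show "f = schubert_neg u * schubert_pos v" using S_neg_pos_unique[OF assms] by metis
qed

text \<open>A nonzero term requires u in \<open>S_neg\<close> and v in \<open>S_pos\<close>; such a
  factorization is unique and automatically reduced.\<close>

lemma nc_poly_elt:
  assumes "y \<in> parabolic (- N) N" "0 \<le> N"
  shows "nc (poly_elt N) y = (if y \<in> S_nonzero then schubert_nonzero y else 0)"
proof -
  have zero: "nc (schubert_neg_elt N) u * nc (schubert_pos_elt N) v = 0" if "\<not> (u \<in> S_neg \<and> v \<in> S_pos)" for u v
    using that nc_schubert_pos_elt_eq_0[of v N] nc_schubert_pos_elt_eq_0[of "omega_perm u" N]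
    by (auto simp: nc_schubert_neg_elt omega_perm_S_neg omega_poly_simps)
  show ?thesis
  proof (cases "y \<in> S_nonzero")
    case False
    have "nc (schubert_neg_elt N) u * nc (schubert_pos_elt N) v = 0" if "(u, v) \<in> factorizations y" for u v
      using that False by (intro zero) (auto simp: factorizations_iff S_nonzero_def)
    then show ?thesis using False by (auto simp: poly_elt_def nc_mult intro!: sum.neutral)
  next
    case True
    then obtain u v where y: "y = u * v" and uv: "u \<in> S_neg" "v \<in> S_pos" by (auto simp: S_nonzero_def)
    have fact: "(u, v) \<in> factorizations y" by (simp add: factorizations_iff y len_S_neg_pos[OF uv])
    then have par: "u \<in> parabolic (- N) N" "v \<in> parabolic (- N) N"
      using reduced_product_parabolic[OF _ assms(1)] by (auto simp: factorizations_def)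
    have pos: "nc (schubert_pos_elt N) v = schubert_pos v"
      using schubert_pos_eq[OF S_pos_parabolic[OF uv(2) par(2)] assms(2)] by simp
    have "omega_perm u \<in> parabolic 1 N"
      using uv(1) par(1) by (intro S_pos_parabolic omega_perm_parabolic) (simp_all add: omega_perm_S_neg)
    then have neg: "nc (schubert_neg_elt N) u = schubert_neg u"
      using schubert_pos_eq[OF _ assms(2)] by (simp add: nc_schubert_neg_elt schubert_neg_def)
    have "nc (poly_elt N) y = nc (schubert_neg_elt N) u * nc (schubert_pos_elt N) v"
      unfolding poly_elt_def nc_mult
    proof (subst sum_Pair_delta[where p = "(u, v)"])
      fix u' v' assume *: "(u', v') \<in> factorizations y" "(u', v') \<noteq> (u, v)"
      then have "\<not> (u' \<in> S_neg \<and> v' \<in> S_pos)"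
        using S_neg_pos_unique[OF uv, of u' v'] by (auto simp: factorizations_iff y)
      then show "nc (schubert_neg_elt N) u' * nc (schubert_pos_elt N) v' = 0" by (rule zero)
    qed (use fact in auto)
    then show ?thesis using True by (simp add: pos neg y schubert_nonzero_eq[OF uv])
  qed
qed

theorem theorem3p16:
  fixes w :: "int perm"
  shows "coaction (back_schubert w) =
           (\<Sum>(x, y)\<in>{(x, y). reduced_product w x y}.
              stanley x \<otimes>\<^sub>\<rat> back_schubert y) \<and>
         back_schubert w =
           (\<Sum>(x, y)\<in>{(x, y). reduced_product w x y \<and> y \<in> S_nonzero}.
              of_Lam (stanley x) * of_poly (schubert_nonzero y))"
proof
  show "coaction (back_schubert w) =
      (\<Sum>(x, y)\<in>{(x, y). reduced_product w x y}. stanley x \<otimes>\<^sub>\<rat> back_schubert y)"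
    using coaction_back_schubert[of w] by (simp add: factorizations_def)
  obtain n where "w \<in> parabolic (- int n) (int n)" using ex_parabolic by blast
  then obtain N where w: "w \<in> parabolic (- N) N" and N: "0 \<le> N" by auto
  \<comment> \<open>The coefficient of F (G_- G_+) at \<open>w\<close> has one term for each reduced
    factorization; those with y outside \<open>S_nonzero\<close> vanish.\<close>
  have "back_schubert w = (\<Sum>(x, y)\<in>factorizations w. of_Lam (nc (stanley_elt (- N) N) x) * of_poly (nc (poly_elt N) y))"
    by (simp add: back_schubert_eq[OF w N] back_schubert_elt_def nc_mult)
  also have "\<dots> = (\<Sum>(x, y)\<in>{(x, y). reduced_product w x y \<and> y \<in> S_nonzero}.
      of_Lam (stanley x) * of_poly (schubert_nonzero y))"
  proof (rule sum.mono_neutral_cong_right[OF finite_factorizations])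
    show "\<forall>p\<in>factorizations w - {(x, y). reduced_product w x y \<and> y \<in> S_nonzero}.
        (case p of (x, y) \<Rightarrow> of_Lam (nc (stanley_elt (- N) N) x) * of_poly (nc (poly_elt N) y)) = 0"
      using reduced_product_parabolic[OF _ w]
      by (auto simp: factorizations_def nc_poly_elt[OF _ N] ring_hom_simps[OF ring_hom_of_poly] split: if_splits)
    show "(case p of (x, y) \<Rightarrow> of_Lam (nc (stanley_elt (- N) N) x) * of_poly (nc (poly_elt N) y)) =
        (case p of (x, y) \<Rightarrow> of_Lam (stanley x) * of_poly (schubert_nonzero y))"
      if "p \<in> {(x, y). reduced_product w x y \<and> y \<in> S_nonzero}" for p
      using that reduced_product_parabolic[OF _ w]
      by (auto simp: nc_poly_elt[OF _ N] stanley_eq[OF _ N])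
  qed (auto simp: factorizations_def)
  finally show "back_schubert w = (\<Sum>(x, y)\<in>{(x, y). reduced_product w x y \<and> y \<in> S_nonzero}.
      of_Lam (stanley x) * of_poly (schubert_nonzero y))" .
qed

end
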